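(* Let $r\in(1,\infty)$, $m$ a $w$-moderate weight, and assume that $\mathrm{span}\{\lambda(x)K\}_{x\in G}$ is dense in $\mathcal M_{r,m}$. Let the discretization data $(Q_n,Y_n,\mathcal I,\{\psi_{n,x}\},X_n,T_n)$ be as in the context, and assume there is $p\in[1,r)$ such that, for all $n\in\mathbb N$, $K\in L_{p,w}(G)\cap L_{p,w\Delta^{-1/p}}(G)$ and $\mathrm{osc}_{Q_n}(K)\in L_{p,w}(G)\cap L_{p,w\Delta^{-1/p}}(G)$. For each $n$ let $S_n:V_n\to L_{r,m}(G)$ be any linear right inverse of $T_n$ (viewed as a map onto $V_n:=\mathrm{Ran}\,T_n$), with operator norm $\|S_n\|$, and set $C_n=|Q_n|^{1/r'}\cdot\sup_{q\in Q_n}w(q)\cdot\|S_n\|$. (i) For every $\varepsilon>0$ and $T\in\mathrm{Co}(L_{r,m})$ there is $n^*\in\mathbb N$ such that for every $n\ge n^*$ there exist coefficients $(c_{n,x})_{x\in X_n}$ with $\big\|T-\sum_{x\in X_n}c_{n,x}\pi(x)u\big\|_{\mathrm{Co}(L_{r,m})}\le\varepsilon$ and $\big(\sum_{x\in X_n}|c_{n,x}|^r m(x)^r\big)^{1/r}\le C_n(1+\varepsilon)\|T\|_{\mathrm{Co}(L_{r,m})}$. (ii) Let $q$ be defined by $1/q+1/p=1+1/r$. For every $n\in\mathbb N$ and every $d=(d_x)_{x\in Y_n}$ with $(m(x)d_x)_{x}\in\ell_q(Y_n)$, the element $T=\sum_{x\in Y_n}d_x\pi(x)u$ belongs to $\mathrm{Co}(L_{r,m})$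 and $\|T\|_{\mathrm{Co}(L_{r,m})}\le D_n\,\|(m(x)d_x)_x\|_{\ell_q}$, where $D_n=|Q_n|^{1/q-1}\,\mathcal I^{1-1/q}\,\sup_{q'\in Q_n}w(q')\,\theta_n$ and $\theta_n=\max\{\|\mathrm{osc}_{Q_n}(K)+|K|\|_{L_{p,w}},\ \|\mathrm{osc}_{Q_n}(K)+|K|\|_{L_{p,w\Delta^{-1/p}}}\}$.
   Context: Setting. $G$ is a locally compact, second countable group with left Haar measure (integrals written $\int_G f(x)\,dx$, $|E|$ denotes the Haar measure of $E$), identity $e$ and modular function $\Delta$. For measurable $f,g$: $(f*g)(x)=\int_G f(y)g(y^{-1}x)\,dy$, $\lambda(x)f(y)=f(x^{-1}y)$, $\langle f,g\rangle_{L_2}=\int_G f\overline g$. $w:G\to(0,\infty)$ is a fixed continuous weight with $w(xy)\le w(x)w(y)$ and $w(x)=w(x^{-1})$. For a weight $v>0$ and $p\in[1,\infty]$, $L_{p,v}(G)$ is the space of measurable $f$ with $\|f\|_{L_{p,v}}:=\|vf\|_{L_p}<\infty$. A continuous $m:G\to(0,\infty)$ is $w$-moderate if $m(xy)\le w(x)m(y)$ and $m(xy)\le m(x)w(y)$ for all $x,y$. $\pi$ is a strongly continuous unitary representation of $G$ on a separable complex Hilbert space $\mathcal H$, and $u\in\mathcal H$ is such that $Vv(x)=\langle v,\pi(x)u\rangle_{\mathcal H}$ is an isometry $\mathcal H\to L_2(G)$; $K(x)=\langle u,\pi(x)u\rangle_{\mathcal H}$. Standing assumption: $K\in L_{p,w}(G)$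 for all $p\in(1,\infty)$. $\mathcal S_w=\{v\in\mathcal H:Vv\in L_{p,w}(G)\ \forall p\in(1,\infty)\}$ (Fréchet space with seminorms $\|Vv\|_{L_{p,w}}$), $\mathcal S_w'$ its anti-dual with pairing $\langle\cdot,\cdot\rangle_{\mathcal S_w}$, $\mathcal H\hookrightarrow\mathcal S_w'$, $V_eT(x)=\langle T,\pi(x)u\rangle_{\mathcal S_w}$. $\mathrm{Co}(L_{r,m})=\{T\in\mathcal S_w':V_eT\in L_{r,m}(G)\}$, $\|T\|_{\mathrm{Co}(L_{r,m})}=\|V_eT\|_{L_{r,m}}$; $\mathcal M_{r,m}=\{f\in L_{r,m}(G):f*K=f\}$; $V_e:\mathrm{Co}(L_{r,m})\to\mathcal M_{r,m}$ is an isometric isomorphism with $V_e(\pi(x)u)=\lambda(x)K$. $r'$ is the conjugate exponent of $r$. Oscillation: $\mathrm{osc}_Q f(x)=\sup_{u\in Q}|f(ux)-f(x)|$. Discretization data. For each $n\in\mathbb N$: $Q_n$ is a compact neighbourhood of $e$; $Y_n\subset G$ is countable with $Y_n\subset Y_{n+1}$, $\bigcup_nY_n$ dense in $G$, $G=\bigcup_{x\in Y_n}xQ_n$; there is an integer $\mathcal I$ independent of $n$ and a decomposition $Y_n=\bigcup_{i=1}^{\mathcal I}Z_{n,i}$ such that $xQ_n\cap yQ_n\neq\emptyset$ for $x,y\in Z_{n,i}$ only if $x=y$. $\{\psi_{n,x}\}_{x\in Y_n}$ are measurable functions with $0\le\psi_{n,x}\le1$, $\sum_{x\in Y_n}\psi_{n,x}\equiv1$,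 $\mathrm{supp}\,\psi_{n,x}\subset xQ_n$, and linearly independent as a.e.-defined functions (finite linear combinations vanishing a.e. have zero coefficients). $X_n\subset Y_n$ are finite sets with $X_n\subset X_{n+1}$ and $\bigcup_nX_n$ dense in $G$. $T_n:L_{r,m}(G)\to\mathcal M_{r,m}$, $T_nF=\sum_{x\in X_n}\langle F,\psi_{n,x}\rangle_{L_2}\lambda(x)K$. *)

theory Defs
  imports "HOL-Analysis.Analysis"
begin

text \<open>Conventions.  The group G is a type 'g of class topological_group_add
(NOT assumed commutative): the group product x y is written x + y, the inverse
x^-1 is -x and the identity e is 0.  Functions on G are complex valued.\<close>

definition lcsc_group :: "'g::{topological_group_add,t2_space,second_countable_topology} itself \<Rightarrow> bool" where
  "lcsc_group _ \<longleftrightarrow> locally_compact_space (euclidean :: 'g topology)"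

text \<open>A left Haar measure: a nonzero left-invariant Borel measure that is finite on
compact sets and positive on nonempty open sets (on a second countable locally compact
Hausdorff group such a measure is automatically regular).\<close>
definition left_haar :: "('g::{topological_group_add,t2_space}) measure \<Rightarrow> bool" where
  "left_haar M \<longleftrightarrow> sets M = sets borel \<and> space M = UNIV \<and>
     (\<forall>x A. A \<in> sets M \<longrightarrow> emeasure M ((\<lambda>y. x + y) ` A) = emeasure M A) \<and>
     (\<forall>C. compact C \<longrightarrow> emeasure M C < \<infinity>) \<and>
     (\<forall>U. open U \<and> U \<noteq> {} \<longrightarrow> emeasure M U > 0)"

definition modular_function :: "('g::group_add) measure \<Rightarrow> ('g \<Rightarrow> real) \<Rightarrow> bool" where
  "modular_function M \<Delta> \<longleftrightarrow> (\<forall>x. \<Delta> x > 0) \<and>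
     (\<forall>x E. E \<in> sets M \<longrightarrow> emeasure M ((\<lambda>y. y + x) ` E) = ennreal (\<Delta> x) * emeasure M E)"

definition in_Lp :: "'g measure \<Rightarrow> real \<Rightarrow> ('g \<Rightarrow> complex) \<Rightarrow> bool" where
  "in_Lp M p f \<longleftrightarrow> f \<in> borel_measurable M \<and> integrable M (\<lambda>x. norm (f x) powr p)"

definition Lp_norm :: "'g measure \<Rightarrow> real \<Rightarrow> ('g \<Rightarrow> complex) \<Rightarrow> real" where
  "Lp_norm M p f = (\<integral>x. norm (f x) powr p \<partial>M) powr (1 / p)"

definition in_Lpw :: "'g measure \<Rightarrow> real \<Rightarrow> ('g \<Rightarrow> real) \<Rightarrow> ('g \<Rightarrow> complex) \<Rightarrow> bool" where
  "in_Lpw M p v f \<longleftrightarrow> f \<in> borel_measurable M \<and> in_Lp M p (\<lambda>x. complex_of_real (v x) * f x)"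

definition Lpw_norm :: "'g measure \<Rightarrow> real \<Rightarrow> ('g \<Rightarrow> real) \<Rightarrow> ('g \<Rightarrow> complex) \<Rightarrow> real" where
  "Lpw_norm M p v f = Lp_norm M p (\<lambda>x. complex_of_real (v x) * f x)"

definition conv :: "('g::group_add) measure \<Rightarrow> ('g \<Rightarrow> complex) \<Rightarrow> ('g \<Rightarrow> complex) \<Rightarrow> 'g \<Rightarrow> complex" where
  "conv M f g x = (\<integral>y. f y * g (- y + x) \<partial>M)"

definition ltrans :: "'g::group_add \<Rightarrow> ('g \<Rightarrow> complex) \<Rightarrow> 'g \<Rightarrow> complex" where
  "ltrans x f y = f (- x + y)"

definition L2_inner :: "'g measure \<Rightarrow> ('g \<Rightarrow> complex) \<Rightarrow> ('g \<Rightarrow> complex) \<Rightarrow> complex" where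
  "L2_inner M f g = (\<integral>x. f x * cnj (g x) \<partial>M)"

definition osc :: "('g::group_add) set \<Rightarrow> ('g \<Rightarrow> complex) \<Rightarrow> 'g \<Rightarrow> real" where
  "osc Q f x = Sup ((\<lambda>u. norm (f (u + x) - f x)) ` Q)"

definition weight :: "('g::{topological_space,group_add} \<Rightarrow> real) \<Rightarrow> bool" where
  "weight w \<longleftrightarrow> continuous_on UNIV w \<and> (\<forall>x. w x > 0) \<and>
     (\<forall>x y. w (x + y) \<le> w x * w y) \<and> (\<forall>x. w (- x) = w x)"

definition moderate :: "('g::{topological_space,group_add} \<Rightarrow> real) \<Rightarrow> ('g \<Rightarrow> real) \<Rightarrow> bool" where
  "moderate w m \<longleftrightarrow> continuous_on UNIV m \<and> (\<forall>x. m x > 0) \<and>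
     (\<forall>x y. m (x + y) \<le> w x * m y \<and> m (x + y) \<le> m x * w y)"

text \<open>The Hilbert space is a type 'h with addition (ab_group_add), a complex scalar
multiplication sc and an inner product ip (linear in the first, conjugate linear in the
second argument).\<close>

definition hnorm :: "('h \<Rightarrow> 'h \<Rightarrow> complex) \<Rightarrow> 'h \<Rightarrow> real" where
  "hnorm ip v = sqrt (Re (ip v v))"

definition complex_hilbert :: "(complex \<Rightarrow> 'h::ab_group_add \<Rightarrow> 'h) \<Rightarrow> ('h \<Rightarrow> 'h \<Rightarrow> complex) \<Rightarrow> bool" where
  "complex_hilbert sc ip \<longleftrightarrow>
     (\<forall>v. sc 1 v = v) \<and> (\<forall>a b v. sc a (sc b v) = sc (a * b) v) \<and>
     (\<forall>a b v. sc (a + b) v = sc a v + sc b v) \<and> (\<forall>a v v'. sc a (v + v') = sc a v + sc a v') \<and>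
     (\<forall>v v' w. ip (v + v') w = ip v w + ip v' w) \<and> (\<forall>a v w. ip (sc a v) w = a * ip v w) \<and>
     (\<forall>v w. ip v w = cnj (ip w v)) \<and> (\<forall>v. Re (ip v v) \<ge> 0) \<and> (\<forall>v. ip v v = 0 \<longrightarrow> v = 0) \<and>
     (\<forall>f :: nat \<Rightarrow> 'h. (\<forall>\<epsilon>>0. \<exists>N. \<forall>i\<ge>N. \<forall>j\<ge>N. hnorm ip (f i - f j) < \<epsilon>) \<longrightarrow>
         (\<exists>v. (\<lambda>n. hnorm ip (f n - v)) \<longlonglongrightarrow> 0)) \<and>
     (\<exists>D. countable D \<and> (\<forall>v. \<forall>\<epsilon>>0. \<exists>d\<in>D. hnorm ip (v - d) < \<epsilon>))"

definition unitary_rep :: "(complex \<Rightarrow> 'h::ab_group_add \<Rightarrow> 'h) \<Rightarrow> ('h \<Rightarrow> 'h \<Rightarrow> complex) \<Rightarrow>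
    ('g::{topological_space,group_add} \<Rightarrow> 'h \<Rightarrow> 'h) \<Rightarrow> bool" where
  "unitary_rep sc ip \<pi> \<longleftrightarrow>
     (\<forall>x v v'. \<pi> x (v + v') = \<pi> x v + \<pi> x v') \<and> (\<forall>x a v. \<pi> x (sc a v) = sc a (\<pi> x v)) \<and>
     (\<forall>x v v'. ip (\<pi> x v) (\<pi> x v') = ip v v') \<and> (\<forall>x. surj (\<pi> x)) \<and>
     (\<forall>x y. \<pi> (x + y) = \<pi> x \<circ> \<pi> y) \<and> \<pi> 0 = id \<and>
     (\<forall>v x0. ((\<lambda>x. hnorm ip (\<pi> x v - \<pi> x0 v)) \<longlongrightarrow> 0) (at x0))"

definition voice :: "('h \<Rightarrow> 'h \<Rightarrow> complex) \<Rightarrow> ('g \<Rightarrow> 'h \<Rightarrow> 'h) \<Rightarrow> 'h \<Rightarrow> 'h \<Rightarrow> 'g \<Rightarrow> complex" where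
  "voice ip \<pi> u v x = ip v (\<pi> x u)"

definition kernel :: "('h \<Rightarrow> 'h \<Rightarrow> complex) \<Rightarrow> ('g \<Rightarrow> 'h \<Rightarrow> 'h) \<Rightarrow> 'h \<Rightarrow> 'g \<Rightarrow> complex" where
  "kernel ip \<pi> u x = ip u (\<pi> x u)"

definition Sw :: "'g measure \<Rightarrow> ('g \<Rightarrow> real) \<Rightarrow> ('h \<Rightarrow> 'h \<Rightarrow> complex) \<Rightarrow> ('g \<Rightarrow> 'h \<Rightarrow> 'h) \<Rightarrow> 'h \<Rightarrow> 'h set" where
  "Sw M w ip \<pi> u = {v. \<forall>p>1. in_Lpw M p w (voice ip \<pi> u v)}"

text \<open>Continuous anti-linear functionals on the Frechet space S_w (seminorms
||V v||_{L_{p,w}}, p in (1,oo)); the pairing <T, v>_{S_w} is T v.\<close>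
definition Sw_dual :: "'g measure \<Rightarrow> ('g \<Rightarrow> real) \<Rightarrow> (complex \<Rightarrow> 'h::ab_group_add \<Rightarrow> 'h) \<Rightarrow>
    ('h \<Rightarrow> 'h \<Rightarrow> complex) \<Rightarrow> ('g \<Rightarrow> 'h \<Rightarrow> 'h) \<Rightarrow> 'h \<Rightarrow> ('h \<Rightarrow> complex) set" where
  "Sw_dual M w sc ip \<pi> u = {T.
     (\<forall>a b v v'. v \<in> Sw M w ip \<pi> u \<longrightarrow> v' \<in> Sw M w ip \<pi> u \<longrightarrow>
         T (sc a v + sc b v') = cnj a * T v + cnj b * T v') \<and>
     (\<exists>P C. finite P \<and> P \<subseteq> {1<..} \<and>
         (\<forall>v \<in> Sw M w ip \<pi> u. norm (T v) \<le> C * (\<Sum>p\<in>P. Lpw_norm M p w (voice ip \<pi> u v))))}"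

definition emb :: "('h \<Rightarrow> 'h \<Rightarrow> complex) \<Rightarrow> 'h \<Rightarrow> 'h \<Rightarrow> complex" where
  "emb ip v = (\<lambda>s. ip v s)"

definition ext_voice :: "('g \<Rightarrow> 'h \<Rightarrow> 'h) \<Rightarrow> 'h \<Rightarrow> ('h \<Rightarrow> complex) \<Rightarrow> 'g \<Rightarrow> complex" where
  "ext_voice \<pi> u T x = T (\<pi> x u)"

definition Co :: "'g measure \<Rightarrow> ('g \<Rightarrow> real) \<Rightarrow> (complex \<Rightarrow> 'h::ab_group_add \<Rightarrow> 'h) \<Rightarrow>
    ('h \<Rightarrow> 'h \<Rightarrow> complex) \<Rightarrow> ('g \<Rightarrow> 'h \<Rightarrow> 'h) \<Rightarrow> 'h \<Rightarrow> real \<Rightarrow> ('g \<Rightarrow> real) \<Rightarrow> ('h \<Rightarrow> complex) set" where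
  "Co M w sc ip \<pi> u r m = {T \<in> Sw_dual M w sc ip \<pi> u. in_Lpw M r m (ext_voice \<pi> u T)}"

definition Co_norm :: "'g measure \<Rightarrow> ('g \<Rightarrow> 'h \<Rightarrow> 'h) \<Rightarrow> 'h \<Rightarrow> real \<Rightarrow> ('g \<Rightarrow> real) \<Rightarrow> ('h \<Rightarrow> complex) \<Rightarrow> real" where
  "Co_norm M \<pi> u r m T = Lpw_norm M r m (ext_voice \<pi> u T)"

definition Mspace :: "('g::group_add) measure \<Rightarrow> real \<Rightarrow> ('g \<Rightarrow> real) \<Rightarrow> ('g \<Rightarrow> complex) \<Rightarrow> ('g \<Rightarrow> complex) set" where
  "Mspace M r m K = {f. in_Lpw M r m f \<and> (AE x in M. conv M f K x = f x)}"

definition discretization ::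
  "('g::{topological_group_add,t2_space}) measure \<Rightarrow> (nat \<Rightarrow> 'g set) \<Rightarrow> (nat \<Rightarrow> 'g set) \<Rightarrow> nat \<Rightarrow>
   (nat \<Rightarrow> 'g \<Rightarrow> 'g \<Rightarrow> real) \<Rightarrow> (nat \<Rightarrow> 'g set) \<Rightarrow> bool" where
  "discretization M Q Y I \<psi> X \<longleftrightarrow>
     (\<forall>n. compact (Q n) \<and> 0 \<in> interior (Q n)) \<and>
     (\<forall>n. countable (Y n) \<and> Y n \<subseteq> Y (Suc n)) \<and> closure (\<Union>n. Y n) = UNIV \<and>
     (\<forall>n. (\<Union>x\<in>Y n. (\<lambda>q. x + q) ` Q n) = UNIV) \<and>
     (\<exists>Z :: nat \<Rightarrow> nat \<Rightarrow> 'g set. \<forall>n. Y n = (\<Union>i\<in>{1..I}. Z n i) \<and>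
        (\<forall>i\<in>{1..I}. \<forall>x\<in>Z n i. \<forall>y\<in>Z n i.
           ((\<lambda>q. x + q) ` Q n) \<inter> ((\<lambda>q. y + q) ` Q n) \<noteq> {} \<longrightarrow> x = y)) \<and>
     (\<forall>n. \<forall>x\<in>Y n. \<psi> n x \<in> borel_measurable M \<and> (\<forall>g. 0 \<le> \<psi> n x g \<and> \<psi> n x g \<le> 1) \<and>
        {g. \<psi> n x g \<noteq> 0} \<subseteq> (\<lambda>q. x + q) ` Q n) \<and>
     (\<forall>n g. ((\<lambda>x. \<psi> n x g) has_sum 1) (Y n)) \<and>
     (\<forall>n F (a :: 'g \<Rightarrow> complex). finite F \<longrightarrow> F \<subseteq> Y n \<longrightarrow>
        (AE g in M. (\<Sum>x\<in>F. a x * complex_of_real (\<psi> n x g)) = 0) \<longrightarrow> (\<forall>x\<in>F. a x = 0)) \<and>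
     (\<forall>n. finite (X n) \<and> X n \<subseteq> Y n \<and> X n \<subseteq> X (Suc n)) \<and> closure (\<Union>n. X n) = UNIV"

definition Tn :: "'g measure \<Rightarrow> (nat \<Rightarrow> 'g \<Rightarrow> 'g \<Rightarrow> real) \<Rightarrow> (nat \<Rightarrow> 'g set) \<Rightarrow> ('g::group_add \<Rightarrow> complex) \<Rightarrow>
    nat \<Rightarrow> ('g \<Rightarrow> complex) \<Rightarrow> 'g \<Rightarrow> complex" where
  "Tn M \<psi> X K n F = (\<lambda>y. \<Sum>x\<in>X n. L2_inner M F (\<lambda>g. complex_of_real (\<psi> n x g)) * ltrans x K y)"

definition right_inverse_on :: "'g measure \<Rightarrow> real \<Rightarrow> ('g \<Rightarrow> real) \<Rightarrow>
    (('g \<Rightarrow> complex) \<Rightarrow> 'g \<Rightarrow> complex) \<Rightarrow> (('g \<Rightarrow> complex) \<Rightarrow> 'g \<Rightarrow> complex) \<Rightarrow> bool" where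
  "right_inverse_on M r m T S \<longleftrightarrow>
     (let V = T ` {F. in_Lpw M r m F} in
       (\<forall>f\<in>V. in_Lpw M r m (S f) \<and> T (S f) = f) \<and>
       (\<forall>f\<in>V. \<forall>g\<in>V. \<forall>a b. S (\<lambda>x. a * f x + b * g x) = (\<lambda>x. a * S f x + b * S g x)))"

definition op_norm_on :: "'g measure \<Rightarrow> real \<Rightarrow> ('g \<Rightarrow> real) \<Rightarrow> ('g \<Rightarrow> complex) set \<Rightarrow>
    (('g \<Rightarrow> complex) \<Rightarrow> 'g \<Rightarrow> complex) \<Rightarrow> real" where
  "op_norm_on M r m V S = Sup {Lpw_norm M r m (S f) | f. f \<in> V \<and> Lpw_norm M r m f \<le> 1}"

end

theory Submission
  imports Defs
begin

text \<open>
  The voice transform satisfies \<open>V\<^sub>e T * K = V\<^sub>e T\<close>. For \<open>T\<close> in the anti-dual no weak integral is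
  needed: \<open>\<pi>(x)u\<close> is a limit, in every seminorm of \<open>S\<^sub>w\<close>, of Riemann sums of \<open>\<integral> K(x\<^sup>-\<^sup>1y) \<pi>(y)u dy\<close> over
  compact sets; the error outside a compact set is controlled by Young's inequality, the error inside by
  the continuity of \<open>y \<mapsto> \<lambda>(y)K\<close> in the weighted spaces.

  (i) Linear independence of the \<open>\<psi>\<close> makes \<open>T\<^sub>n\<close> map onto the span of \<open>\<lambda>(x)K\<close>, \<open>x \<in> X\<^sub>n\<close>. Density provides
  \<open>h\<close> in this span close to \<open>V\<^sub>e T\<close>, and the coefficients are \<open>\<langle>S\<^sub>n h, \<psi>\<^sub>n\<^sub>,\<^sub>x\<rangle>\<close>, estimated by
  Hoelder's inequality.

  (ii) On \<open>xQ\<^sub>n\<close> the oscillation dominates a translate of \<open>K\<close> by nearby ones, so the sum of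
  \<open>|d\<^sub>x| |\<lambda>(x)K|\<close> is at most the convolution of the step function
  \<open>|Q\<^sub>n|\<^sup>-\<^sup>1 \<Sum> |d\<^sub>x| 1\<^bsub>xQ\<^sub>n\<^esub>\<close> with \<open>osc K + |K|\<close>, and Young's inequality for a possibly
  non-unimodular group applies. At most \<open>I\<close> of the sets \<open>xQ\<^sub>n\<close> meet at a point.
\<close>

section \<open>Weighted Lebesgue spaces\<close>

text \<open>The standing assumption leaves out the exponent 1, so convolution with \<open>K\<close>
  loses integrability: Young's inequality leads to the exponent c only from the smaller a with 2/a =
  1 + 1/c. Since c > 1 gives a > 1, every exponent stays in the range that \<open>Sw\<close>
  controls.

  Origin of the constants. In C_n, |Q_n|^(1/r') is the second Hoelder factor on a patch xQ_n and sup
  w compares m(x) with m on the patch; the partition of unity keeps the overlap number out. In D_n,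
  averaging over a patch contributes |Q_n|^(-1), the q-norm of its indicator |Q_n|^(1/q), the
  overlap I^(1-1/q). One of the two marginal bounds in Young's inequality concerns the inverted
  kernel; inversion costs the density 1/\<Delta>, which is \<open>\<Delta> x powr (- 1 / p)\<close>
  inside the weight. Hence the two norms in \<theta>_n.

  Two obstacles remain. The operator norm in (i) is a supremum of reals, so boundedness of S_n must
  be proved although the translates of \<open>K\<close> may be dependent. In (ii) the sum must be a
  continuous functional on \<open>Sw\<close> before its voice transform counts; this comes from the
  duality of the weights m and 1/m.\<close>

lemma weighted_am_gm3:
  fixes x y z a b c :: real
  assumes "0 \<le> x" "0 \<le> y" "0 \<le> z" "0 \<le> a" "0 \<le> b" "0 \<le> c" "a + b + c = 1"
  shows "x powr a * y powr b * z powr c \<le> a * x + b * y + c * z"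
\<comment> \<open>\<open>0 powr a\<close> is 0 for every \<open>a\<close>, also for
  \<open>a = 0\<close>, so the left-hand side vanishes in this case.\<close>
proof (cases "x = 0 \<or> y = 0 \<or> z = 0")
  case True
  then show ?thesis using assms by auto
next
  case False
  then have pos: "x > 0" "y > 0" "z > 0" using assms by auto
  define s where "s = a * x + b * y + c * z"
  have "a > 0 \<or> b > 0 \<or> c > 0" using assms by linarith
  then have s: "s > 0" unfolding s_def using assms pos
    by (smt (verit) mult_nonneg_nonneg mult_pos_pos)
  \<comment> \<open>The tangent of the logarithm at the mean \<open>s\<close>. After adding the
    three weighted inequalities the linear terms cancel.\<close>
  have *: "e * ln t - e * ln s \<le> e * t / s - e" if "t > 0" "e \<ge> 0" for t e
  proof -
    have "ln (t / s) \<le> t / s - 1" using that s by (intro ln_le_minus_one) auto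
    then have "e * ln (t / s) \<le> e * (t / s - 1)" using that by (intro mult_left_mono) auto
    then show ?thesis using that s by (simp add: ln_div algebra_simps)
  qed
  have "a * x / s + b * y / s + c * z / s = 1"
    using s unfolding s_def by (simp add: add_divide_distrib[symmetric])
  moreover have "a * ln s + b * ln s + c * ln s = ln s"
    using assms(7) by (simp add: distrib_right[symmetric])
  ultimately have "a * ln x + b * ln y + c * ln z \<le> ln s"
    using *[OF pos(1) assms(4)] *[OF pos(2) assms(5)] *[OF pos(3) assms(6)] assms(7) by linarith
  then have "exp (a * ln x + b * ln y + c * ln z) \<le> s"
    using s by (metis exp_le_cancel_iff exp_ln)
  then show ?thesis using pos by (simp add: powr_def exp_add s_def)
qed

text \<open>Removes the division by zero from the norm inequalities below: they are proved for
  positive bounds, then each bound is enlarged by \<open>e\<close> and \<open>e\<close> tends to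
  0.\<close>

lemma le_limit_at_right_0:
  assumes "\<And>e. 0 < e \<Longrightarrow> c \<le> ennreal (f e)" "(f \<longlongrightarrow> f 0) (at_right (0::real))"
  shows "c \<le> ennreal (f 0)"
proof (rule tendsto_lowerbound)
  show "((\<lambda>e. ennreal (f e)) \<longlongrightarrow> ennreal (f 0)) (at_right 0)" by (intro tendsto_ennrealI assms(2))
  show "\<forall>\<^sub>F e in at_right 0. c \<le> ennreal (f e)"
    using assms(1) by (auto simp: eventually_at_right_field intro!: exI[of _ 1])
qed simp

text \<open>Integrates the weighted mean inequality for \<open>f / A\<close>, \<open>g / B\<close>,
  \<open>h / C\<close>. Young's inequality needs three factors; an exponent 0 recovers the case of
  two.\<close>

lemma nn_integral_Holder3:
  fixes f g h :: "'a \<Rightarrow> real"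
  assumes [measurable]: "f \<in> borel_measurable M" "g \<in> borel_measurable M" "h \<in> borel_measurable M"
    and nn: "\<And>x. 0 \<le> f x" "\<And>x. 0 \<le> g x" "\<And>x. 0 \<le> h x"
    and abc: "0 \<le> a" "0 \<le> b" "0 \<le> c" "a + b + c = 1"
    and pos: "A > 0" "B > 0" "C > 0"
    and int: "(\<integral>\<^sup>+x. f x \<partial>M) \<le> ennreal A" "(\<integral>\<^sup>+x. g x \<partial>M) \<le> ennreal B" "(\<integral>\<^sup>+x. h x \<partial>M) \<le> ennreal C"
  shows "(\<integral>\<^sup>+x. ennreal (f x powr a * g x powr b * h x powr c) \<partial>M) \<le> ennreal (A powr a * B powr b * C powr c)"
proof -
  define P where "P = A powr a * B powr b * C powr c"
  have P: "P > 0" using pos by (simp add: P_def)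
  have "f x powr a * g x powr b * h x powr c \<le> P * (a / A) * f x + P * (b / B) * g x + P * (c / C) * h x" for x
  proof -
    have "f x powr a * g x powr b * h x powr c
        = P * ((f x / A) powr a * (g x / B) powr b * (h x / C) powr c)"
      using nn[of x] pos by (simp add: powr_divide P_def)
    also have "\<dots> \<le> P * (a * (f x / A) + b * (g x / B) + c * (h x / C))"
      using nn[of x] pos abc P by (intro mult_left_mono weighted_am_gm3) auto
    finally show ?thesis by (simp add: algebra_simps)
  qed
  then have "(\<integral>\<^sup>+x. ennreal (f x powr a * g x powr b * h x powr c) \<partial>M)
      \<le> (\<integral>\<^sup>+x. ennreal (P * (a / A) * f x + P * (b / B) * g x + P * (c / C) * h x) \<partial>M)"
    by (intro nn_integral_mono ennreal_leI)
  also have "\<dots> = (\<integral>\<^sup>+x. ennreal (P * (a / A)) * f x + ennreal (P * (b / B)) * g x + ennreal (P * (c / C)) * h x \<partial>M)"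
    using nn abc pos P by (intro nn_integral_cong) (simp add: ennreal_plus ennreal_mult[symmetric] del: times_divide_eq_right)
  also have "\<dots> = ennreal (P * (a / A)) * (\<integral>\<^sup>+x. f x \<partial>M) + ennreal (P * (b / B)) * (\<integral>\<^sup>+x. g x \<partial>M) + ennreal (P * (c / C)) * (\<integral>\<^sup>+x. h x \<partial>M)"
    by (simp add: nn_integral_add nn_integral_cmult)
  also have "\<dots> \<le> ennreal (P * (a / A)) * ennreal A + ennreal (P * (b / B)) * ennreal B + ennreal (P * (c / C)) * ennreal C"
    using int by (intro add_mono mult_left_mono) auto
  also have "\<dots> = ennreal (P * (a + b + c))"
    using abc(1-3) pos P by (simp add: ennreal_mult[symmetric] ennreal_plus[symmetric] algebra_simps del: ennreal_plus)
  finally show ?thesis using abc by (simp add: P_def)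
qed

lemma nn_integral_Holder:
  fixes f g :: "'a \<Rightarrow> real"
  assumes "f \<in> borel_measurable M" "g \<in> borel_measurable M"
    and nn: "\<And>x. 0 \<le> f x" "\<And>x. 0 \<le> g x"
    and s: "1 < s" "1 / s + 1 / t = 1"
    and pos: "0 \<le> A" "0 \<le> B"
    and int: "(\<integral>\<^sup>+x. ennreal (f x powr s) \<partial>M) \<le> ennreal (A powr s)"
             "(\<integral>\<^sup>+x. ennreal (g x powr t) \<partial>M) \<le> ennreal (B powr t)"
  shows "(\<integral>\<^sup>+x. ennreal (f x * g x) \<partial>M) \<le> ennreal (A * B)"
proof -
  note [measurable] = assms(1,2)
  have st: "s > 0" "t > 0"
  proof -
    have "1 / t > 0" using s by (metis diff_gt_0_iff_gt divide_less_eq_1_pos add_diff_cancel_left' order_less_trans zero_less_one)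
    then show "t > 0" by simp
  qed (use s in auto)
  have *: "(\<integral>\<^sup>+x. ennreal (f x * g x) \<partial>M) \<le> ennreal ((A + e) * (B + e))" if e: "e > 0" for e
  proof -
    \<comment> \<open>The factor with exponent 0 is 1 where \<open>g\<close> is positive and 0 where
      \<open>g\<close> vanishes, hence harmless.\<close>
    have "(\<integral>\<^sup>+x. ennreal (f x * g x) \<partial>M)
       = (\<integral>\<^sup>+x. ennreal ((f x powr s) powr (1 / s) * (g x powr t) powr (1 / t) * (g x powr t) powr 0) \<partial>M)"
      using nn st by (intro nn_integral_cong) (simp add: powr_powr)
    also have "\<dots> \<le> ennreal (((A + e) powr s) powr (1 / s) * ((B + e) powr t) powr (1 / t) * ((B + e) powr t) powr 0)"
    proof (rule nn_integral_Holder3)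
      show "(\<integral>\<^sup>+x. ennreal (f x powr s) \<partial>M) \<le> ennreal ((A + e) powr s)"
        using int(1) e pos st by (elim order_trans) (auto intro!: ennreal_leI powr_mono2)
      show "(\<integral>\<^sup>+x. ennreal (g x powr t) \<partial>M) \<le> ennreal ((B + e) powr t)"
        using int(2) e pos st by (elim order_trans) (auto intro!: ennreal_leI powr_mono2)
      then show "(\<integral>\<^sup>+x. ennreal (g x powr t) \<partial>M) \<le> ennreal ((B + e) powr t)" .
    qed (use e pos st s in auto)
    also have "\<dots> = ennreal ((A + e) * (B + e))" using e pos st by (simp add: powr_powr)
    finally show ?thesis .
  qed
  have "((\<lambda>e. (A + e) * (B + e)) \<longlongrightarrow> (A + 0) * (B + 0)) (at_right 0)"
    by (intro tendsto_intros)
  from le_limit_at_right_0[OF * this] show ?thesis by simp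
qed

lemma powr_convex_nonneg:
  fixes x y t p :: real
  assumes "0 \<le> x" "0 \<le> y" "0 \<le> t" "t \<le> 1" "1 \<le> p"
  shows "(t * x + (1 - t) * y) powr p \<le> t * x powr p + (1 - t) * y powr p"
proof -
  \<comment> \<open>Covers the case where one of the two points is 0, which convexity on the
    positive reals does not reach.\<close>
  have *: "(e * z) powr p \<le> e * z powr p" if "0 \<le> e" "e \<le> 1" "0 \<le> z" for e z :: real
  proof -
    have "(e * z) powr p = e powr p * z powr p" using that by (simp add: powr_mult)
    also have "\<dots> \<le> e powr 1 * z powr p" using that assms by (intro mult_right_mono powr_mono') auto
    finally show ?thesis using that by simp
  qed
  consider "x = 0" | "y = 0" | "x > 0" "y > 0" using assms by fastforce
  then show ?thesis
  proof cases
    case 3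
    then show ?thesis using powr_convex[OF assms(5)] assms
      by (auto simp: convex_on_alt)
  qed (use *[of "1 - t" y] *[of t x] assms in auto)
qed

text \<open>Convexity of the p-th power, applied to \<open>f / A\<close> and \<open>g / B\<close>
  with the weights \<open>A / (A + B)\<close> and \<open>B / (A + B)\<close>: both normalised
  integrals are at most 1, and the weights add up to 1.\<close>

lemma nn_integral_Minkowski_pos:
  fixes f g :: "'a \<Rightarrow> real"
  assumes [measurable]: "f \<in> borel_measurable M" "g \<in> borel_measurable M"
    and nn: "\<And>x. 0 \<le> f x" "\<And>x. 0 \<le> g x"
    and p: "1 \<le> p"
    and pos: "0 < A" "0 < B"
    and int: "(\<integral>\<^sup>+x. ennreal (f x powr p) \<partial>M) \<le> ennreal (A powr p)"
             "(\<integral>\<^sup>+x. ennreal (g x powr p) \<partial>M) \<le> ennreal (B powr p)"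
  shows "(\<integral>\<^sup>+x. ennreal ((f x + g x) powr p) \<partial>M) \<le> ennreal ((A + B) powr p)"
proof -
  define P where "P = (A + B) powr p"
  define t where "t = A / (A + B)"
  have t: "0 \<le> t" "t \<le> 1" "1 - t = B / (A + B)" using pos by (auto simp: t_def field_simps)
  have P: "P > 0" using pos by (simp add: P_def)
  have "(f x + g x) powr p \<le> P * t * A powr (- p) * f x powr p + P * (1 - t) * B powr (- p) * g x powr p" for x
  proof -
    have "f x + g x = (A + B) * (t * (f x / A) + (1 - t) * (g x / B))"
    proof -
      have "(A + B) * (t * (f x / A)) = f x" "(A + B) * ((1 - t) * (g x / B)) = g x"
        unfolding t(3) unfolding t_def using pos by auto
      then show ?thesis by (simp only: distrib_left)
    qed
    also have "\<dots> powr p = P * (t * (f x / A) + (1 - t) * (g x / B)) powr p"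
      using nn pos t by (simp add: powr_mult P_def)
    also have "\<dots> \<le> P * (t * (f x / A) powr p + (1 - t) * (g x / B) powr p)"
      using nn[of x] t P pos p by (intro mult_left_mono powr_convex_nonneg) auto
    finally show ?thesis
      using powr_divide[of "f x" A p] powr_divide[of "g x" B p] nn[of x] pos
      by (simp add: powr_minus divide_inverse algebra_simps)
  qed
  then have "(\<integral>\<^sup>+x. ennreal ((f x + g x) powr p) \<partial>M)
      \<le> (\<integral>\<^sup>+x. ennreal (P * t * A powr (- p) * f x powr p + P * (1 - t) * B powr (- p) * g x powr p) \<partial>M)"
    by (intro nn_integral_mono ennreal_leI)
  also have "\<dots> = (\<integral>\<^sup>+x. ennreal (P * t * A powr (- p)) * ennreal (f x powr p) + ennreal (P * (1 - t) * B powr (- p)) * ennreal (g x powr p) \<partial>M)"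
    using t(1,2) P by (intro nn_integral_cong) (simp add: ennreal_plus ennreal_mult)
  also have "\<dots> = ennreal (P * t * A powr (- p)) * (\<integral>\<^sup>+x. ennreal (f x powr p) \<partial>M) + ennreal (P * (1 - t) * B powr (- p)) * (\<integral>\<^sup>+x. ennreal (g x powr p) \<partial>M)"
    by (simp add: nn_integral_add nn_integral_cmult)
  also have "\<dots> \<le> ennreal (P * t * A powr (- p)) * ennreal (A powr p) + ennreal (P * (1 - t) * B powr (- p)) * ennreal (B powr p)"
    using int by (intro add_mono mult_left_mono) auto
  also have "\<dots> = ennreal (P * t * A powr (- p) * A powr p + P * (1 - t) * B powr (- p) * B powr p)"
    using t(1,2) P by (simp add: ennreal_mult[symmetric] ennreal_plus[symmetric] del: ennreal_plus)
  also have "P * t * A powr (- p) * A powr p + P * (1 - t) * B powr (- p) * B powr p = P"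
    using pos by (simp add: powr_minus field_simps)
  finally show ?thesis by (simp add: P_def)
qed

lemma nn_integral_Minkowski:
  fixes f g :: "'a \<Rightarrow> real"
  assumes "f \<in> borel_measurable M" "g \<in> borel_measurable M"
    and nn: "\<And>x. 0 \<le> f x" "\<And>x. 0 \<le> g x"
    and p: "1 \<le> p"
    and pos: "0 \<le> A" "0 \<le> B"
    and int: "(\<integral>\<^sup>+x. ennreal (f x powr p) \<partial>M) \<le> ennreal (A powr p)"
             "(\<integral>\<^sup>+x. ennreal (g x powr p) \<partial>M) \<le> ennreal (B powr p)"
  shows "(\<integral>\<^sup>+x. ennreal ((f x + g x) powr p) \<partial>M) \<le> ennreal ((A + B) powr p)"
proof -
  have *: "(\<integral>\<^sup>+x. ennreal ((f x + g x) powr p) \<partial>M) \<le> ennreal (((A + e) + (B + e)) powr p)" if e: "e > 0" for e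
  proof (rule nn_integral_Minkowski_pos)
    show "(\<integral>\<^sup>+x. ennreal (f x powr p) \<partial>M) \<le> ennreal ((A + e) powr p)"
      using int(1) e pos p by (elim order_trans) (auto intro!: ennreal_leI powr_mono2)
    show "(\<integral>\<^sup>+x. ennreal (g x powr p) \<partial>M) \<le> ennreal ((B + e) powr p)"
      using int(2) e pos p by (elim order_trans) (auto intro!: ennreal_leI powr_mono2)
  qed (use assms e in auto)
  have "((\<lambda>e. ((A + e) + (B + e)) powr p) \<longlongrightarrow> ((A + 0) + (B + 0)) powr p) (at_right 0)"
    using p pos by (intro tendsto_intros tendsto_powr')
      (auto simp: eventually_at_right_field intro!: exI[of _ 1])
  from le_limit_at_right_0[OF * this] show ?thesis by simp
qed

section \<open>Membership and norm in the weighted spaces\<close>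

lemma Lpw_norm_nonneg: "0 \<le> Lpw_norm M p v f"
  by (simp add: Lpw_norm_def Lp_norm_def)

text \<open>Estimates are made with nonnegative integrals, whereas the norm is a Bochner integral;
  membership excludes the default value 0 of a non-integrable function.\<close>

lemma nn_integral_Lpw_norm:
  assumes "in_Lpw M p v f" "0 < p" "\<And>x. 0 \<le> v x"
  shows "(\<integral>\<^sup>+x. ennreal ((v x * norm (f x)) powr p) \<partial>M) = ennreal (Lpw_norm M p v f powr p)"
proof -
  have 1: "norm (complex_of_real (v x) * f x) = v x * norm (f x)" for x
    using assms(3) by (simp add: norm_mult)
  have "integrable M (\<lambda>x. (v x * norm (f x)) powr p)"
    using assms(1) unfolding in_Lpw_def in_Lp_def 1 by simp
  then have "(\<integral>\<^sup>+x. ennreal ((v x * norm (f x)) powr p) \<partial>M) = ennreal (\<integral>x. (v x * norm (f x)) powr p \<partial>M)"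
    by (intro nn_integral_eq_integral) auto
  moreover have "Lpw_norm M p v f powr p = (\<integral>x. (v x * norm (f x)) powr p \<partial>M)"
    unfolding Lpw_norm_def Lp_norm_def 1 using assms(2) by (simp add: powr_powr)
  ultimately show ?thesis by simp
qed

text \<open>The way back: a finite bound on the nonnegative integral yields membership. The weight
  is not assumed measurable here, so measurability of its product with \<open>f\<close> is a
  separate premise.\<close>

lemma
  assumes "f \<in> borel_measurable M" "(\<lambda>x. complex_of_real (v x) * f x) \<in> borel_measurable M"
    and v: "\<And>x. 0 \<le> v x" and "0 < p" "0 \<le> c"
    and int: "(\<integral>\<^sup>+x. ennreal ((v x * norm (f x)) powr p) \<partial>M) \<le> ennreal (c powr p)"
  shows in_Lpw_bound: "in_Lpw M p v f" and Lpw_norm_bound: "Lpw_norm M p v f \<le> c"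
proof -
  have 1: "norm (complex_of_real (v x) * f x) = v x * norm (f x)" for x
    using assms(3) by (simp add: norm_mult)
  note [measurable] = assms(1,2)
  have [measurable]: "(\<lambda>x. v x * norm (f x)) \<in> borel_measurable M"
    unfolding 1[symmetric] by measurable
  have i: "integrable M (\<lambda>x. (v x * norm (f x)) powr p)"
    using int by (intro integrableI_bounded) (auto intro: le_less_trans)
  show L: "in_Lpw M p v f" unfolding in_Lpw_def in_Lp_def 1 using i assms(1,2) by auto
  have "ennreal (Lpw_norm M p v f powr p) \<le> ennreal (c powr p)"
    using int nn_integral_Lpw_norm[OF L \<open>0 < p\<close> v] by simp
  then have "Lpw_norm M p v f powr p \<le> c powr p" by simp
  then show "Lpw_norm M p v f \<le> c"
    using \<open>0 < p\<close> \<open>0 \<le> c\<close> by (meson not_le powr_less_mono2)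
qed

lemma in_Lpw_measurable:
  assumes "in_Lpw M p v f"
  shows "f \<in> borel_measurable M" "(\<lambda>x. complex_of_real (v x) * f x) \<in> borel_measurable M"
  using assms by (auto simp: in_Lpw_def in_Lp_def)

lemma in_Lpw_measurable_norm:
  assumes "in_Lpw M p v f" "\<And>x. 0 \<le> v x"
  shows "(\<lambda>x. v x * norm (f x)) \<in> borel_measurable M"
proof -
  have "(\<lambda>x. norm (complex_of_real (v x) * f x)) \<in> borel_measurable M"
    using in_Lpw_measurable(2)[OF assms(1)] by measurable
  then show ?thesis using assms(2) by (simp add: norm_mult)
qed

lemma in_Lpw_mono:
  assumes g: "in_Lpw M p v g" and v: "\<And>x. 0 \<le> v x" and p: "0 < p"
    and f: "f \<in> borel_measurable M" "(\<lambda>x. complex_of_real (v x) * f x) \<in> borel_measurable M"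
    and le: "\<And>x. norm (f x) \<le> norm (g x)"
  shows "in_Lpw M p v f"
proof -
  have "(\<integral>\<^sup>+x. ennreal ((v x * norm (f x)) powr p) \<partial>M) \<le> (\<integral>\<^sup>+x. ennreal ((v x * norm (g x)) powr p) \<partial>M)"
    using v p le by (intro nn_integral_mono ennreal_leI powr_mono2 mult_left_mono) auto
  also have "\<dots> = ennreal (Lpw_norm M p v g powr p)" by (rule nn_integral_Lpw_norm[OF g p v])
  finally show ?thesis by (rule in_Lpw_bound[OF f v p Lpw_norm_nonneg])
qed

lemma
  assumes f: "in_Lpw M p v f" and g: "in_Lpw M p v g" and v: "\<And>x. 0 \<le> v x" and p: "1 \<le> p"
  shows in_Lpw_add: "in_Lpw M p v (\<lambda>x. f x + g x)"
    and Lpw_norm_triangle: "Lpw_norm M p v (\<lambda>x. f x + g x) \<le> Lpw_norm M p v f + Lpw_norm M p v g"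
proof -
  have p0: "p > 0" using p by simp
  have m: "(\<lambda>x. f x + g x) \<in> borel_measurable M"
    "(\<lambda>x. complex_of_real (v x) * (f x + g x)) \<in> borel_measurable M"
    using in_Lpw_measurable[OF f] in_Lpw_measurable[OF g] by (auto simp: distrib_left)
  have "(\<integral>\<^sup>+x. ennreal ((v x * norm (f x + g x)) powr p) \<partial>M)
     \<le> (\<integral>\<^sup>+x. ennreal ((v x * norm (f x) + v x * norm (g x)) powr p) \<partial>M)"
    using v p by (intro nn_integral_mono ennreal_leI powr_mono2)
      (auto simp: distrib_left[symmetric] norm_triangle_ineq mult_left_mono)
  also have "\<dots> \<le> ennreal ((Lpw_norm M p v f + Lpw_norm M p v g) powr p)"
    using in_Lpw_measurable_norm[OF f v] in_Lpw_measurable_norm[OF g v] v p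
    by (intro nn_integral_Minkowski) (auto simp: Lpw_norm_nonneg nn_integral_Lpw_norm[OF f p0 v] nn_integral_Lpw_norm[OF g p0 v])
  finally show "in_Lpw M p v (\<lambda>x. f x + g x)"
    "Lpw_norm M p v (\<lambda>x. f x + g x) \<le> Lpw_norm M p v f + Lpw_norm M p v g"
    using in_Lpw_bound[OF m v p0 add_nonneg_nonneg[OF Lpw_norm_nonneg Lpw_norm_nonneg]]
      Lpw_norm_bound[OF m v p0 add_nonneg_nonneg[OF Lpw_norm_nonneg Lpw_norm_nonneg]] by blast+
qed

lemma Lpw_norm_cmult: "0 < p \<Longrightarrow> Lpw_norm M p v (\<lambda>x. c * f x) = norm c * Lpw_norm M p v f"
  unfolding Lpw_norm_def Lp_norm_def
  by (simp add: norm_mult powr_mult mult.left_commute[of _ "norm c"] powr_powr)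

lemma in_Lpw_cmult:
  assumes "in_Lpw M p v f"
  shows "in_Lpw M p v (\<lambda>x. c * f x)"
proof -
  have "integrable M (\<lambda>x. norm c powr p * norm (complex_of_real (v x) * f x) powr p)"
    using assms by (auto simp: in_Lpw_def in_Lp_def)
  then show ?thesis
    using assms by (auto simp: in_Lpw_def in_Lp_def norm_mult powr_mult mult.left_commute[of _ c] mult.left_commute[of _ "norm c"] mult_ac)
qed

lemma
  assumes "0 < p"
  shows in_Lpw_zero: "in_Lpw M p v (\<lambda>x. 0)" and Lpw_norm_zero: "Lpw_norm M p v (\<lambda>x. 0) = 0"
  using assms by (auto simp: in_Lpw_def in_Lp_def Lpw_norm_def Lp_norm_def)

lemma
  assumes f: "\<And>i. i \<in> F \<Longrightarrow> in_Lpw M p v (f i)" and v: "\<And>x. 0 \<le> v x" and p: "1 \<le> p"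
  shows in_Lpw_sum: "in_Lpw M p v (\<lambda>x. \<Sum>i\<in>F. f i x)"
    and Lpw_norm_sum: "Lpw_norm M p v (\<lambda>x. \<Sum>i\<in>F. f i x) \<le> (\<Sum>i\<in>F. Lpw_norm M p v (f i))"
proof -
  have "in_Lpw M p v (\<lambda>x. \<Sum>i\<in>F. f i x) \<and> Lpw_norm M p v (\<lambda>x. \<Sum>i\<in>F. f i x) \<le> (\<Sum>i\<in>F. Lpw_norm M p v (f i))"
    using f
  proof (induction F rule: infinite_finite_induct)
    case (insert i F)
    then have IH: "in_Lpw M p v (\<lambda>x. \<Sum>i\<in>F. f i x)" "in_Lpw M p v (f i)"
      "Lpw_norm M p v (\<lambda>x. \<Sum>i\<in>F. f i x) \<le> (\<Sum>i\<in>F. Lpw_norm M p v (f i))" by auto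
    show ?case using in_Lpw_add[OF IH(2,1) v p] Lpw_norm_triangle[OF IH(2,1) v p] IH(3) insert(1,2) by auto
  qed (use p in \<open>auto simp: in_Lpw_zero Lpw_norm_zero\<close>)
  then show "in_Lpw M p v (\<lambda>x. \<Sum>i\<in>F. f i x)"
    "Lpw_norm M p v (\<lambda>x. \<Sum>i\<in>F. f i x) \<le> (\<Sum>i\<in>F. Lpw_norm M p v (f i))" by auto
qed

lemma
  assumes f: "in_Lpw M p v f" and g: "in_Lpw M p v g" and v: "\<And>x. 0 \<le> v x" and p: "1 \<le> p"
  shows in_Lpw_diff: "in_Lpw M p v (\<lambda>x. f x - g x)"
    and Lpw_norm_diff_triangle: "Lpw_norm M p v (\<lambda>x. f x - g x) \<le> Lpw_norm M p v f + Lpw_norm M p v g"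
  using in_Lpw_add[OF f in_Lpw_cmult[OF g, of "-1"] v p]
    Lpw_norm_triangle[OF f in_Lpw_cmult[OF g, of "-1"] v p] p by (auto simp: Lpw_norm_cmult[of p M v "-1" g, simplified])

lemma Lpw_norm_minus_commute: "Lpw_norm M p v (\<lambda>x. f x - g x) = Lpw_norm M p v (\<lambda>x. g x - f x)"
  unfolding Lpw_norm_def Lp_norm_def by (simp add: norm_mult norm_minus_commute)

lemma nn_integral_Lpw_pairing:
  assumes f: "in_Lpw M s v f" and g: "in_Lpw M t (\<lambda>x. 1 / v x) g" and v: "\<And>x. 0 < v x"
    and s: "1 < s" "1 / s + 1 / t = 1"
  shows "(\<integral>\<^sup>+x. ennreal (norm (f x) * norm (g x)) \<partial>M) \<le> ennreal (Lpw_norm M s v f * Lpw_norm M t (\<lambda>x. 1 / v x) g)"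
proof -
  have "t > 0"
  proof -
    have "1 / t > 0" using s by (metis diff_gt_0_iff_gt divide_less_eq_1_pos add_diff_cancel_left' order_less_trans zero_less_one)
    then show "t > 0" by simp
  qed
  have v': "0 \<le> v x" "0 \<le> 1 / v x" for x using v[of x] by auto
  have "(\<integral>\<^sup>+x. ennreal (norm (f x) * norm (g x)) \<partial>M) = (\<integral>\<^sup>+x. ennreal ((v x * norm (f x)) * (1 / v x * norm (g x))) \<partial>M)"
    using v by (intro nn_integral_cong) (simp add: less_imp_neq[THEN not_sym])
  also have "\<dots> \<le> ennreal (Lpw_norm M s v f * Lpw_norm M t (\<lambda>x. 1 / v x) g)"
    using in_Lpw_measurable_norm[OF f v'(1)] in_Lpw_measurable_norm[OF g v'(2)] v s \<open>t > 0\<close> v'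
      nn_integral_Lpw_norm[OF f _ v'(1)] nn_integral_Lpw_norm[OF g _ v'(2)]
    by (intro nn_integral_Holder) (auto simp: Lpw_norm_nonneg)
  finally show ?thesis .
qed

section \<open>Haar measure and convolution\<close>

text \<open>In Young's inequality the first bound is the value of an integral at a point and may be
  0. The condition \<open>0 < a\<close> makes the power continuous there.\<close>

lemma nn_integral_Holder3_nonneg:
  fixes f g h :: "'a \<Rightarrow> real"
  assumes [measurable]: "f \<in> borel_measurable M" "g \<in> borel_measurable M" "h \<in> borel_measurable M"
    and nn: "\<And>x. 0 \<le> f x" "\<And>x. 0 \<le> g x" "\<And>x. 0 \<le> h x"
    and abc: "0 < a" "0 \<le> b" "0 \<le> c" "a + b + c = 1"
    and pos: "A \<ge> 0" "B > 0" "C > 0"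
    and int: "(\<integral>\<^sup>+x. f x \<partial>M) \<le> ennreal A" "(\<integral>\<^sup>+x. g x \<partial>M) \<le> ennreal B" "(\<integral>\<^sup>+x. h x \<partial>M) \<le> ennreal C"
  shows "(\<integral>\<^sup>+x. ennreal (f x powr a * g x powr b * h x powr c) \<partial>M) \<le> ennreal (A powr a * B powr b * C powr c)"
proof -
  have *: "(\<integral>\<^sup>+x. ennreal (f x powr a * g x powr b * h x powr c) \<partial>M) \<le> ennreal ((A + e) powr a * B powr b * C powr c)"
    if "e > 0" for e
  proof (rule nn_integral_Holder3)
    show "(\<integral>\<^sup>+x. f x \<partial>M) \<le> ennreal (A + e)"
      using int(1) by (rule order_trans) (use that in \<open>auto intro: ennreal_leI\<close>)
  qed (use assms that in auto)
  have "((\<lambda>e. (A + e) powr a * B powr b * C powr c) \<longlongrightarrow> (A + 0) powr a * B powr b * C powr c) (at_right 0)"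
    using abc pos by (intro tendsto_intros tendsto_powr')
      (auto simp: eventually_at_right_field intro!: exI[of _ 1])
  from le_limit_at_right_0[OF * this] show ?thesis by simp
qed

lemma borel_measurable_group_uminus [measurable (raw)]:
  fixes f :: "'a \<Rightarrow> 'g::topological_group_add"
  assumes "f \<in> borel_measurable N"
  shows "(\<lambda>x. - f x) \<in> borel_measurable N"
proof -
  have "continuous_on UNIV (uminus :: 'g \<Rightarrow> 'g)"
    unfolding continuous_on_def by (auto intro: tendsto_intros)
  then show ?thesis
    using assms by (rule borel_measurable_continuous_on)
qed

section \<open>Left Haar measure: sigma-finiteness, left invariance, Young's inequality\<close>

locale haar_group =
  fixes M :: "'g::{topological_group_add,t2_space,second_countable_topology} measure"
  assumes lc: "lcsc_group TYPE('g)" and haar: "left_haar M"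
begin

lemma sets_M [measurable_cong]: "sets M = sets borel"
  and space_M [simp]: "space M = UNIV"
  using haar by (auto simp: left_haar_def)

lemma emeasure_compact: "compact C \<Longrightarrow> emeasure M C < \<infinity>"
  and emeasure_open_pos: "open U \<Longrightarrow> U \<noteq> {} \<Longrightarrow> 0 < emeasure M U"
  and emeasure_left: "A \<in> sets M \<Longrightarrow> emeasure M ((\<lambda>y. x + y) ` A) = emeasure M A"
  using haar by (auto simp: left_haar_def)

lemma compact_sets: "compact C \<Longrightarrow> C \<in> sets M"
  unfolding sets_M by (intro borel_closed compact_imp_closed)

text \<open>By the Lindelof property countably many open sets with compact hulls cover the group;
  finite unions of the hulls increase to it. Sigma-finiteness, and with it Fubini, rests on this,
  and so do the cut-offs in the reproducing formula.\<close>

lemma compact_exhaustion: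
  obtains C :: "nat \<Rightarrow> 'g set" where "\<And>n. compact (C n)" "incseq C" "(\<Union>n. C n) = UNIV"
proof -
  have "\<forall>x::'g. \<exists>U. open U \<and> x \<in> U \<and> (\<exists>K. compact K \<and> U \<subseteq> K)"
    using lc by (auto simp: lcsc_group_def locally_compact_space_def) metis
  then obtain U where U: "\<And>x::'g. open (U x)" "\<And>x. x \<in> U x" "\<And>x. \<exists>K. compact K \<and> U x \<subseteq> K"
    by metis
  from U(3) obtain K where K: "\<And>x. compact (K x)" "\<And>x. U x \<subseteq> K x" by metis
  have "\<And>S. S \<in> range U \<Longrightarrow> openin (top_of_set UNIV) S" using U(1) by auto
  then obtain F where F: "F \<subseteq> range U" "countable F" "\<Union>F = \<Union>(range U)"
    by (rule Lindelof_openin)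
  obtain D where D: "countable D" "F = U ` D"
    using F(1,2) by (meson countable_subset_image)
  have cov: "(\<Union>x\<in>D. U x) = UNIV" using F(3) D(2) U(2) by auto
  then have ne: "D \<noteq> {}" by auto
  define e where "e = from_nat_into D"
  have e: "range e = D" using D(1) ne by (simp add: e_def)
  show ?thesis
  proof
    show "compact (\<Union>i\<le>n. K (e i))" for n by (intro compact_UN) (auto simp: K)
    show "incseq (\<lambda>n. \<Union>i\<le>n. K (e i))" by (auto simp: incseq_def intro: order_trans)
    have "(\<Union>x\<in>D. U x) \<subseteq> (\<Union>n. \<Union>i\<le>n. K (e i))" using K(2) e by fastforce
    then show "(\<Union>n. \<Union>i\<le>n. K (e i)) = UNIV" using cov by auto
  qed
qed

lemma sigma_finite_M: "sigma_finite_measure M"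
proof -
  obtain C :: "nat \<Rightarrow> 'g set" where C: "\<And>n. compact (C n)" "incseq C" "(\<Union>n. C n) = UNIV"
    using compact_exhaustion by blast
  show ?thesis
  proof
    show "\<exists>A. countable A \<and> A \<subseteq> sets M \<and> \<Union>A = space M \<and> (\<forall>a\<in>A. emeasure M a \<noteq> \<infinity>)"
      using C emeasure_compact by (intro exI[of _ "range C"]) (auto simp: compact_sets less_top)
  qed
qed

sublocale sigma_finite_measure M by (rule sigma_finite_M)
sublocale prod: pair_sigma_finite M M ..

lemma continuous_measurable: "continuous_on UNIV f \<Longrightarrow> f \<in> borel_measurable M"
  for f :: "'g \<Rightarrow> 'b::topological_space"
  using borel_measurable_continuous_onI by (simp add: measurable_cong_sets[OF sets_M refl])

lemma distr_left: "distr M M (\<lambda>y. a + y) = M"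
proof (rule measure_eqI)
  fix A assume "A \<in> sets (distr M M (\<lambda>y. a + y))"
  then have A[measurable]: "A \<in> sets M" by simp
  have "emeasure (distr M M (\<lambda>y. a + y)) A = emeasure M ((\<lambda>y. a + y) -` A \<inter> space M)"
    by (intro emeasure_distr) measurable
  also have "(\<lambda>y. a + y) -` A \<inter> space M = (\<lambda>y. - a + y) ` A"
    by (auto simp: image_iff intro!: bexI[of _ "a + _"] simp: add.assoc[symmetric])
  finally show "emeasure (distr M M (\<lambda>y. a + y)) A = emeasure M A"
    using emeasure_left[OF A] by simp
qed simp

lemma nn_integral_left:
  assumes [measurable]: "f \<in> borel_measurable M"
  shows "(\<integral>\<^sup>+y. f (a + y) \<partial>M) = (\<integral>\<^sup>+y. f y \<partial>M)"
proof -
  have "(\<integral>\<^sup>+y. f y \<partial>distr M M (\<lambda>y. a + y)) = (\<integral>\<^sup>+y. f (a + y) \<partial>M)"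
    by (rule nn_integral_distr) measurable
  then show ?thesis by (simp add: distr_left)
qed

lemma compact_pos_measure:
  obtains C where "compact C" "0 < emeasure M C" "emeasure M C < \<infinity>"
proof -
  obtain U K where U: "open U" "(0::'g) \<in> U" "compact K" "U \<subseteq> K"
    using lc by (auto simp: lcsc_group_def locally_compact_space_def) metis
  have "0 < emeasure M U" using U by (intro emeasure_open_pos) auto
  also have "\<dots> \<le> emeasure M K" using U by (intro emeasure_mono compact_sets) auto
  finally show ?thesis using that[of K] U emeasure_compact by auto
qed

text \<open>The integrand is split into three factors with the exponents 1/r, 1 - 1/p and 1 - 1/q,
  whose sum is 1. Hoelder bounds the last two by the norms of \<open>F\<close> and \<open>G\<close>
  and leaves \<open>J\<close>, which is integrable by left invariance. The factor with
  \<open>G (- y + z)\<close> becomes \<open>G (- y)\<close> under left translation of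
  \<open>y\<close>, whence the second bound on \<open>G\<close>. The real function \<open>H\<close>
  stands for the convolution, which may be infinite on a null set.\<close>

lemma Young_convolution_aux:
  fixes F G :: "'g \<Rightarrow> real"
  assumes [measurable]: "F \<in> borel_measurable M" "G \<in> borel_measurable M"
    and nn: "\<And>x. 0 \<le> F x" "\<And>x. 0 \<le> G x"
    and pqr: "1 \<le> p" "1 \<le> q" "0 < r" "1 / q + 1 / p = 1 + 1 / r"
    and pos: "0 < A" "0 < B"
    and F: "(\<integral>\<^sup>+y. ennreal (F y powr q) \<partial>M) \<le> ennreal (A powr q)"
    and G: "(\<integral>\<^sup>+y. ennreal (G y powr p) \<partial>M) \<le> ennreal (B powr p)"
      "(\<integral>\<^sup>+y. ennreal (G (- y) powr p) \<partial>M) \<le> ennreal (B powr p)"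
    and H: "\<And>z. 0 \<le> H z" "\<And>z. ennreal (H z) \<le> (\<integral>\<^sup>+y. ennreal (F y * G (- y + z)) \<partial>M)"
  shows "(\<integral>\<^sup>+z. ennreal (H z powr r) \<partial>M) \<le> ennreal ((A * B) powr r)"
    and "AE z in M. (\<integral>\<^sup>+y. ennreal (F y * G (- y + z)) \<partial>M) < \<infinity>"
proof -
  define J where "J z = (\<integral>\<^sup>+y. ennreal (F y powr q * G (- y + z) powr p) \<partial>M)" for z
  have [measurable]: "J \<in> borel_measurable M" unfolding J_def by measurable
  have exps: "1 / q - 1 / r = 1 - 1 / p" "1 / p - 1 / r = 1 - 1 / q" "0 \<le> 1 - 1 / p" "0 \<le> 1 - 1 / q"
    using pqr by (auto simp: field_simps)
  have intJ: "(\<integral>\<^sup>+z. J z \<partial>M) \<le> ennreal (A powr q * B powr p)"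
  proof -
    have "(\<integral>\<^sup>+z. J z \<partial>M) = (\<integral>\<^sup>+y. (\<integral>\<^sup>+z. ennreal (F y powr q * G (- y + z) powr p) \<partial>M) \<partial>M)"
      unfolding J_def by (rule prod.Fubini') measurable
    also have "\<dots> = (\<integral>\<^sup>+y. ennreal (F y powr q) * (\<integral>\<^sup>+z. ennreal (G (- y + z) powr p) \<partial>M) \<partial>M)"
      by (intro nn_integral_cong) (simp add: ennreal_mult nn_integral_cmult)
    also have "\<dots> = (\<integral>\<^sup>+y. ennreal (F y powr q) * (\<integral>\<^sup>+z. ennreal (G z powr p) \<partial>M) \<partial>M)"
      by (subst nn_integral_left[where f="\<lambda>z. ennreal (G z powr p)"]) auto
    also have "\<dots> = (\<integral>\<^sup>+y. ennreal (F y powr q) \<partial>M) * (\<integral>\<^sup>+z. ennreal (G z powr p) \<partial>M)"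
      by (simp add: nn_integral_multc)
    also have "\<dots> \<le> ennreal (A powr q) * ennreal (B powr p)"
      using F G by (intro mult_mono) auto
    finally show ?thesis by (simp add: ennreal_mult)
  qed
  then have "(\<integral>\<^sup>+z. J z \<partial>M) \<noteq> \<infinity>" by (auto simp: top_unique)
  then have AEJ: "AE z in M. J z \<noteq> \<infinity>" by (intro nn_integral_PInf_AE) auto
  define c where "c = (A powr q) powr (1 - 1 / p) * (B powr p) powr (1 - 1 / q)"
  have c: "c > 0" using pos by (simp add: c_def)
  have key: "(\<integral>\<^sup>+y. ennreal (F y * G (- y + z)) \<partial>M) \<le> ennreal (enn2real (J z) powr (1 / r) * c)"
    if "J z \<noteq> \<infinity>" for z
  proof -
    have G': "(\<integral>\<^sup>+y. ennreal (G (- y + z) powr p) \<partial>M) \<le> ennreal (B powr p)"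
    proof -
      have "(\<integral>\<^sup>+y. ennreal (G (- y + z) powr p) \<partial>M) = (\<integral>\<^sup>+y. ennreal (G (- (- z + y)) powr p) \<partial>M)"
        by (simp add: minus_add)
      also have "\<dots> = (\<integral>\<^sup>+y. ennreal (G (- y) powr p) \<partial>M)"
        by (rule nn_integral_left[where f="\<lambda>y. ennreal (G (- y) powr p)"]) measurable
      finally show ?thesis using G by simp
    qed
    have *: "F y * G (- y + z) = (F y powr q * G (- y + z) powr p) powr (1 / r) * (F y powr q) powr (1 - 1 / p) * (G (- y + z) powr p) powr (1 - 1 / q)" for y
    proof (cases "F y = 0 \<or> G (- y + z) = 0")
      case False
      then have 1: "F y > 0" "G (- y + z) > 0" using nn by (auto simp: less_le)
      have "q / r + q * (1 - 1 / p) = 1" "p / r + p * (1 - 1 / q) = 1"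
        unfolding exps(1,2)[symmetric] using pqr by (auto simp: right_diff_distrib)
      then have "F y powr (q / r) * F y powr (q * (1 - 1 / p)) = F y"
        "G (- y + z) powr (p / r) * G (- y + z) powr (p * (1 - 1 / q)) = G (- y + z)"
        using 1 by (auto simp: powr_add[symmetric])
      moreover have "(F y powr q * G (- y + z) powr p) powr (1 / r) * (F y powr q) powr (1 - 1 / p) * (G (- y + z) powr p) powr (1 - 1 / q)
        = (F y powr (q / r) * F y powr (q * (1 - 1 / p))) * (G (- y + z) powr (p / r) * G (- y + z) powr (p * (1 - 1 / q)))"
        by (simp add: powr_mult powr_powr mult_ac)
      ultimately show ?thesis by simp
    qed auto
    have "(\<integral>\<^sup>+y. ennreal (F y * G (- y + z)) \<partial>M) =
      (\<integral>\<^sup>+y. ennreal ((F y powr q * G (- y + z) powr p) powr (1 / r) * (F y powr q) powr (1 - 1 / p) * (G (- y + z) powr p) powr (1 - 1 / q)) \<partial>M)"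
      by (rule nn_integral_cong) (simp only: * [symmetric])
    also have "\<dots> \<le> ennreal (enn2real (J z) powr (1 / r) * (A powr q) powr (1 - 1 / p) * (B powr p) powr (1 - 1 / q))"
    proof (rule nn_integral_Holder3_nonneg)
      show "(\<integral>\<^sup>+y. ennreal (F y powr q * G (- y + z) powr p) \<partial>M) \<le> ennreal (enn2real (J z))"
        using that by (simp add: J_def less_top)
    qed (use pos F G' pqr exps nn in auto)
    finally show ?thesis by (simp add: c_def mult.assoc)
  qed
  show "AE z in M. (\<integral>\<^sup>+y. ennreal (F y * G (- y + z)) \<partial>M) < \<infinity>"
    using AEJ
  proof eventually_elim
    case (elim z)
    show ?case using le_less_trans[OF key[OF elim]] by simp
  qed
  have "AE z in M. ennreal (H z powr r) \<le> ennreal (c powr r) * J z"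
    using AEJ
  proof eventually_elim
    case (elim z)
    have "ennreal (H z) \<le> ennreal (enn2real (J z) powr (1 / r) * c)"
      using H(2)[of z] key[OF elim] by (rule order_trans)
    then have "H z \<le> enn2real (J z) powr (1 / r) * c"
      using c by (subst (asm) ennreal_le_iff) auto
    then have "H z powr r \<le> (enn2real (J z) powr (1 / r) * c) powr r"
      using H(1) pqr by (intro powr_mono2) auto
    also have "\<dots> = c powr r * enn2real (J z)"
      using c pqr by (simp add: powr_mult powr_powr)
    finally have "ennreal (H z powr r) \<le> ennreal (c powr r * enn2real (J z))" by (rule ennreal_leI)
    then show ?case using elim by (simp add: ennreal_mult less_top)
  qed
  then have "(\<integral>\<^sup>+z. ennreal (H z powr r) \<partial>M) \<le> (\<integral>\<^sup>+z. ennreal (c powr r) * J z \<partial>M)"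
    by (rule nn_integral_mono_AE)
  also have "\<dots> = ennreal (c powr r) * (\<integral>\<^sup>+z. J z \<partial>M)" by (rule nn_integral_cmult) measurable
  also have "\<dots> \<le> ennreal (c powr r) * ennreal (A powr q * B powr p)" by (intro mult_left_mono intJ) auto
  also have "\<dots> = ennreal (c powr r * (A powr q * B powr p))" by (simp add: ennreal_mult)
  also have "c powr r * (A powr q * B powr p) = (A * B) powr r"
  proof -
    have "q * (1 / q - 1 / r) * r + q = r" "p * (1 / p - 1 / r) * r + p = r" using pqr by (auto simp: field_simps)
    then have e: "r = q * (1 - 1 / p) * r + q" "r = p * (1 - 1 / q) * r + p" using exps by auto
    have "(A * B) powr r = A powr r * B powr r" using pos by (simp add: powr_mult)
    also have "A powr r = A powr (q * (1 - 1 / p) * r) * A powr q" by (subst e(1)) (simp add: powr_add)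
    also have "B powr r = B powr (p * (1 - 1 / q) * r) * B powr p" by (subst e(2)) (simp add: powr_add)
    finally show ?thesis using pos by (simp add: c_def powr_mult powr_powr mult_ac)
  qed
  finally show "(\<integral>\<^sup>+z. ennreal (H z powr r) \<partial>M) \<le> ennreal ((A * B) powr r)" .
qed

lemma
  fixes F G :: "'g \<Rightarrow> real"
  assumes [measurable]: "F \<in> borel_measurable M" "G \<in> borel_measurable M"
    and nn: "\<And>x. 0 \<le> F x" "\<And>x. 0 \<le> G x"
    and pqr: "1 \<le> p" "1 \<le> q" "0 < r" "1 / q + 1 / p = 1 + 1 / r"
    and pos: "0 \<le> A" "0 \<le> B"
    and F: "(\<integral>\<^sup>+y. ennreal (F y powr q) \<partial>M) \<le> ennreal (A powr q)"
    and G: "(\<integral>\<^sup>+y. ennreal (G y powr p) \<partial>M) \<le> ennreal (B powr p)"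
      "(\<integral>\<^sup>+y. ennreal (G (- y) powr p) \<partial>M) \<le> ennreal (B powr p)"
  shows Young_convolution: "\<And>H. (\<And>z. 0 \<le> H z) \<Longrightarrow> (\<And>z. ennreal (H z) \<le> (\<integral>\<^sup>+y. ennreal (F y * G (- y + z)) \<partial>M)) \<Longrightarrow>
      (\<integral>\<^sup>+z. ennreal (H z powr r) \<partial>M) \<le> ennreal ((A * B) powr r)"
    and Young_convolution_AE_finite: "AE z in M. (\<integral>\<^sup>+y. ennreal (F y * G (- y + z)) \<partial>M) < \<infinity>"
proof -
  have F': "(\<integral>\<^sup>+y. ennreal (F y powr q) \<partial>M) \<le> ennreal ((A + e) powr q)" if "e > 0" for e
    using F that pqr pos by (elim order_trans) (auto intro!: ennreal_leI powr_mono2)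
  have G': "(\<integral>\<^sup>+y. ennreal (G y powr p) \<partial>M) \<le> ennreal ((B + e) powr p)"
    "(\<integral>\<^sup>+y. ennreal (G (- y) powr p) \<partial>M) \<le> ennreal ((B + e) powr p)" if "e > 0" for e
    using G(1) G(2) that pqr pos by (elim order_trans; auto intro!: ennreal_leI powr_mono2)+
  \<comment> \<open>This conclusion does not involve \<open>H\<close>; the zero function satisfies
    the premises about it.\<close>
  show "AE z in M. (\<integral>\<^sup>+y. ennreal (F y * G (- y + z)) \<partial>M) < \<infinity>"
    using Young_convolution_aux(2)[OF assms(1-8) _ _ F'[of 1] G'[of 1], of "\<lambda>_. 0"] pos by auto
  fix H :: "'g \<Rightarrow> real"
  assume H: "\<And>z. 0 \<le> H z" "\<And>z. ennreal (H z) \<le> (\<integral>\<^sup>+y. ennreal (F y * G (- y + z)) \<partial>M)"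
  have *: "(\<integral>\<^sup>+z. ennreal (H z powr r) \<partial>M) \<le> ennreal (((A + e) * (B + e)) powr r)" if "e > 0" for e
    using Young_convolution_aux(1)[OF assms(1-8) _ _ F'[of e] G'[of e], of H] pos H that by auto
  have "((\<lambda>e. ((A + e) * (B + e)) powr r) \<longlongrightarrow> ((A + 0) * (B + 0)) powr r) (at_right 0)"
    using pqr pos by (intro tendsto_intros tendsto_powr')
      (auto simp: eventually_at_right_field intro!: exI[of _ 1])
  from le_limit_at_right_0[OF * this] show "(\<integral>\<^sup>+z. ennreal (H z powr r) \<partial>M) \<le> ennreal ((A * B) powr r)"
    by simp
qed

end

section \<open>Modular function and inversion\<close>

locale modular_group = haar_group M for M :: "'g::{topological_group_add,t2_space,second_countable_topology} measure" +
  fixes \<Delta> :: "'g \<Rightarrow> real"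
  assumes modular: "modular_function M \<Delta>"
begin

lemma modular_pos: "0 < \<Delta> x"
  and emeasure_right: "E \<in> sets M \<Longrightarrow> emeasure M ((\<lambda>y. y + x) ` E) = ennreal (\<Delta> x) * emeasure M E"
  using modular by (auto simp: modular_function_def)

text \<open>Multiplicativity is not part of the definition of the modular function. A compact set of
  positive finite measure, translated by \<open>x\<close> on the right and back, yields this
  instance.\<close>

lemma modular_uminus: "\<Delta> (- x) = 1 / \<Delta> x"
proof -
  obtain C where C: "compact C" "0 < emeasure M C" "emeasure M C < \<infinity>" by (rule compact_pos_measure)
  have "(\<lambda>y. y + x) ` C \<in> sets M"
    by (intro compact_sets compact_continuous_image C continuous_intros)
  then have "emeasure M ((\<lambda>y. y + - x) ` (\<lambda>y. y + x) ` C) = ennreal (\<Delta> (- x)) * (ennreal (\<Delta> x) * emeasure M C)"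
    by (simp add: emeasure_right compact_sets C del: add_uminus_conv_diff)
  moreover have "(\<lambda>y. y + - x) ` (\<lambda>y. y + x) ` C = C" by (auto simp: image_image add.assoc)
  ultimately have "emeasure M C = ennreal (\<Delta> (- x) * \<Delta> x) * emeasure M C"
    using modular_pos by (simp add: ennreal_mult less_imp_le mult.assoc)
  moreover obtain c where c: "emeasure M C = ennreal c" "c > 0"
    using C by (cases "emeasure M C") auto
  ultimately have "\<Delta> (- x) * \<Delta> x = 1"
    using modular_pos[of x] modular_pos[of "- x"] by (simp add: ennreal_mult[symmetric])
  then show ?thesis using modular_pos[of x] by (simp add: field_simps)
qed

lemma emeasure_right_preimage:
  assumes "compact C"
  shows "(\<integral>\<^sup>+y. indicator C (y + x) \<partial>M) = ennreal (1 / \<Delta> x) * emeasure M C"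
proof -
  have e: "(\<lambda>y. y + - x) ` C = {y. y + x \<in> C}"
    by (auto simp: image_iff add.assoc intro!: bexI[of _ "_ + x"])
  have [measurable]: "C \<in> sets M" "C \<in> sets borel" using compact_sets[OF assms] by (auto simp: sets_M)
  have "(\<integral>\<^sup>+y. indicator C (y + x) \<partial>M) = (\<integral>\<^sup>+y. indicator {y. y + x \<in> C} y \<partial>M)"
    by (intro nn_integral_cong) (auto simp: indicator_def)
  also have "\<dots> = emeasure M {y. y + x \<in> C}"
    by (rule nn_integral_indicator) (use assms in \<open>auto simp: e[symmetric] intro!: compact_sets compact_continuous_image continuous_intros\<close>)
  also have "\<dots> = ennreal (\<Delta> (- x)) * emeasure M C" unfolding e[symmetric] by (rule emeasure_right) measurable
  finally show ?thesis by (simp add: modular_uminus)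
qed

text \<open>Integrating \<open>1\<^sub>C (x) f (y\<^sup>-\<^sup>1 x)\<close> over \<open>G \<times> G\<close> in both orders avoids any appeal to
  the uniqueness of Haar measure.\<close>
lemma nn_integral_inverse:
  assumes [measurable]: "f \<in> borel_measurable M"
  shows "(\<integral>\<^sup>+y. f (- y) \<partial>M) = (\<integral>\<^sup>+y. f y * ennreal (1 / \<Delta> y) \<partial>M)"
proof -
  obtain C where C: "compact C" "0 < emeasure M C" "emeasure M C < \<infinity>" by (rule compact_pos_measure)
  have [measurable]: "C \<in> sets M" "C \<in> sets borel" using compact_sets[OF C(1)] by (auto simp: sets_M)
  let ?c = "emeasure M C"
  \<comment> \<open>Measurability of the modular function is not assumed. Up to the constant
    \<open>?c\<close>, its reciprocal is a parameter integral of a jointly measurable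
    function.\<close>
  have [measurable]: "(\<lambda>x. ennreal (1 / \<Delta> x)) \<in> borel_measurable M"
  proof -
    have "(\<lambda>x. ennreal (1 / \<Delta> x)) = (\<lambda>x. (\<integral>\<^sup>+y. indicator C (y + x) \<partial>M) / ?c)"
      using C by (simp add: emeasure_right_preimage ennreal_mult_divide_eq)
    moreover have "(\<lambda>x. (\<integral>\<^sup>+y. indicator C (y + x) \<partial>M) / ?c) \<in> borel_measurable M" by measurable
    ultimately show ?thesis by simp
  qed
  have "?c * (\<integral>\<^sup>+y. f (- y) \<partial>M) = (\<integral>\<^sup>+x. indicator C x * (\<integral>\<^sup>+y. f (- y) \<partial>M) \<partial>M)"
    by (simp add: nn_integral_multc)
  also have "\<dots> = (\<integral>\<^sup>+x. indicator C x * (\<integral>\<^sup>+y. f (- y + x) \<partial>M) \<partial>M)"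
  proof (intro nn_integral_cong)
    fix x
    have "(\<integral>\<^sup>+y. f (- y + x) \<partial>M) = (\<integral>\<^sup>+y. f (- (- x + y)) \<partial>M)" by (simp add: minus_add)
    also have "\<dots> = (\<integral>\<^sup>+y. f (- y) \<partial>M)"
      by (rule nn_integral_left[where f="\<lambda>y. f (- y)"]) measurable
    finally show "indicator C x * (\<integral>\<^sup>+y. f (- y) \<partial>M) = indicator C x * (\<integral>\<^sup>+y. f (- y + x) \<partial>M)" by simp
  qed
  also have "\<dots> = (\<integral>\<^sup>+x. (\<integral>\<^sup>+y. indicator C x * f (- y + x) \<partial>M) \<partial>M)"
    by (simp add: nn_integral_cmult)
  also have "\<dots> = (\<integral>\<^sup>+y. (\<integral>\<^sup>+x. indicator C x * f (- y + x) \<partial>M) \<partial>M)"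
    by (rule prod.Fubini') measurable
  also have "\<dots> = (\<integral>\<^sup>+y. (\<integral>\<^sup>+x. indicator C (y + x) * f x \<partial>M) \<partial>M)"
  proof (rule nn_integral_cong)
    fix y
    have "(\<integral>\<^sup>+x. indicator C (y + x) * f (- y + (y + x)) \<partial>M) = (\<integral>\<^sup>+x. indicator C x * f (- y + x) \<partial>M)"
      by (rule nn_integral_left[where f="\<lambda>x. indicator C x * f (- y + x)"]) measurable
    then show "(\<integral>\<^sup>+x. indicator C x * f (- y + x) \<partial>M) = (\<integral>\<^sup>+x. indicator C (y + x) * f x \<partial>M)"
      by (simp add: add.assoc[symmetric])
  qed
  also have "\<dots> = (\<integral>\<^sup>+x. (\<integral>\<^sup>+y. indicator C (y + x) * f x \<partial>M) \<partial>M)"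
    by (rule prod.Fubini') measurable
  also have "\<dots> = (\<integral>\<^sup>+x. (ennreal (1 / \<Delta> x) * ?c) * f x \<partial>M)"
    by (simp add: nn_integral_multc emeasure_right_preimage[OF C(1)])
  also have "\<dots> = ?c * (\<integral>\<^sup>+x. f x * ennreal (1 / \<Delta> x) \<partial>M)"
    by (subst nn_integral_cmult[symmetric]) (auto simp: mult_ac)
  finally have "?c * (\<integral>\<^sup>+y. f (- y) \<partial>M) = ?c * (\<integral>\<^sup>+x. f x * ennreal (1 / \<Delta> x) \<partial>M)" .
  then show ?thesis using C by (auto simp: ennreal_mult_cancel_left)
qed

end

section \<open>Convergence in norm from pointwise convergence and convergence of the norms\<close>

lemma powr_add_le:
  fixes a b s :: real
  assumes "0 \<le> a" "0 \<le> b" "0 < s"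
  shows "(a + b) powr s \<le> 2 powr s * (a powr s + b powr s)"
proof -
  have "(a + b) powr s \<le> (2 * max a b) powr s" using assms by (intro powr_mono2) auto
  also have "\<dots> = 2 powr s * max a b powr s" using assms by (simp add: powr_mult)
  also have "\<dots> \<le> 2 powr s * (a powr s + b powr s)"
    by (intro mult_left_mono) (auto simp: max_def)
  finally show ?thesis .
qed

text \<open>Scheffe's lemma handles the \<open>s\<close>-th powers of the functions; the part of the \<open>s\<close>-th power
  of the difference that it does not control is dominated by a multiple of the limit.\<close>
lemma Lpw_norm_diff_tendsto_0:
  fixes g :: "nat \<Rightarrow> 'a \<Rightarrow> complex"
  assumes g: "\<And>n. in_Lpw M s v (g n)" and h: "in_Lpw M s v h" and v: "\<And>x. 0 \<le> v x" and s: "1 \<le> s"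
    and lim: "\<And>x. (\<lambda>n. g n x) \<longlonglongrightarrow> h x"
    and nlim: "(\<lambda>n. Lpw_norm M s v (g n)) \<longlonglongrightarrow> Lpw_norm M s v h"
  shows "(\<lambda>n. Lpw_norm M s v (\<lambda>x. g n x - h x)) \<longlonglongrightarrow> 0"
proof -
  have s0: "s > 0" using s by simp
  define F where "F n x = (v x * norm (g n x)) powr s" for n x
  define f where "f x = (v x * norm (h x)) powr s" for x
  define a where "a n x = (v x * norm (g n x - h x)) powr s" for n x
  have intF: "(\<integral>\<^sup>+x. ennreal (F n x) \<partial>M) = ennreal (Lpw_norm M s v (g n) powr s)" for n
    unfolding F_def by (rule nn_integral_Lpw_norm[OF g s0 v])
  have intf: "(\<integral>\<^sup>+x. ennreal (f x) \<partial>M) = ennreal (Lpw_norm M s v h powr s)"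
    unfolding f_def by (rule nn_integral_Lpw_norm[OF h s0 v])
  have inta: "(\<integral>\<^sup>+x. ennreal (a n x) \<partial>M) = ennreal (Lpw_norm M s v (\<lambda>x. g n x - h x) powr s)" for n
    unfolding a_def by (rule nn_integral_Lpw_norm[OF in_Lpw_diff[OF g h v s] s0 v])
  have mF[measurable]: "F n \<in> borel_measurable M" for n
    unfolding F_def using in_Lpw_measurable_norm[OF g v] by measurable
  have mf[measurable]: "f \<in> borel_measurable M"
    unfolding f_def using in_Lpw_measurable_norm[OF h v] by measurable
  have ma[measurable]: "a n \<in> borel_measurable M" for n
    unfolding a_def using in_Lpw_measurable_norm[OF in_Lpw_diff[OF g h v s] v] by measurable
  have iF: "integrable M (F n)" for n
    by (rule integrableI_bounded) (auto simp: intF F_def[abs_def, symmetric] F_def intF[unfolded F_def])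
  have intg: "integrable M f"
    by (rule integrableI_bounded) (auto simp: f_def intf[unfolded f_def])
  have pw: "(\<lambda>n. F n x) \<longlonglongrightarrow> f x" for x
    unfolding F_def f_def using s0 v
    by (intro tendsto_powr' tendsto_mult tendsto_norm tendsto_const lim) auto
  have pwa: "(\<lambda>n. a n x) \<longlonglongrightarrow> 0" for x
  proof -
    have "(\<lambda>n. (v x * norm (g n x - h x)) powr s) \<longlonglongrightarrow> (v x * norm (h x - h x)) powr s"
      using s0 v by (intro tendsto_powr' tendsto_mult tendsto_norm tendsto_const tendsto_diff lim) auto
    then show ?thesis using s0 by (simp add: a_def)
  qed
  have sch: "(\<lambda>n. \<integral>\<^sup>+x. norm (F n x - f x) \<partial>M) \<longlonglongrightarrow> 0"
  proof (rule Scheffe_lemma1[OF iF intg])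
    have "(\<lambda>n. ennreal (Lpw_norm M s v (g n) powr s)) \<longlonglongrightarrow> ennreal (Lpw_norm M s v h powr s)"
      using s0 by (intro tendsto_ennrealI tendsto_powr' nlim tendsto_const) (auto simp: Lpw_norm_nonneg)
    then have "limsup (\<lambda>n. \<integral>\<^sup>+x. ennreal (F n x) \<partial>M) = (\<integral>\<^sup>+x. ennreal (f x) \<partial>M)"
      unfolding intF intf by (intro lim_imp_Limsup) auto
    then show "limsup (\<lambda>n. \<integral>\<^sup>+x. norm (F n x) \<partial>M) \<le> (\<integral>\<^sup>+x. norm (f x) \<partial>M)"
      by (simp add: F_def f_def)
  qed (use pw in auto)
  define c where "c = 2 powr s"
  have c: "c > 0" by (simp add: c_def)
  have dom: "(\<lambda>n. \<integral>x. min (a n x) (2 * c * f x) \<partial>M) \<longlonglongrightarrow> (\<integral>x. 0 \<partial>M)"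
  proof (rule integral_dominated_convergence)
    show "integrable M (\<lambda>x. 2 * c * f x)" using intg by simp
    show "AE x in M. norm (min (a n x) (2 * c * f x)) \<le> 2 * c * f x" for n
      using c by (auto simp: a_def f_def min_def)
    have "(\<lambda>n. min (a n x) (2 * c * f x)) \<longlonglongrightarrow> min 0 (2 * c * f x)" for x
      by (intro tendsto_min pwa tendsto_const)
    moreover have "min 0 (2 * c * f x) = 0" for x using c by (simp add: f_def)
    ultimately show "AE x in M. (\<lambda>n. min (a n x) (2 * c * f x)) \<longlonglongrightarrow> 0" by simp
  qed auto
  \<comment> \<open>With \<open>a <= c * (F + f)\<close> and \<open>F <= |F - f| + f\<close>:
    whatever exceeds the cut-off \<open>2 * c * f\<close> is paid for by
    \<open>c * |F - f|\<close>.\<close>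
  have le: "a n x \<le> min (a n x) (2 * c * f x) + c * norm (F n x - f x)" for n x
  proof -
    have "a n x \<le> (v x * norm (g n x) + v x * norm (h x)) powr s"
      unfolding a_def using v s0
      by (intro powr_mono2) (auto simp: distrib_left[symmetric] norm_triangle_ineq4 mult_left_mono)
    also have "\<dots> \<le> c * (F n x + f x)"
      unfolding F_def f_def c_def using v s0 by (intro powr_add_le) auto
    also have "\<dots> \<le> c * (norm (F n x - f x) + 2 * f x)"
      using c by (intro mult_left_mono) auto
    finally have "a n x \<le> 2 * c * f x + c * norm (F n x - f x)" by (simp add: algebra_simps)
    moreover have "0 \<le> c * norm (F n x - f x)" using c by simp
    ultimately show ?thesis unfolding min_def by auto
  qed
  have bnd: "(\<integral>\<^sup>+x. ennreal (a n x) \<partial>M) \<le> ennreal (\<integral>x. min (a n x) (2 * c * f x) \<partial>M) + ennreal c * (\<integral>\<^sup>+x. norm (F n x - f x) \<partial>M)" for n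
  proof -
    have nn: "0 \<le> min (a n x) (2 * c * f x)" for x using c by (auto simp: a_def f_def)
    have f0: "0 \<le> f x" for x by (simp add: f_def)
    have i: "integrable M (\<lambda>x. min (a n x) (2 * c * f x))"
      by (rule Bochner_Integration.integrable_bound[of M "\<lambda>x. 2 * c * f x"]) (use intg nn c f0 in auto)
    have "(\<integral>\<^sup>+x. ennreal (a n x) \<partial>M) \<le> (\<integral>\<^sup>+x. ennreal (min (a n x) (2 * c * f x)) + ennreal c * ennreal (norm (F n x - f x)) \<partial>M)"
      using le nn c by (intro nn_integral_mono) (simp add: ennreal_plus[symmetric] ennreal_mult[symmetric] ennreal_leI del: ennreal_plus)
    also have "\<dots> = ennreal (\<integral>x. min (a n x) (2 * c * f x) \<partial>M) + ennreal c * (\<integral>\<^sup>+x. norm (F n x - f x) \<partial>M)"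
      using nn_integral_eq_integral[OF i] nn by (simp add: nn_integral_add nn_integral_cmult)
    finally show ?thesis .
  qed
  have "(\<lambda>n. ennreal (\<integral>x. min (a n x) (2 * c * f x) \<partial>M) + ennreal c * (\<integral>\<^sup>+x. norm (F n x - f x) \<partial>M))
      \<longlonglongrightarrow> ennreal (\<integral>x. 0 \<partial>M) + ennreal c * 0"
    by (intro tendsto_add tendsto_ennrealI dom ennreal_tendsto_cmult sch) simp
  then have lim0: "(\<lambda>n. ennreal (\<integral>x. min (a n x) (2 * c * f x) \<partial>M) + ennreal c * (\<integral>\<^sup>+x. norm (F n x - f x) \<partial>M)) \<longlonglongrightarrow> 0"
    by simp
  have "(\<lambda>n. \<integral>\<^sup>+x. ennreal (a n x) \<partial>M) \<longlonglongrightarrow> 0"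
    by (rule tendsto_sandwich[OF _ _ tendsto_const lim0]) (use bnd in auto)
  then have "(\<lambda>n. ennreal (Lpw_norm M s v (\<lambda>x. g n x - h x) powr s)) \<longlonglongrightarrow> ennreal 0"
    unfolding inta by simp
  then have lims: "(\<lambda>n. Lpw_norm M s v (\<lambda>x. g n x - h x) powr s) \<longlonglongrightarrow> 0"
    by (subst (asm) tendsto_ennreal_iff) auto
  have "(\<lambda>n. (Lpw_norm M s v (\<lambda>x. g n x - h x) powr s) powr (1 / s)) \<longlonglongrightarrow> 0 powr (1 / s)"
    using s0 by (intro tendsto_powr'[OF lims tendsto_const]) auto
  then show ?thesis using s0 by (simp add: powr_powr Lpw_norm_nonneg)
qed

section \<open>Moderate weights and translations\<close>

lemma weight_imp_moderate: "weight w \<Longrightarrow> moderate w w"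
  by (auto simp: weight_def moderate_def)

text \<open>Symmetry of \<open>w\<close> turns the upper bounds for \<open>m\<close> into
  \<open>m y <= w x * m (x + y)\<close> and its mirror image. The lemma gives access to the dual
  space of L_{r,m}, whose weight is 1/m.\<close>

lemma moderate_inverse:
  fixes w m :: "'g::{topological_space, group_add} \<Rightarrow> real"
  assumes w: "weight w" and m: "moderate w m"
  shows "moderate w (\<lambda>x. 1 / m x)"
proof -
  have pos: "m x > 0" for x using m by (auto simp: moderate_def)
  have "m y \<le> w x * m (x + y)" for x y
    using m w unfolding moderate_def weight_def by (metis minus_add_cancel)
  moreover have "m x \<le> m (x + y) * w y" for x y
    using m w unfolding moderate_def weight_def by (metis add.assoc add.right_inverse add.right_neutral)
  moreover have "continuous_on UNIV (\<lambda>x. 1 / m x)"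
    using m pos by (intro continuous_intros) (auto simp: moderate_def less_imp_neq[THEN not_sym])
  ultimately show ?thesis using pos unfolding moderate_def by (simp add: field_simps)
qed

context haar_group
begin

context
  fixes w m :: "'g \<Rightarrow> real"
  assumes w: "weight w" and m: "moderate w m"
begin

lemma weight_measurable: "w \<in> borel_measurable M"
  and moderate_measurable: "m \<in> borel_measurable M"
  using w m by (auto simp: weight_def moderate_def intro: continuous_measurable)

lemma weight_nonneg: "0 \<le> w x" and moderate_nonneg: "0 \<le> m x"
  using w m by (auto simp: weight_def moderate_def less_imp_le)

lemma moderate_shift: "m z \<le> m y * w (- y + z)"
proof -
  have "m (y + (- y + z)) \<le> m y * w (- y + z)" using m unfolding moderate_def by blast
  then show ?thesis by (simp add: add.assoc[symmetric])
qed

lemma nn_integral_ltrans_Lpw: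
  assumes f: "in_Lpw M s w f" and s: "0 < s"
  shows "(\<integral>\<^sup>+z. ennreal ((m z * norm (ltrans x f z)) powr s) \<partial>M) = (\<integral>\<^sup>+z. ennreal ((m (x + z) * norm (f z)) powr s) \<partial>M)"
proof -
  note [measurable] = weight_measurable moderate_measurable in_Lpw_measurable[OF f]
  have "(\<integral>\<^sup>+z. ennreal ((m (x + z) * norm (f (- x + (x + z)))) powr s) \<partial>M) = (\<integral>\<^sup>+z. ennreal ((m z * norm (f (- x + z))) powr s) \<partial>M)"
    by (rule nn_integral_left[where f="\<lambda>z. ennreal ((m z * norm (f (- x + z))) powr s)"]) measurable
  then show ?thesis by (simp add: ltrans_def add.assoc[symmetric])
qed

text \<open>Translation passes from the weight \<open>w\<close> to any moderate weight. In this way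
  the assumptions on \<open>K\<close>, made for \<open>w\<close> only, reach the weights m and
  1/m.\<close>

lemma
  assumes f: "in_Lpw M s w f" and s: "0 < s"
  shows in_Lpw_ltrans: "in_Lpw M s m (ltrans x f)"
    and Lpw_norm_ltrans: "Lpw_norm M s m (ltrans x f) \<le> m x * Lpw_norm M s w f"
proof -
  note [measurable] = weight_measurable moderate_measurable in_Lpw_measurable[OF f]
  have le: "m (x + z) \<le> m x * w z" for z using m by (auto simp: moderate_def)
  have "(\<integral>\<^sup>+z. ennreal ((m z * norm (ltrans x f z)) powr s) \<partial>M) \<le> (\<integral>\<^sup>+z. ennreal (m x powr s) * ennreal ((w z * norm (f z)) powr s) \<partial>M)"
    unfolding nn_integral_ltrans_Lpw[OF assms]
  proof (intro nn_integral_mono)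
    fix z
    have "(m (x + z) * norm (f z)) powr s \<le> (m x * (w z * norm (f z))) powr s"
      using le[of z] s by (intro powr_mono2) (auto simp: mult.assoc[symmetric] intro!: mult_right_mono mult_nonneg_nonneg moderate_nonneg)
    also have "\<dots> = m x powr s * (w z * norm (f z)) powr s"
      by (rule powr_mult)
    finally show "ennreal ((m (x + z) * norm (f z)) powr s) \<le> ennreal (m x powr s) * ennreal ((w z * norm (f z)) powr s)"
      by (simp add: ennreal_mult[symmetric] ennreal_leI)
  qed
  also have "\<dots> = ennreal (m x powr s) * ennreal (Lpw_norm M s w f powr s)"
    by (subst nn_integral_cmult) (auto simp: nn_integral_Lpw_norm[OF f s weight_nonneg])
  also have "\<dots> = ennreal ((m x * Lpw_norm M s w f) powr s)"
    by (simp add: ennreal_mult[symmetric] powr_mult moderate_nonneg Lpw_norm_nonneg)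
  finally have *: "(\<integral>\<^sup>+z. ennreal ((m z * norm (ltrans x f z)) powr s) \<partial>M) \<le> ennreal ((m x * Lpw_norm M s w f) powr s)" .
  have meas: "ltrans x f \<in> borel_measurable M" "(\<lambda>z. complex_of_real (m z) * ltrans x f z) \<in> borel_measurable M"
    unfolding ltrans_def by measurable
  have nn: "0 \<le> m x * Lpw_norm M s w f" by (simp add: moderate_nonneg Lpw_norm_nonneg)
  show "in_Lpw M s m (ltrans x f)" "Lpw_norm M s m (ltrans x f) \<le> m x * Lpw_norm M s w f"
    using in_Lpw_bound[OF meas moderate_nonneg s nn *] Lpw_norm_bound[OF meas moderate_nonneg s nn *] by auto
qed

text \<open>Continuity of \<open>f\<close> gives pointwise convergence of the translates, so it
  remains to let the norms converge. After the translation is moved onto the weight,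
  \<open>m (X n + z)\<close> converges and is dominated by \<open>B * w z\<close>, where
  \<open>B\<close> bounds the convergent sequence \<open>m (X n)\<close>.\<close>

lemma Lpw_ltrans_continuous_seq:
  assumes f: "in_Lpw M s w f" and s: "1 \<le> s" and cont: "continuous_on UNIV f"
    and X: "X \<longlonglongrightarrow> x"
  shows "(\<lambda>n. Lpw_norm M s m (\<lambda>z. ltrans (X n) f z - ltrans x f z)) \<longlonglongrightarrow> 0"
proof (rule Lpw_norm_diff_tendsto_0)
  have s0: "0 < s" using s by simp
  note [measurable] = weight_measurable moderate_measurable in_Lpw_measurable[OF f]
  show "in_Lpw M s m (ltrans (X n) f)" "in_Lpw M s m (ltrans x f)" for n
    using in_Lpw_ltrans[OF f s0] by auto
  have cf: "(\<lambda>n. f (Y n)) \<longlonglongrightarrow> f y" if "Y \<longlonglongrightarrow> y" for Y y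
    using continuous_on_tendsto_compose[OF cont that] by auto
  have cm: "(\<lambda>n. m (Y n)) \<longlonglongrightarrow> m y" if "Y \<longlonglongrightarrow> y" for Y y
    using continuous_on_tendsto_compose[OF _ that, of UNIV m] m by (auto simp: moderate_def)
  show "(\<lambda>n. ltrans (X n) f z) \<longlonglongrightarrow> ltrans x f z" for z
    unfolding ltrans_def by (intro cf tendsto_add tendsto_minus X tendsto_const)
  have "bounded (range (\<lambda>n. m (X n)))" by (rule convergent_imp_bounded[OF cm[OF X]])
  then obtain B where "\<And>n. norm (m (X n)) \<le> B" unfolding bounded_iff by auto
  then have B: "m (X n) \<le> B" for n by (metis abs_le_D1 real_norm_def)
  have B0: "0 \<le> B" using B[of 0] moderate_nonneg[of "X 0"] by linarith
  have le: "m (X n + z) \<le> B * w z" for n z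
  proof -
    have "m (X n + z) \<le> m (X n) * w z" using m by (auto simp: moderate_def)
    also have "\<dots> \<le> B * w z" by (intro mult_right_mono B weight_nonneg)
    finally show ?thesis .
  qed
  have "(\<lambda>n. \<integral>\<^sup>+z. ennreal ((m (X n + z) * norm (f z)) powr s) \<partial>M) \<longlonglongrightarrow> (\<integral>\<^sup>+z. ennreal ((m (x + z) * norm (f z)) powr s) \<partial>M)"
  proof (rule nn_integral_dominated_convergence[where w="\<lambda>z. ennreal (B powr s) * ennreal ((w z * norm (f z)) powr s)"])
    show "AE z in M. ennreal ((m (X n + z) * norm (f z)) powr s) \<le> ennreal (B powr s) * ennreal ((w z * norm (f z)) powr s)" for n
    proof (rule AE_I2)
      fix z
      have "(m (X n + z) * norm (f z)) powr s \<le> (B * (w z * norm (f z))) powr s"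
        using le[of n z] s by (intro powr_mono2) (auto simp: mult.assoc[symmetric] intro!: mult_right_mono mult_nonneg_nonneg moderate_nonneg)
      also have "\<dots> = B powr s * (w z * norm (f z)) powr s"
        by (rule powr_mult)
      finally show "ennreal ((m (X n + z) * norm (f z)) powr s) \<le> ennreal (B powr s) * ennreal ((w z * norm (f z)) powr s)"
        by (simp add: ennreal_mult[symmetric] ennreal_leI)
    qed
    have "(\<integral>\<^sup>+z. ennreal (B powr s) * ennreal ((w z * norm (f z)) powr s) \<partial>M) = ennreal (B powr s) * ennreal (Lpw_norm M s w f powr s)"
      by (subst nn_integral_cmult) (auto simp: nn_integral_Lpw_norm[OF f s0 weight_nonneg])
    then show "(\<integral>\<^sup>+z. ennreal (B powr s) * ennreal ((w z * norm (f z)) powr s) \<partial>M) < \<infinity>"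
      by (simp add: ennreal_mult[symmetric])
    show "AE z in M. (\<lambda>n. ennreal ((m (X n + z) * norm (f z)) powr s)) \<longlonglongrightarrow> ennreal ((m (x + z) * norm (f z)) powr s)"
      using s0 by (intro AE_I2 tendsto_ennrealI tendsto_powr' tendsto_mult cm tendsto_add X tendsto_const)
        (simp_all add: moderate_nonneg)
  qed measurable
  then have "(\<lambda>n. ennreal (Lpw_norm M s m (ltrans (X n) f) powr s)) \<longlonglongrightarrow> ennreal (Lpw_norm M s m (ltrans x f) powr s)"
    by (simp add: nn_integral_ltrans_Lpw[OF f s0, symmetric] nn_integral_Lpw_norm[OF in_Lpw_ltrans[OF f s0] s0 moderate_nonneg])
  then have lim: "(\<lambda>n. Lpw_norm M s m (ltrans (X n) f) powr s) \<longlonglongrightarrow> Lpw_norm M s m (ltrans x f) powr s"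
    by (subst (asm) tendsto_ennreal_iff) auto
  have "(\<lambda>n. (Lpw_norm M s m (ltrans (X n) f) powr s) powr (1 / s)) \<longlonglongrightarrow> (Lpw_norm M s m (ltrans x f) powr s) powr (1 / s)"
    using s0 by (intro tendsto_powr'[OF lim tendsto_const]) auto
  then show "(\<lambda>n. Lpw_norm M s m (ltrans (X n) f)) \<longlonglongrightarrow> Lpw_norm M s m (ltrans x f)"
    using s0 by (simp add: powr_powr Lpw_norm_nonneg)
qed (use s moderate_nonneg in auto)

text \<open>The group is first countable, so sequences decide about neighbourhoods.\<close>

lemma Lpw_ltrans_nhds:
  assumes f: "in_Lpw M s w f" and s: "1 \<le> s" and cont: "continuous_on UNIV f" and e: "e > 0"
  shows "\<exists>U. open U \<and> x \<in> U \<and> (\<forall>y\<in>U. Lpw_norm M s m (\<lambda>z. ltrans y f z - ltrans x f z) < e)"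
proof -
  have "eventually (\<lambda>y. Lpw_norm M s m (\<lambda>z. ltrans y f z - ltrans x f z) < e) (at x)"
  proof (rule sequentially_imp_eventually_at, safe)
    fix X assume "X \<longlonglongrightarrow> x"
    from order_tendstoD(2)[OF Lpw_ltrans_continuous_seq[OF f s cont this] e]
    show "eventually (\<lambda>n. Lpw_norm M s m (\<lambda>z. ltrans (X n) f z - ltrans x f z) < e) sequentially" .
  qed
  then obtain U where U: "open U" "x \<in> U" "\<And>y. y \<in> U \<Longrightarrow> y \<noteq> x \<Longrightarrow> Lpw_norm M s m (\<lambda>z. ltrans y f z - ltrans x f z) < e"
    by (auto simp: eventually_at_topological)
  have "Lpw_norm M s m (\<lambda>z. ltrans x f z - ltrans x f z) < e" using e s by (simp add: Lpw_norm_zero)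
  then show ?thesis using U by metis
qed

end

end

section \<open>The voice transform\<close>

lemma borel_measurable_cnj [measurable (raw)]:
  assumes "f \<in> borel_measurable N"
  shows "(\<lambda>x. cnj (f x)) \<in> borel_measurable N"
  using assms by (rule borel_measurable_continuous_on[rotated]) (intro continuous_intros)

section \<open>Inner product on the representation space\<close>

locale hilbert =
  fixes sc :: "complex \<Rightarrow> 'h::ab_group_add \<Rightarrow> 'h" and ip :: "'h \<Rightarrow> 'h \<Rightarrow> complex"
  assumes H: "complex_hilbert sc ip"
begin

lemma ip_add_left: "ip (v + v') z = ip v z + ip v' z"
  and ip_sc_left: "ip (sc a v) z = a * ip v z"
  and ip_cnj: "cnj (ip v z) = ip z v"
  and ip_self_nonneg: "0 \<le> Re (ip v v)"
  and ip_eq_0: "ip v v = 0 \<Longrightarrow> v = 0"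
  and sc_one: "sc 1 v = v"
  and sc_add: "sc (a + b) v = sc a v + sc b v"
proof -
  note h = H[unfolded complex_hilbert_def]
  note h2 = h[THEN conjunct2, THEN conjunct2]
  note h4 = h2[THEN conjunct2, THEN conjunct2]
  note h6 = h4[THEN conjunct2, THEN conjunct2]
  note h8 = h6[THEN conjunct2, THEN conjunct2]
  show "ip (v + v') z = ip v z + ip v' z" by (rule h4[THEN conjunct1, rule_format])
  show "ip (sc a v) z = a * ip v z" by (rule h4[THEN conjunct2, THEN conjunct1, rule_format])
  show "cnj (ip v z) = ip z v" by (rule h6[THEN conjunct1, rule_format, symmetric])
  show "0 \<le> Re (ip v v)" by (rule h6[THEN conjunct2, THEN conjunct1, rule_format])
  show "ip v v = 0 \<Longrightarrow> v = 0" by (rule h8[THEN conjunct1, rule_format])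
  show "sc 1 v = v" by (rule h[THEN conjunct1, rule_format])
  show "sc (a + b) v = sc a v + sc b v" by (rule h2[THEN conjunct1, rule_format])
qed

lemma sc_zero: "sc 0 v = 0"
  using sc_add[of 0 0 v] by simp

lemma ip_zero_left: "ip 0 z = 0"
  using ip_add_left[of 0 0 z] by simp

lemma ip_diff_left: "ip (v - v') z = ip v z - ip v' z"
  using ip_add_left[of "v - v'" v' z] by simp

lemma ip_add_right: "ip z (v + v') = ip z v + ip z v'"
  and ip_diff_right: "ip z (v - v') = ip z v - ip z v'"
  and ip_sc_right: "ip z (sc a v) = cnj a * ip z v"
  by (metis ip_cnj ip_add_left complex_cnj_add, metis ip_cnj ip_diff_left complex_cnj_diff,
      metis ip_cnj ip_sc_left complex_cnj_mult)

lemma ip_sum_left: "ip (\<Sum>x\<in>F. f x) z = (\<Sum>x\<in>F. ip (f x) z)"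
  by (induction F rule: infinite_finite_induct) (auto simp: ip_add_left ip_zero_left)

lemma hnorm_nonneg: "0 \<le> hnorm ip v"
  by (simp add: hnorm_def ip_self_nonneg)

lemma ip_self: "ip v v = complex_of_real ((hnorm ip v)\<^sup>2)"
proof -
  have "Im (ip v v) = 0" using ip_cnj[of v v] by (simp add: complex_eq_iff)
  then show ?thesis by (simp add: hnorm_def ip_self_nonneg complex_eq_iff)
qed

lemma Cauchy_Schwarz_ip: "cmod (ip v z) \<le> hnorm ip v * hnorm ip z"
proof (cases "hnorm ip z = 0")
  case True
  then have "z = 0" using ip_self[of z] by (intro ip_eq_0) simp
  then have "ip v z = 0" using ip_cnj[of z v] ip_zero_left[of v] by simp
  then show ?thesis by (simp add: hnorm_nonneg)
next
  case False
  then have pos: "hnorm ip z > 0" using hnorm_nonneg[of z] by linarith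
  define N where "N = complex_of_real ((hnorm ip z)\<^sup>2)"
  define a where "a = ip v z / N"
  have N: "N \<noteq> 0" "cnj N = N" using pos by (auto simp: N_def)
  have "ip (v - sc a z) (v - sc a z) = ip v v - cnj a * ip v z - a * ip z v + a * cnj a * N"
    by (simp add: ip_diff_left ip_diff_right ip_sc_left ip_sc_right ip_self[of z] N_def algebra_simps)
  also have "\<dots> = ip v v - ip v z * cnj (ip v z) / N"
    using N by (simp add: a_def ip_cnj field_simps power2_eq_square)
  also have "\<dots> = complex_of_real ((hnorm ip v)\<^sup>2 - (cmod (ip v z))\<^sup>2 / (hnorm ip z)\<^sup>2)"
    by (simp add: ip_self[of v] N_def complex_norm_square[symmetric])
  finally have "0 \<le> (hnorm ip v)\<^sup>2 - (cmod (ip v z))\<^sup>2 / (hnorm ip z)\<^sup>2"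
    using ip_self_nonneg[of "v - sc a z"] by simp
  then have "(cmod (ip v z))\<^sup>2 \<le> (hnorm ip v * hnorm ip z)\<^sup>2"
    using pos by (simp add: power_mult_distrib field_simps)
  then show ?thesis by (rule power2_le_imp_le) (simp add: hnorm_nonneg)
qed

end

section \<open>The kernel and the isometry\<close>

locale voice_transform = haar_group M + hilbert sc ip
  for M :: "'g::{topological_group_add,t2_space,second_countable_topology} measure"
    and sc :: "complex \<Rightarrow> 'h::ab_group_add \<Rightarrow> 'h" and ip :: "'h \<Rightarrow> 'h \<Rightarrow> complex" +
  fixes \<pi> :: "'g \<Rightarrow> 'h \<Rightarrow> 'h" and u :: 'h and w :: "'g \<Rightarrow> real"
  assumes rep: "unitary_rep sc ip \<pi>"
    and isometry: "\<forall>v. in_Lp M 2 (voice ip \<pi> u v) \<and> Lp_norm M 2 (voice ip \<pi> u v) = hnorm ip v"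
    and w: "weight w"
    and standing: "\<forall>s>1. in_Lpw M s w (kernel ip \<pi> u)"
begin

abbreviation "K \<equiv> kernel ip \<pi> u"
abbreviation "V \<equiv> voice ip \<pi> u"

lemma rep_ip: "ip (\<pi> x v) (\<pi> x v') = ip v v'"
  and rep_plus: "\<pi> (x + y) v = \<pi> x (\<pi> y v)"
  and rep_zero: "\<pi> 0 v = v"
  and rep_cont: "((\<lambda>x. hnorm ip (\<pi> x v - \<pi> x0 v)) \<longlongrightarrow> 0) (at x0)"
  using rep by (auto simp: unitary_rep_def)

lemma ip_rep_rep: "ip (\<pi> x u) (\<pi> y u) = K (- x + y)"
proof -
  have "ip (\<pi> x u) (\<pi> y u) = ip (\<pi> (- x) (\<pi> x u)) (\<pi> (- x) (\<pi> y u))" by (simp add: rep_ip)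
  also have "\<dots> = ip u (\<pi> (- x + y) u)" by (simp add: rep_plus[symmetric] rep_zero)
  finally show ?thesis by (simp add: kernel_def)
qed

lemma voice_rep: "V (\<pi> x u) = ltrans x K"
  by (auto simp: voice_def ltrans_def ip_rep_rep)

lemma K_minus: "K (- x) = cnj (K x)"
  using ip_rep_rep[of x 0] ip_cnj[of u "\<pi> x u"] by (simp add: rep_zero kernel_def)

lemma norm_K_minus: "norm (K (- x)) = norm (K x)"
  by (simp add: K_minus)

lemma norm_K_flip: "norm (K (- y + x)) = norm (K (- x + y))"
  using norm_K_minus[of "- x + y"] by (simp add: minus_add)

text \<open>Cauchy-Schwarz and unitarity. The bound serves twice: as a uniform bound on the
  integrand of the Riemann sums, and to make the supremum in the oscillation a genuine one.\<close>

lemma norm_K_le: "norm (K x) \<le> (hnorm ip u)\<^sup>2"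
proof -
  have "hnorm ip (\<pi> x u) = hnorm ip u" by (simp add: hnorm_def rep_ip)
  then show ?thesis using Cauchy_Schwarz_ip[of u "\<pi> x u"] by (simp add: kernel_def power2_eq_square)
qed

lemma K_continuous: "continuous_on UNIV K"
  unfolding continuous_on_def
proof safe
  fix x0 :: 'g
  have "((\<lambda>x. K x - K x0) \<longlongrightarrow> 0) (at x0)"
  proof (rule Lim_null_comparison)
    show "eventually (\<lambda>x. norm (K x - K x0) \<le> hnorm ip u * hnorm ip (\<pi> x u - \<pi> x0 u)) (at x0)"
      using Cauchy_Schwarz_ip[of u] by (intro always_eventually) (auto simp: kernel_def ip_diff_right[symmetric])
    show "((\<lambda>x. hnorm ip u * hnorm ip (\<pi> x u - \<pi> x0 u)) \<longlongrightarrow> 0) (at x0)"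
      using rep_cont by (rule tendsto_mult_right_zero)
  qed
  then show "(K \<longlongrightarrow> K x0) (at x0)" by (simp add: LIM_zero_iff)
qed

lemma K_measurable [measurable]: "K \<in> borel_measurable M" "K \<in> borel_measurable borel"
  using continuous_measurable[OF K_continuous] borel_measurable_continuous_onI[OF K_continuous] by auto

lemma w_measurable [measurable]: "w \<in> borel_measurable M" "w \<in> borel_measurable borel"
  using w by (auto simp: weight_def intro: continuous_measurable borel_measurable_continuous_onI)

lemma w_pos: "0 < w x" and w_nonneg: "0 \<le> w x" and w_plus: "w (x + y) \<le> w x * w y" and w_minus: "w (- x) = w x"
  using w by (auto simp: weight_def less_imp_le)

lemma K_in_Lpw: "1 < s \<Longrightarrow> in_Lpw M s w K"
  using standing by blast

lemma voice_measurable [measurable]: "V v \<in> borel_measurable M"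
  using isometry by (auto simp: in_Lp_def)

lemma voice_square: "integrable M (\<lambda>x. (norm (V v x))\<^sup>2)" "(\<integral>x. (norm (V v x))\<^sup>2 \<partial>M) = Re (ip v v)"
proof -
  have 1: "integrable M (\<lambda>x. norm (V v x) powr 2)" using isometry by (simp add: in_Lp_def)
  then show "integrable M (\<lambda>x. (norm (V v x))\<^sup>2)" by simp
  have "(\<integral>x. (norm (V v x))\<^sup>2 \<partial>M) powr (1 / 2) = sqrt (Re (ip v v))"
    using isometry by (simp add: Lp_norm_def hnorm_def)
  moreover have "0 \<le> (\<integral>x. (norm (V v x))\<^sup>2 \<partial>M)" by simp
  ultimately show "(\<integral>x. (norm (V v x))\<^sup>2 \<partial>M) = Re (ip v v)"
    by (simp add: powr_half_sqrt ip_self_nonneg)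
qed

lemma voice_add: "V (v + v') x = V v x + V v' x" and voice_sc: "V (sc a v) x = a * V v x"
  by (simp_all add: voice_def ip_add_left ip_sc_left)

lemma voice_inner_integrable: "integrable M (\<lambda>x. V v x * cnj (V z x))"
proof (rule Bochner_Integration.integrable_bound)
  show "integrable M (\<lambda>x. (norm (V v x))\<^sup>2 + (norm (V z x))\<^sup>2)"
    by (intro Bochner_Integration.integrable_add voice_square)
  have "cmod a * cmod b \<le> (cmod a)\<^sup>2 + (cmod b)\<^sup>2" for a b
  proof -
    have "2 * cmod a * cmod b \<le> (cmod a)\<^sup>2 + (cmod b)\<^sup>2" by (rule sum_squares_bound)
    moreover have "0 \<le> cmod a * cmod b" by simp
    ultimately show ?thesis by linarith
  qed
  then show "AE x in M. norm (V v x * cnj (V z x)) \<le> norm ((norm (V v x))\<^sup>2 + (norm (V z x))\<^sup>2)"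
    by (simp add: norm_mult)
qed measurable

text \<open>Polarisation: the isometry for \<open>v + z\<close> gives the real part, and replacing
  \<open>v\<close> by \<open>sc \<i> v\<close> gives the imaginary part.\<close>

lemma voice_inner: "(\<integral>x. V v x * cnj (V z x) \<partial>M) = ip v z"
proof -
  have re: "Re (\<integral>x. V v x * cnj (V z x) \<partial>M) = Re (ip v z)" for v
  proof -
    have "(norm (V (v + z) x))\<^sup>2 = (norm (V v x))\<^sup>2 + (norm (V z x))\<^sup>2 + 2 * Re (V v x * cnj (V z x))" for x
      unfolding voice_add cmod_power2 by (simp add: power2_eq_square algebra_simps)
    then have "Re (ip (v + z) (v + z)) = (\<integral>x. (norm (V v x))\<^sup>2 + (norm (V z x))\<^sup>2 + 2 * Re (V v x * cnj (V z x)) \<partial>M)"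
      unfolding voice_square(2)[symmetric] by simp
    also have "\<dots> = Re (ip v v) + Re (ip z z) + 2 * Re (\<integral>x. V v x * cnj (V z x) \<partial>M)"
      using voice_square(1) voice_inner_integrable[of v z]
      by (simp add: voice_square(2) integrable_Re integral_Re del: times_complex.sel)
    finally show ?thesis using ip_cnj[of v z] by (simp add: ip_add_left ip_add_right complex_eq_iff)
  qed
  have "Re (\<integral>x. \<i> * (V v x * cnj (V z x)) \<partial>M) = Re (ip (sc \<i> v) z)"
    using re[of "sc \<i> v"] by (simp add: voice_sc mult.assoc)
  then have "Im (\<integral>x. V v x * cnj (V z x) \<partial>M) = Im (ip v z)"
    by (simp add: ip_sc_left)
  then show ?thesis using re by (simp add: complex_eq_iff)
qed

text \<open>The preservation of inner products for the pair \<open>v\<close>,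
  \<open>\<pi> x u\<close>: the voice transform of the second vector, conjugated, is
  \<open>K (- y + x)\<close>.\<close>

lemma voice_reproducing: "integrable M (\<lambda>y. V v y * K (- y + x))" "(\<integral>y. V v y * K (- y + x) \<partial>M) = V v x"
proof -
  have *: "cnj (V (\<pi> x u) y) = K (- y + x)" for y
    using K_minus[of "- x + y"] by (simp add: voice_def ip_rep_rep minus_add)
  show "integrable M (\<lambda>y. V v y * K (- y + x))"
    using voice_inner_integrable[of v "\<pi> x u"] by (simp add: *)
  show "(\<integral>y. V v y * K (- y + x) \<partial>M) = V v x"
    using voice_inner[of v "\<pi> x u"] unfolding * by (simp only: voice_def[of ip \<pi> u v x])
qed

text \<open>\<open>|K|\<close> is invariant under inversion, so the modular function does not enter.\<close>
lemma Young_kernel: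
  fixes h :: "'g \<Rightarrow> real"
  assumes h[measurable]: "h \<in> borel_measurable M" and h0: "\<And>x. 0 \<le> h x" and c: "1 < c"
    and a: "a = 2 * c / (1 + c)"
    and int: "(\<integral>\<^sup>+y. ennreal ((w y * h y) powr a) \<partial>M) \<le> ennreal (A powr a)" "0 \<le> A"
    and g[measurable]: "g \<in> borel_measurable M"
    and le: "\<And>z. ennreal (norm (g z)) \<le> (\<integral>\<^sup>+y. ennreal (h y * norm (K (- y + z))) \<partial>M)"
  shows "in_Lpw M c w g" "Lpw_norm M c w g \<le> A * Lpw_norm M a w K"
proof -
  \<comment> \<open>The exponent solves 2/a = 1 + 1/c, Young's relation with two equal exponents. It
    exceeds 1, so \<open>K\<close> belongs to the corresponding space.\<close>
  have a1: "1 < a" unfolding a using c by (simp add: field_simps)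
  have e: "1 / a + 1 / a = 1 + 1 / c" unfolding a using c by (simp add: field_simps)
  define G where "G y = w y * norm (K y)" for y
  have [measurable]: "G \<in> borel_measurable M" unfolding G_def by measurable
  have G: "(\<integral>\<^sup>+y. ennreal (G y powr a) \<partial>M) = ennreal (Lpw_norm M a w K powr a)"
    unfolding G_def by (rule nn_integral_Lpw_norm[OF K_in_Lpw[OF a1]]) (use a1 w_nonneg in auto)
  have G0: "0 \<le> G y" for y by (simp add: G_def w_nonneg)
  have Gm: "G (- y) = G y" for y by (simp add: G_def w_minus norm_K_minus)
  have "(\<integral>\<^sup>+z. ennreal ((w z * norm (g z)) powr c) \<partial>M) \<le> ennreal ((A * Lpw_norm M a w K) powr c)"
  proof (rule Young_convolution[where F="\<lambda>y. w y * h y" and G=G and p=a and q=a])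
    fix z
    have "ennreal (w z * norm (g z)) \<le> ennreal (w z) * (\<integral>\<^sup>+y. ennreal (h y * norm (K (- y + z))) \<partial>M)"
      using le[of z] by (simp add: ennreal_mult w_nonneg mult_left_mono)
    also have "\<dots> = (\<integral>\<^sup>+y. ennreal (w z * (h y * norm (K (- y + z)))) \<partial>M)"
      by (simp add: nn_integral_cmult[symmetric] ennreal_mult w_nonneg h0)
    also have "\<dots> \<le> (\<integral>\<^sup>+y. ennreal (w y * h y * G (- y + z)) \<partial>M)"
    proof (intro nn_integral_mono ennreal_leI)
      fix y
      have "w z \<le> w y * w (- y + z)" using w_plus[of y "- y + z"] by (simp add: add.assoc[symmetric])
      then have "w z * (h y * norm (K (- y + z))) \<le> w y * w (- y + z) * (h y * norm (K (- y + z)))"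
        by (intro mult_right_mono) (auto simp: h0)
      then show "w z * (h y * norm (K (- y + z))) \<le> w y * h y * G (- y + z)" by (simp add: G_def mult_ac)
    qed
    finally show "ennreal (w z * norm (g z)) \<le> (\<integral>\<^sup>+y. ennreal (w y * h y * G (- y + z)) \<partial>M)" .
  qed (use int a1 e c G h0 w_nonneg in \<open>auto simp: Gm G0 Lpw_norm_nonneg intro: mult_nonneg_nonneg\<close>)
  then show "in_Lpw M c w g" "Lpw_norm M c w g \<le> A * Lpw_norm M a w K"
    using in_Lpw_bound[of g M w c "A * Lpw_norm M a w K"] Lpw_norm_bound[of g M w c "A * Lpw_norm M a w K"] c int(2) w_nonneg
    by (auto simp: Lpw_norm_nonneg)
qed

end

section \<open>The reproducing formula for distributions\<close>

text \<open>Minkowski's integral inequality for slices that are uniformly bounded over a set of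
  finite measure: Hoelder on \<open>B\<close> gives \<open>H^p <= b^(p-1)\<close> times the integral
  of \<open>D^p\<close>, and Fubini does the rest.\<close>

lemma (in haar_group) nn_integral_Minkowski_kernel:
  fixes D :: "'g \<Rightarrow> 'g \<Rightarrow> real"
  assumes [measurable]: "case_prod D \<in> borel_measurable (M \<Otimes>\<^sub>M M)" "B \<in> sets M"
    and D0: "\<And>y z. 0 \<le> D y z" and p: "1 \<le> p" and b: "emeasure M B \<le> ennreal b" "0 < b" and d: "0 \<le> d"
    and bound: "\<And>y. y \<in> B \<Longrightarrow> (\<integral>\<^sup>+z. ennreal (D y z powr p) \<partial>M) \<le> ennreal (d powr p)"
    and H: "\<And>z. 0 \<le> H z" "\<And>z. ennreal (H z) \<le> (\<integral>\<^sup>+y. ennreal (indicator B y * D y z) \<partial>M)"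
  shows "(\<integral>\<^sup>+z. ennreal (H z powr p) \<partial>M) \<le> ennreal ((b * d) powr p)"
proof -
  have [measurable]: "B \<in> sets borel" using assms(2) by (simp add: sets_M)
  define J where "J z = (\<integral>\<^sup>+y. ennreal (indicator B y * D y z powr p) \<partial>M)" for z
  have [measurable]: "J \<in> borel_measurable M" unfolding J_def by measurable
  have "(\<integral>\<^sup>+z. J z \<partial>M) = (\<integral>\<^sup>+y. (\<integral>\<^sup>+z. ennreal (indicator B y * D y z powr p) \<partial>M) \<partial>M)"
    unfolding J_def by (rule prod.Fubini') measurable
  also have "\<dots> \<le> (\<integral>\<^sup>+y. ennreal (d powr p) * indicator B y \<partial>M)"
    by (rule nn_integral_mono) (use bound in \<open>auto simp: indicator_def\<close>)
  also have "\<dots> \<le> ennreal (d powr p) * ennreal b"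
    using b by (simp add: nn_integral_cmult_indicator mult_left_mono)
  finally have intJ: "(\<integral>\<^sup>+z. J z \<partial>M) \<le> ennreal (d powr p * b)"
    using b by (simp add: ennreal_mult)
  then have "(\<integral>\<^sup>+z. J z \<partial>M) \<noteq> \<infinity>" by (auto simp: top_unique)
  then have AEJ: "AE z in M. J z \<noteq> \<infinity>" by (intro nn_integral_PInf_AE) auto
  have "AE z in M. ennreal (H z powr p) \<le> ennreal (b powr (p - 1)) * J z"
    using AEJ
  proof eventually_elim
    case (elim z)
    have gB: "(\<integral>\<^sup>+y. ennreal (indicator B y) \<partial>M) \<le> ennreal b"
      using b by (simp add: ennreal_indicator)
    have "ennreal (H z) \<le> (\<integral>\<^sup>+y. ennreal (indicator B y * D y z) \<partial>M)" by (rule H)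
    also have "\<dots> = (\<integral>\<^sup>+y. ennreal ((indicator B y * D y z powr p) powr (1 / p) * indicator B y powr (1 - 1 / p) * indicator B y powr 0) \<partial>M)"
      using D0 p by (intro nn_integral_cong) (auto simp: indicator_def powr_powr)
    also have "\<dots> \<le> ennreal (enn2real (J z) powr (1 / p) * b powr (1 - 1 / p) * b powr 0)"
    proof (rule nn_integral_Holder3_nonneg)
      show "(\<integral>\<^sup>+y. ennreal (indicator B y * D y z powr p) \<partial>M) \<le> ennreal (enn2real (J z))"
        using elim by (simp add: J_def less_top)
    qed (use b gB p in auto)
    finally have "H z \<le> enn2real (J z) powr (1 / p) * b powr (1 - 1 / p)"
      using b by (subst (asm) ennreal_le_iff) auto
    then have "H z powr p \<le> (enn2real (J z) powr (1 / p) * b powr (1 - 1 / p)) powr p"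
      using H(1) p by (intro powr_mono2) auto
    also have "\<dots> = b powr (p - 1) * enn2real (J z)"
      using b p by (simp add: powr_mult powr_powr algebra_simps)
    finally have "ennreal (H z powr p) \<le> ennreal (b powr (p - 1) * enn2real (J z))" by (rule ennreal_leI)
    then show ?case using elim by (simp add: ennreal_mult less_top)
  qed
  then have "(\<integral>\<^sup>+z. ennreal (H z powr p) \<partial>M) \<le> (\<integral>\<^sup>+z. ennreal (b powr (p - 1)) * J z \<partial>M)"
    by (rule nn_integral_mono_AE)
  also have "\<dots> = ennreal (b powr (p - 1)) * (\<integral>\<^sup>+z. J z \<partial>M)" by (rule nn_integral_cmult) measurable
  also have "\<dots> \<le> ennreal (b powr (p - 1)) * ennreal (d powr p * b)" by (intro mult_left_mono intJ) auto
  also have "\<dots> = ennreal ((b powr (p - 1) * b powr 1) * d powr p)" using b by (simp add: ennreal_mult[symmetric] mult_ac)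
  also have "(b powr (p - 1) * b powr 1) * d powr p = (b * d) powr p"
    unfolding powr_add[symmetric] using b d by (simp add: powr_mult)
  finally show ?thesis .
qed

text \<open>For a tag function \<sigma> with finite range, the Riemann sum over its level sets is an
  integral with \<open>\<sigma> y\<close> inserted in the second factor. Errors of Riemann sums
  thereby become integrals.\<close>

lemma (in haar_group) integral_finite_range:
  fixes h :: "'g \<Rightarrow> complex" and G :: "'g \<Rightarrow> complex"
  assumes [measurable]: "B \<in> sets M" "h \<in> borel_measurable M" "\<sigma> \<in> measurable M borel"
    and B: "emeasure M B < \<infinity>" and h: "\<And>y. norm (h y) \<le> N"
    and D: "finite D" "range \<sigma> \<subseteq> D"
  shows "integrable M (\<lambda>y. indicator B y *\<^sub>R (h y * G (\<sigma> y)))"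
    and "(\<integral>y. indicator B y *\<^sub>R (h y * G (\<sigma> y)) \<partial>M) = (\<Sum>d\<in>D. (\<integral>y. indicator (B \<inter> \<sigma> -` {d}) y *\<^sub>R h y \<partial>M) * G d)"
proof -
  have [measurable]: "\<sigma> -` {d} \<in> sets M" for d
    using measurable_sets[OF assms(3), of "{d}"] by simp
  have i: "integrable M (\<lambda>y. (indicator (B \<inter> \<sigma> -` {d}) y *\<^sub>R h y) * G d)" for d
  proof (intro integrable_mult_left integrableI_bounded_set_indicator)
    show "emeasure M (B \<inter> \<sigma> -` {d}) < \<infinity>"
      using B emeasure_mono[of "B \<inter> \<sigma> -` {d}" B M] by (auto intro: le_less_trans)
    show "AE y in M. y \<in> B \<inter> \<sigma> -` {d} \<longrightarrow> norm (h y) \<le> N" using h by auto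
  qed measurable
  have eq: "indicator B y *\<^sub>R (h y * G (\<sigma> y)) = (\<Sum>d\<in>D. (indicator (B \<inter> \<sigma> -` {d}) y *\<^sub>R h y) * G d)" for y
  proof -
    have "(\<Sum>d\<in>D. (indicator (B \<inter> \<sigma> -` {d}) y *\<^sub>R h y) * G d) = (\<Sum>d\<in>D. if d = \<sigma> y then (indicator B y *\<^sub>R h y) * G d else 0)"
      by (intro sum.cong) (auto simp: indicator_def)
    also have "\<dots> = (indicator B y *\<^sub>R h y) * G (\<sigma> y)" using D by (subst sum.delta) auto
    finally show ?thesis by simp
  qed
  show "integrable M (\<lambda>y. indicator B y *\<^sub>R (h y * G (\<sigma> y)))"
    unfolding eq by (intro Bochner_Integration.integrable_sum i)
  show "(\<integral>y. indicator B y *\<^sub>R (h y * G (\<sigma> y)) \<partial>M) = (\<Sum>d\<in>D. (\<integral>y. indicator (B \<inter> \<sigma> -` {d}) y *\<^sub>R h y \<partial>M) * G d)"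
    unfolding eq Bochner_Integration.integral_sum[OF i] by (simp only: integral_mult_left_zero)
qed

section \<open>Distributions and their reproducing formula\<close>

context voice_transform
begin

lemma voice_lincomb: "V (\<Sum>d\<in>D. sc (c d) (\<pi> d u)) = (\<lambda>z. \<Sum>d\<in>D. c d * ltrans d K z)"
  by (rule ext) (simp add: voice_def ip_sum_left ip_sc_left ltrans_def ip_rep_rep)

lemma ltrans_K_in_Lpw: "moderate w v \<Longrightarrow> 1 < s \<Longrightarrow> in_Lpw M s v (ltrans x K)"
  using in_Lpw_ltrans[OF w _ K_in_Lpw] by simp

lemma lincomb_in_Lpw:
  assumes "moderate w v" "1 < s"
  shows "in_Lpw M s v (\<lambda>z. \<Sum>d\<in>D. c d * ltrans d K z)"
  using assms by (intro in_Lpw_sum in_Lpw_cmult ltrans_K_in_Lpw) (auto simp: moderate_def less_imp_le)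

lemma lincomb_in_Sw: "(\<Sum>d\<in>D. sc (c d) (\<pi> d u)) \<in> Sw M w ip \<pi> u"
  by (simp add: Sw_def voice_lincomb lincomb_in_Lpw[OF weight_imp_moderate[OF w]])

lemma rep_in_Sw: "\<pi> x u \<in> Sw M w ip \<pi> u"
  by (simp add: Sw_def voice_rep ltrans_K_in_Lpw[OF weight_imp_moderate[OF w]])

text \<open>A distribution is anti-linear on \<open>Sw\<close> only, so the induction has to keep
  every partial sum inside \<open>Sw\<close>.\<close>

lemma Sw_dual_lincomb:
  assumes "T \<in> Sw_dual M w sc ip \<pi> u"
  shows "T (\<Sum>d\<in>D. sc (c d) (\<pi> d u)) = (\<Sum>d\<in>D. cnj (c d) * T (\<pi> d u))"
proof -
  have lin: "T (sc a v + sc b v') = cnj a * T v + cnj b * T v'"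
    if "v \<in> Sw M w ip \<pi> u" "v' \<in> Sw M w ip \<pi> u" for a b v v'
    using assms that by (simp add: Sw_dual_def)
  have z: "T 0 = 0" using lin[of "\<pi> 0 u" "\<pi> 0 u" 0 0] by (simp add: rep_in_Sw sc_zero)
  show ?thesis
  proof (induction D rule: infinite_finite_induct)
    case (insert d D)
    show ?case
      using lin[OF rep_in_Sw[of d] lincomb_in_Sw[where c=c and D=D], of "c d" 1] insert
      by (simp add: sc_one)
  qed (simp_all add: z)
qed

text \<open>A Riemann sum approximating \<open>\<integral>\<^sub>B h(y) \<pi>(y)u dy\<close>, \<open>h = \<lambda>(x)K\<close>, in every seminorm; the whole
  integral is \<open>\<pi>(x)u\<close>, and the part outside \<open>B\<close> is estimated by Young's inequality.\<close>
lemma Riemann_sum_approx: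
  assumes T: "T \<in> Sw_dual M w sc ip \<pi> u"
    and P: "finite P" "P \<subseteq> {1<..}" and C: "0 \<le> C"
    and bound: "\<And>v. v \<in> Sw M w ip \<pi> u \<Longrightarrow> norm (T v) \<le> C * (\<Sum>p\<in>P. Lpw_norm M p w (V v))"
    and B: "compact B" and meas: "ext_voice \<pi> u T \<in> borel_measurable M"
    and int: "integrable M (\<lambda>y. ext_voice \<pi> u T y * K (- y + x))"
  defines "\<tau> \<equiv> \<lambda>p. Lpw_norm M (2 * p / (1 + p)) w (\<lambda>y. indicator (- B) y *\<^sub>R ltrans x K y)"
  shows "norm (ext_voice \<pi> u T x - (\<integral>y. indicator B y *\<^sub>R (ext_voice \<pi> u T y * K (- y + x)) \<partial>M))
    \<le> C * (\<Sum>p\<in>P. \<tau> p * Lpw_norm M (2 * p / (1 + p)) w K)" (is "?lhs \<le> ?rhs")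
proof -
  define f where "f = ext_voice \<pi> u T"
  define h where "h = ltrans x K"
  define N where "N = (hnorm ip u)\<^sup>2"
  \<comment> \<open>The summand 1 keeps \<open>b\<close> positive when \<open>B\<close> is a null
    set, as the Minkowski inequality for kernels requires.\<close>
  define b where "b = measure M B + 1"
  have [measurable]: "B \<in> sets M" "B \<in> sets borel" using compact_sets[OF B] by (auto simp: sets_M)
  have [measurable]: "f \<in> borel_measurable M" using meas by (simp add: f_def)
  have [measurable]: "h \<in> borel_measurable M" unfolding h_def ltrans_def by measurable
  have Bfin: "emeasure M B < \<infinity>" by (rule emeasure_compact[OF B])
  have b: "emeasure M B \<le> ennreal b" "0 < b"
    using Bfin by (auto simp: b_def emeasure_eq_ennreal_measure ennreal_leI add_nonneg_pos)
  have hN: "norm (h y) \<le> N" for y by (simp add: h_def ltrans_def N_def norm_K_le)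
  have N0: "0 \<le> N" by (simp add: N_def)
  have cnjh: "cnj (h y) = K (- y + x)" for y
    using K_minus[of "- x + y"] by (simp add: h_def ltrans_def minus_add)
  have wm: "moderate w w" by (rule weight_imp_moderate[OF w])
  \<comment> \<open>Continuity of \<open>T\<close> on the difference of \<open>\<pi> d u\<close> and
    \<open>\<pi> y u\<close>, whose voice transform is the difference of two translates of
    \<open>K\<close>.\<close>
  have fdiff: "norm (f d - f y) \<le> C * (\<Sum>p\<in>P. Lpw_norm M p w (\<lambda>z. ltrans d K z - ltrans y K z))" for d y
  proof -
    define v where "v = sc 1 (\<pi> d u) + sc (-1) (\<pi> y u)"
    have Vv: "V v = (\<lambda>z. ltrans d K z - ltrans y K z)"
      by (rule ext) (simp add: v_def voice_add voice_sc voice_rep)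
    have vS: "v \<in> Sw M w ip \<pi> u"
      by (simp add: Sw_def Vv in_Lpw_diff ltrans_K_in_Lpw wm w_nonneg)
    have "T v = f d - f y"
      using T rep_in_Sw unfolding v_def Sw_dual_def f_def ext_voice_def by simp
    then show ?thesis using bound[OF vS] by (simp add: Vv)
  qed
  \<comment> \<open>The first constant before \<delta> comes from the voice transform of the Riemann
    sum, the second from comparing \<open>T s\<close> with the integral of \<open>f\<close> over
    \<open>B\<close>.\<close>
  have main: "?lhs \<le> ?rhs + (C * (\<Sum>p\<in>P. N * b) + N * b * C * card P) * \<delta>" if \<delta>: "\<delta> > 0" for \<delta>
  proof -
    have "\<exists>U. open U \<and> y \<in> U \<and> (\<forall>y'\<in>U. \<forall>p\<in>P. Lpw_norm M p w (\<lambda>z. ltrans y K z - ltrans y' K z) < \<delta>)" for y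
    proof -
      have "\<forall>p\<in>P. \<exists>U. open U \<and> y \<in> U \<and> (\<forall>y'\<in>U. Lpw_norm M p w (\<lambda>z. ltrans y' K z - ltrans y K z) < \<delta>)"
        using P by (intro ballI Lpw_ltrans_nhds[OF w wm K_in_Lpw _ K_continuous \<delta>]) auto
      then obtain U where U: "\<And>p. p \<in> P \<Longrightarrow> open (U p) \<and> y \<in> U p \<and> (\<forall>y'\<in>U p. Lpw_norm M p w (\<lambda>z. ltrans y' K z - ltrans y K z) < \<delta>)"
        by metis
      show ?thesis using P(1) U
        by (intro exI[of _ "\<Inter>p\<in>P. U p"]) (auto simp: Lpw_norm_minus_commute[of M _ w "ltrans y K"])
    qed
    then obtain U where U: "\<And>y. open (U y)" "\<And>y. y \<in> U y"
      "\<And>y y' p. y' \<in> U y \<Longrightarrow> p \<in> P \<Longrightarrow> Lpw_norm M p w (\<lambda>z. ltrans y K z - ltrans y' K z) < \<delta>"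
      by metis
    obtain D0 where D0: "finite D0" "B \<subseteq> (\<Union>y\<in>D0. U y)"
      using compactE_image[OF B, of B U] U(1,2) by (metis UN_I subsetI)
    \<comment> \<open>The extra point makes \<open>D\<close> non-empty, so that
      \<open>from_nat_into\<close> enumerates exactly \<open>D\<close>.\<close>
    define D where "D = insert x D0"
    define e where "e = from_nat_into D"
    have D: "finite D" "countable D" "D \<noteq> {}" using D0 by (auto simp: D_def countable_finite)
    have re: "range e = D" using D by (simp add: e_def)
    \<comment> \<open>The first neighbourhood containing \<open>y\<close> supplies its tag: the
      least index makes \<sigma> measurable. Outside the cover the tag is arbitrary, but still in
      \<open>D\<close>.\<close>
    define \<sigma> where "\<sigma> y = e (LEAST i. y \<in> U (e i))" for y
    have [measurable]: "U y \<in> sets M" for y using U(1) by (auto simp: sets_M)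
    have \<sigma>[measurable]: "\<sigma> \<in> measurable M borel" unfolding \<sigma>_def by measurable
    have ran: "range \<sigma> \<subseteq> D" using re by (auto simp: \<sigma>_def)
    have near: "Lpw_norm M p w (\<lambda>z. ltrans (\<sigma> y) K z - ltrans y K z) < \<delta>" if "y \<in> B" "p \<in> P" for y p
    proof -
      have "\<exists>i. y \<in> U (e i)" using D0 that re unfolding D_def by (metis UN_E insertCI rangeE subsetD)
      then have "y \<in> U (\<sigma> y)" unfolding \<sigma>_def by (rule LeastI_ex)
      then show ?thesis using U(3) that by blast
    qed
    \<comment> \<open>\<open>s\<close> is the Riemann sum for the integral over \<open>B\<close> of
      \<open>h y\<close> times \<open>\<pi> y u\<close>, with the mass of each level set of \<sigma>
      placed at its tag.\<close>
    define c where "c d = (\<integral>y. indicator (B \<inter> \<sigma> -` {d}) y *\<^sub>R h y \<partial>M)" for d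
    define s where "s = (\<Sum>d\<in>D. sc (c d) (\<pi> d u))"
    have Vs: "V s z = (\<integral>y. indicator B y *\<^sub>R (h y * K (- \<sigma> y + z)) \<partial>M)"
      and Vsi: "integrable M (\<lambda>y. indicator B y *\<^sub>R (h y * K (- \<sigma> y + z)))" for z
      using integral_finite_range[OF _ _ \<sigma> Bfin hN D(1) ran, where G="\<lambda>d. K (- d + z)"]
      unfolding s_def voice_lincomb ltrans_def c_def by auto
    have Ts: "T s = cnj (\<integral>y. indicator B y *\<^sub>R (h y * cnj (f (\<sigma> y))) \<partial>M)"
      and Tsi: "integrable M (\<lambda>y. indicator B y *\<^sub>R (h y * cnj (f (\<sigma> y))))"
      using integral_finite_range[OF _ _ \<sigma> Bfin hN D(1) ran, where G="\<lambda>d. cnj (f d)"]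
      unfolding s_def Sw_dual_lincomb[OF T] c_def by (auto simp: f_def ext_voice_def)
    have hrep: "integrable M (\<lambda>y. h y * K (- y + z))" "(\<integral>y. h y * K (- y + z) \<partial>M) = h z" for z
      using voice_reproducing[of "\<pi> x u" z] unfolding voice_rep h_def by auto
    have nrm: "Lpw_norm M p w (\<lambda>z. V s z - h z) \<le> N * b * \<delta> + \<tau> p * Lpw_norm M (2 * p / (1 + p)) w K" if p: "p \<in> P" for p
    proof -
      have p1: "1 < p" using P p by auto
      \<comment> \<open>\<open>A1\<close> is the error made inside \<open>B\<close> by moving
        \<open>y\<close> to its tag, \<open>A2\<close> the part of the reproducing integral outside
        \<open>B\<close>.\<close>
      define A1 where "A1 z = (\<integral>y. indicator B y *\<^sub>R (h y * (K (- \<sigma> y + z) - K (- y + z))) \<partial>M)" for z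
      define A2 where "A2 z = (\<integral>y. indicator (- B) y *\<^sub>R (h y * K (- y + z)) \<partial>M)" for z
      have i1: "integrable M (\<lambda>y. indicator B y *\<^sub>R (h y * K (- y + z)))" for z
        by (intro integrable_mult_indicator hrep) simp
      have i2: "integrable M (\<lambda>y. indicator (- B) y *\<^sub>R (h y * K (- y + z)))" for z
        by (intro integrable_mult_indicator hrep) (simp add: sets_M)
      have i3: "integrable M (\<lambda>y. indicator B y *\<^sub>R (h y * (K (- \<sigma> y + z) - K (- y + z))))" for z
        using Bochner_Integration.integrable_diff[OF Vsi[of z] i1[of z]] by (simp add: scaleR_diff_right right_diff_distrib)
      have split: "V s z - h z = A1 z - A2 z" for z
      proof -
        have "h z = (\<integral>y. h y * K (- y + z) \<partial>M)" by (rule hrep(2)[symmetric])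
        also have "\<dots> = (\<integral>y. indicator B y *\<^sub>R (h y * K (- y + z)) + indicator (- B) y *\<^sub>R (h y * K (- y + z)) \<partial>M)"
          by (intro Bochner_Integration.integral_cong) (auto simp: indicator_def)
        also have "\<dots> = (\<integral>y. indicator B y *\<^sub>R (h y * K (- y + z)) \<partial>M) + A2 z"
          unfolding A2_def by (rule Bochner_Integration.integral_add[OF i1 i2])
        finally have "h z = (\<integral>y. indicator B y *\<^sub>R (h y * K (- y + z)) \<partial>M) + A2 z" .
        moreover have "A1 z = V s z - (\<integral>y. indicator B y *\<^sub>R (h y * K (- y + z)) \<partial>M)"
          unfolding A1_def Vs Bochner_Integration.integral_diff[OF Vsi i1, symmetric]
          by (simp add: scaleR_diff_right right_diff_distrib)
        ultimately show ?thesis by simp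
      qed
      have m1[measurable]: "A1 \<in> borel_measurable M" unfolding A1_def by measurable
      have m2[measurable]: "A2 \<in> borel_measurable M" unfolding A2_def by measurable
      have "(\<integral>\<^sup>+z. ennreal ((w z * norm (A1 z)) powr p) \<partial>M) \<le> ennreal ((b * (N * \<delta>)) powr p)"
      proof (rule nn_integral_Minkowski_kernel[where B=B and D="\<lambda>y z. N * (w z * norm (K (- \<sigma> y + z) - K (- y + z)))"])
        fix y assume y: "y \<in> B"
        have i: "in_Lpw M p w (\<lambda>z. ltrans (\<sigma> y) K z - ltrans y K z)"
          using p1 by (intro in_Lpw_diff ltrans_K_in_Lpw wm w_nonneg) auto
        have "(\<integral>\<^sup>+z. ennreal ((N * (w z * norm (K (- \<sigma> y + z) - K (- y + z)))) powr p) \<partial>M)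
          = (\<integral>\<^sup>+z. ennreal (N powr p) * ennreal ((w z * norm (ltrans (\<sigma> y) K z - ltrans y K z)) powr p) \<partial>M)"
          by (intro nn_integral_cong) (simp add: ltrans_def powr_mult ennreal_mult)
        also have "\<dots> = ennreal (N powr p) * (\<integral>\<^sup>+z. ennreal ((w z * norm (ltrans (\<sigma> y) K z - ltrans y K z)) powr p) \<partial>M)"
          by (intro nn_integral_cmult) (unfold ltrans_def, measurable)
        also have "\<dots> = ennreal (N powr p) * ennreal (Lpw_norm M p w (\<lambda>z. ltrans (\<sigma> y) K z - ltrans y K z) powr p)"
          using p1 by (subst nn_integral_Lpw_norm[OF i]) (auto simp: w_nonneg)
        also have "\<dots> \<le> ennreal (N powr p) * ennreal (\<delta> powr p)"
          using near[OF y p] p1 by (intro mult_left_mono ennreal_leI powr_mono2) (auto simp: Lpw_norm_nonneg)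
        finally show "(\<integral>\<^sup>+z. ennreal ((N * (w z * norm (K (- \<sigma> y + z) - K (- y + z)))) powr p) \<partial>M) \<le> ennreal ((N * \<delta>) powr p)"
          by (simp add: powr_mult ennreal_mult)
      next
        fix z
        have "ennreal (w z * norm (A1 z)) = ennreal (w z) * ennreal (norm (A1 z))" by (simp add: ennreal_mult w_nonneg)
        also have "\<dots> \<le> ennreal (w z) * (\<integral>\<^sup>+y. norm (indicator B y *\<^sub>R (h y * (K (- \<sigma> y + z) - K (- y + z)))) \<partial>M)"
          unfolding A1_def by (intro mult_left_mono integral_norm_bound_ennreal[OF i3]) auto
        also have "\<dots> = (\<integral>\<^sup>+y. ennreal (w z) * norm (indicator B y *\<^sub>R (h y * (K (- \<sigma> y + z) - K (- y + z)))) \<partial>M)"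
          by (rule nn_integral_cmult[symmetric]) measurable
        also have "\<dots> \<le> (\<integral>\<^sup>+y. ennreal (indicator B y * (N * (w z * norm (K (- \<sigma> y + z) - K (- y + z))))) \<partial>M)"
        proof (intro nn_integral_mono)
          fix y
          have "w z * (norm (h y) * norm (K (- \<sigma> y + z) - K (- y + z))) \<le> w z * (N * norm (K (- \<sigma> y + z) - K (- y + z)))"
            using hN w_nonneg by (intro mult_left_mono mult_right_mono) auto
          then show "ennreal (w z) * norm (indicator B y *\<^sub>R (h y * (K (- \<sigma> y + z) - K (- y + z)))) \<le> ennreal (indicator B y * (N * (w z * norm (K (- \<sigma> y + z) - K (- y + z)))))"
            by (auto simp: indicator_def norm_mult ennreal_mult[symmetric] w_nonneg mult_ac intro!: ennreal_leI)
        qed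
        finally show "ennreal (w z * norm (A1 z)) \<le> (\<integral>\<^sup>+y. ennreal (indicator B y * (N * (w z * norm (K (- \<sigma> y + z) - K (- y + z))))) \<partial>M)" .
      qed (use N0 \<delta> b p1 w_nonneg in auto)
      then have A1: "in_Lpw M p w A1" "Lpw_norm M p w A1 \<le> b * (N * \<delta>)"
        using in_Lpw_bound[of A1 M w p "b * (N * \<delta>)"] Lpw_norm_bound[of A1 M w p "b * (N * \<delta>)"] p1 b N0 \<delta> w_nonneg by auto
      define a where "a = 2 * p / (1 + p)"
      have a1: "1 < a" unfolding a_def using p1 by (simp add: field_simps)
      have hl: "in_Lpw M a w (\<lambda>y. indicator (- B) y *\<^sub>R h y)"
      proof (rule in_Lpw_mono)
        show "in_Lpw M a w h" unfolding h_def by (rule ltrans_K_in_Lpw[OF wm a1])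
        show "norm (indicator (- B) y *\<^sub>R h y) \<le> norm (h y)" for y by (auto simp: indicator_def)
      qed (use a1 w_nonneg in auto)
      have "in_Lpw M p w A2 \<and> Lpw_norm M p w A2 \<le> Lpw_norm M a w (\<lambda>y. indicator (- B) y *\<^sub>R h y) * Lpw_norm M a w K"
      proof (intro conjI Young_kernel[where h="\<lambda>y. norm (indicator (- B) y *\<^sub>R h y)"])
        show "(\<integral>\<^sup>+y. ennreal ((w y * norm (indicator (- B) y *\<^sub>R h y)) powr a) \<partial>M) \<le> ennreal (Lpw_norm M a w (\<lambda>y. indicator (- B) y *\<^sub>R h y) powr a)"
          using a1 by (subst nn_integral_Lpw_norm[OF hl]) (auto simp: w_nonneg)
        then show "(\<integral>\<^sup>+y. ennreal ((w y * norm (indicator (- B) y *\<^sub>R h y)) powr a) \<partial>M) \<le> ennreal (Lpw_norm M a w (\<lambda>y. indicator (- B) y *\<^sub>R h y) powr a)" .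
        show "ennreal (norm (A2 z)) \<le> (\<integral>\<^sup>+y. ennreal (norm (indicator (- B) y *\<^sub>R h y) * norm (K (- y + z))) \<partial>M)" for z
          using integral_norm_bound_ennreal[OF i2[of z]] unfolding A2_def by (simp add: norm_mult mult.assoc)
        then show "ennreal (norm (A2 z)) \<le> (\<integral>\<^sup>+y. ennreal (norm (indicator (- B) y *\<^sub>R h y) * norm (K (- y + z))) \<partial>M)" for z .
      qed (use p1 in \<open>auto simp: a_def Lpw_norm_nonneg\<close>)
      then have A2: "in_Lpw M p w A2" "Lpw_norm M p w A2 \<le> \<tau> p * Lpw_norm M (2 * p / (1 + p)) w K"
        by (auto simp: \<tau>_def a_def h_def)
      have "Lpw_norm M p w (\<lambda>z. A1 z - A2 z) \<le> Lpw_norm M p w A1 + Lpw_norm M p w A2"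
        using p1 by (intro Lpw_norm_diff_triangle A1 A2 w_nonneg) auto
      then show ?thesis using A1 A2 by (simp add: split mult_ac)
    qed
    have e1: "norm (f x - T s) \<le> C * (\<Sum>p\<in>P. N * b * \<delta> + \<tau> p * Lpw_norm M (2 * p / (1 + p)) w K)"
    proof -
      define v where "v = sc 1 (\<pi> x u) + sc (-1) s"
      have sS: "s \<in> Sw M w ip \<pi> u" unfolding s_def by (rule lincomb_in_Sw)
      have Vv: "V v = (\<lambda>z. h z - V s z)"
        by (rule ext) (simp add: v_def voice_add voice_sc voice_rep h_def)
      have vS: "v \<in> Sw M w ip \<pi> u"
        using sS by (simp add: Sw_def Vv h_def in_Lpw_diff ltrans_K_in_Lpw wm w_nonneg)
      have "T v = f x - T s"
        using T rep_in_Sw sS unfolding v_def Sw_dual_def f_def ext_voice_def by simp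
      then have "norm (f x - T s) \<le> C * (\<Sum>p\<in>P. Lpw_norm M p w (\<lambda>z. h z - V s z))"
        using bound[OF vS] by (simp add: Vv)
      also have "\<dots> \<le> C * (\<Sum>p\<in>P. N * b * \<delta> + \<tau> p * Lpw_norm M (2 * p / (1 + p)) w K)"
        using C nrm by (intro mult_left_mono sum_mono) (auto simp: Lpw_norm_minus_commute[of M _ w h])
      finally show ?thesis .
    qed
    have i4: "integrable M (\<lambda>y. indicator B y *\<^sub>R (f y * cnj (h y)))"
      by (intro integrable_mult_indicator) (use int in \<open>simp_all add: f_def cnjh\<close>)
    have i5: "integrable M (\<lambda>y. indicator B y *\<^sub>R (f (\<sigma> y) * cnj (h y)))"
      using integrable_cnj[OF Tsi] by (simp add: mult.commute)
    have "T s = (\<integral>y. cnj (indicator B y *\<^sub>R (h y * cnj (f (\<sigma> y)))) \<partial>M)"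
      unfolding Ts by (rule Bochner_Integration.integral_cnj[symmetric])
    also have "\<dots> = (\<integral>y. indicator B y *\<^sub>R (f (\<sigma> y) * cnj (h y)) \<partial>M)"
      by (rule Bochner_Integration.integral_cong) (simp_all add: mult.commute)
    finally have "T s - (\<integral>y. indicator B y *\<^sub>R (f y * cnj (h y)) \<partial>M) = (\<integral>y. indicator B y *\<^sub>R (f (\<sigma> y) * cnj (h y)) \<partial>M) - (\<integral>y. indicator B y *\<^sub>R (f y * cnj (h y)) \<partial>M)"
      by simp
    also have "\<dots> = (\<integral>y. indicator B y *\<^sub>R ((f (\<sigma> y) - f y) * cnj (h y)) \<partial>M)"
      unfolding Bochner_Integration.integral_diff[OF i5 i4, symmetric] by (simp add: scaleR_diff_right left_diff_distrib)
    finally have e2eq: "T s - (\<integral>y. indicator B y *\<^sub>R (f y * cnj (h y)) \<partial>M) = (\<integral>y. indicator B y *\<^sub>R ((f (\<sigma> y) - f y) * cnj (h y)) \<partial>M)" .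
    have "norm (\<integral>y. indicator B y *\<^sub>R ((f (\<sigma> y) - f y) * cnj (h y)) \<partial>M) \<le> (\<integral>y. indicator B y * (C * (card P * \<delta>) * N) \<partial>M)"
    proof (rule order_trans[OF Bochner_Integration.integral_norm_bound Bochner_Integration.integral_mono])
      have "integrable M (\<lambda>y. indicator B y *\<^sub>R ((f (\<sigma> y) - f y) * cnj (h y)))"
        using Bochner_Integration.integrable_diff[OF i5 i4] by (simp add: scaleR_diff_right left_diff_distrib)
      then show "integrable M (\<lambda>y. norm (indicator B y *\<^sub>R ((f (\<sigma> y) - f y) * cnj (h y))))"
        by (rule integrable_norm)
      show "integrable M (\<lambda>y. indicator B y * (C * (card P * \<delta>) * N))"
        using Bfin by (intro integrable_mult_left integrable_real_indicator) auto
      fix y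
      have "norm ((f (\<sigma> y) - f y) * cnj (h y)) \<le> (C * (card P * \<delta>)) * N" if "y \<in> B"
        unfolding norm_mult
      proof (rule mult_mono)
        have "norm (f (\<sigma> y) - f y) \<le> C * (\<Sum>p\<in>P. Lpw_norm M p w (\<lambda>z. ltrans (\<sigma> y) K z - ltrans y K z))" by (rule fdiff)
        also have "\<dots> \<le> C * (\<Sum>p\<in>P. \<delta>)" using C near[OF that] by (intro mult_left_mono sum_mono) (auto simp: less_imp_le)
        finally show "norm (f (\<sigma> y) - f y) \<le> C * (card P * \<delta>)" by simp
      qed (use hN C \<delta> in auto)
      then show "norm (indicator B y *\<^sub>R ((f (\<sigma> y) - f y) * cnj (h y))) \<le> indicator B y * (C * (card P * \<delta>) * N)"
        by (auto simp: indicator_def)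
    qed
    also have "\<dots> = measure M B * (C * (card P * \<delta>) * N)" by simp
    also have "\<dots> \<le> b * (C * (card P * \<delta>) * N)"
      using C N0 \<delta> by (intro mult_right_mono) (auto simp: b_def)
    finally have e2: "norm (T s - (\<integral>y. indicator B y *\<^sub>R (f y * cnj (h y)) \<partial>M)) \<le> b * (C * (card P * \<delta>) * N)"
      unfolding e2eq .
    have "norm (f x - (\<integral>y. indicator B y *\<^sub>R (f y * cnj (h y)) \<partial>M)) \<le> norm (f x - T s) + norm (T s - (\<integral>y. indicator B y *\<^sub>R (f y * cnj (h y)) \<partial>M))"
      using norm_triangle_ineq[of "f x - T s" "T s - (\<integral>y. indicator B y *\<^sub>R (f y * cnj (h y)) \<partial>M)"] by simp
    also have "\<dots> \<le> C * (\<Sum>p\<in>P. N * b * \<delta> + \<tau> p * Lpw_norm M (2 * p / (1 + p)) w K) + b * (C * (card P * \<delta>) * N)"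
      by (intro add_mono e1 e2)
    also have "\<dots> = ?rhs + (C * (\<Sum>p\<in>P. N * b) + N * b * C * card P) * \<delta>"
      by (simp add: sum.distrib algebra_simps)
    finally show ?thesis by (simp add: f_def cnjh)
  qed
  define c where "c = C * (\<Sum>p\<in>P. N * b) + N * b * C * card P"
  have "((\<lambda>\<delta>. ?rhs + c * \<delta>) \<longlongrightarrow> ?rhs + c * 0) (at_right 0)" by (intro tendsto_intros)
  moreover have "\<forall>\<^sub>F \<delta> in at_right 0. ?lhs \<le> ?rhs + c * \<delta>"
    using main unfolding c_def by (auto simp: eventually_at_right_field intro!: exI[of _ 1])
  ultimately show ?thesis by (auto intro: tendsto_lowerbound)
qed

text \<open>The translate of \<open>K\<close> lies in the dual space with weight 1/m, so the
  convolution converges absolutely at every point and not merely almost everywhere.\<close>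

lemma Co_pairing:
  assumes m: "moderate w m" and r: "1 < r" and f: "in_Lpw M r m f"
  shows "(\<integral>\<^sup>+y. ennreal (norm (f y) * norm (K (- y + x))) \<partial>M)
      \<le> ennreal (Lpw_norm M r m f * (Lpw_norm M (r / (r - 1)) w K / m x))"
    and "integrable M (\<lambda>y. f y * K (- y + x))"
proof -
  note mi = moderate_inverse[OF w m]
  have r': "1 < r / (r - 1)" "1 / r + 1 / (r / (r - 1)) = 1" using r by (auto simp: field_simps)
  have g: "in_Lpw M (r / (r - 1)) (\<lambda>x. 1 / m x) (ltrans x K)"
    by (rule ltrans_K_in_Lpw[OF mi r'(1)])
  have "(\<integral>\<^sup>+y. ennreal (norm (f y) * norm (ltrans x K y)) \<partial>M)
     \<le> ennreal (Lpw_norm M r m f * Lpw_norm M (r / (r - 1)) (\<lambda>x. 1 / m x) (ltrans x K))"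
    using m r r' by (intro nn_integral_Lpw_pairing f g) (auto simp: moderate_def)
  also have "\<dots> \<le> ennreal (Lpw_norm M r m f * (1 / m x * Lpw_norm M (r / (r - 1)) w K))"
    using Lpw_norm_ltrans[OF w mi K_in_Lpw[OF r'(1)], of x] r'
    by (intro ennreal_leI mult_left_mono) (auto simp: Lpw_norm_nonneg)
  finally show *: "(\<integral>\<^sup>+y. ennreal (norm (f y) * norm (K (- y + x))) \<partial>M)
      \<le> ennreal (Lpw_norm M r m f * (Lpw_norm M (r / (r - 1)) w K / m x))"
    by (simp add: ltrans_def norm_K_flip[of _ x])
  note [measurable] = in_Lpw_measurable(1)[OF f]
  show "integrable M (\<lambda>y. f y * K (- y + x))"
    by (rule integrableI_bounded) (use le_less_trans[OF *] in \<open>auto simp: norm_mult\<close>)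
qed

text \<open>The Riemann sum estimate is applied along a compact exhaustion: the tails \<tau> of
  \<open>ltrans x K\<close> tend to 0 for each of the finitely many exponents, while the truncated
  integrals tend to the convolution.\<close>

lemma Co_reproducing:
  assumes T: "T \<in> Co M w sc ip \<pi> u r m" and m: "moderate w m" and r: "1 < r"
  shows "conv M (ext_voice \<pi> u T) K x = ext_voice \<pi> u T x"
proof -
  define f where "f = ext_voice \<pi> u T"
  define h where "h = ltrans x K"
  have TS: "T \<in> Sw_dual M w sc ip \<pi> u" and f: "in_Lpw M r m f" using T by (auto simp: Co_def f_def)
  have mf[measurable]: "f \<in> borel_measurable M" by (rule in_Lpw_measurable(1)[OF f])
  have [measurable]: "h \<in> borel_measurable M" unfolding h_def ltrans_def by measurable
  have int: "integrable M (\<lambda>y. f y * K (- y + x))" by (rule Co_pairing(2)[OF m r f])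
  obtain P C0 where P: "finite P" "P \<subseteq> {1<..}"
    and C0: "\<And>v. v \<in> Sw M w ip \<pi> u \<Longrightarrow> norm (T v) \<le> C0 * (\<Sum>p\<in>P. Lpw_norm M p w (V v))"
    using TS unfolding Sw_dual_def by blast
  \<comment> \<open>The constant in the continuity condition of \<open>Sw_dual\<close> may be
    negative.\<close>
  define C where "C = max C0 0"
  have C: "0 \<le> C" "norm (T v) \<le> C * (\<Sum>p\<in>P. Lpw_norm M p w (V v))" if "v \<in> Sw M w ip \<pi> u" for v
  proof -
    have "C0 * (\<Sum>p\<in>P. Lpw_norm M p w (V v)) \<le> C * (\<Sum>p\<in>P. Lpw_norm M p w (V v))"
      by (intro mult_right_mono sum_nonneg) (auto simp: C_def Lpw_norm_nonneg)
    then show "norm (T v) \<le> C * (\<Sum>p\<in>P. Lpw_norm M p w (V v))" using C0[OF that] by linarith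
  qed (simp add: C_def)
  obtain B :: "nat \<Rightarrow> 'g set" where B: "\<And>n. compact (B n)" "incseq B" "(\<Union>n. B n) = UNIV"
    using compact_exhaustion by blast
  have BM[measurable]: "B n \<in> sets M" "B n \<in> sets borel" for n using compact_sets[OF B(1)] by (auto simp: sets_M)
  have ev: "eventually (\<lambda>n. y \<in> B n) sequentially" for y
  proof -
    obtain n where "y \<in> B n" using B(3) by blast
    then have "\<forall>k\<ge>n. y \<in> B k" using B(2) unfolding incseq_def by blast
    then show ?thesis by (auto simp: eventually_sequentially)
  qed
  define \<tau> where "\<tau> n p = Lpw_norm M (2 * p / (1 + p)) w (\<lambda>y. indicator (- B n) y *\<^sub>R ltrans x K y)" for n p
  have \<tau>: "(\<lambda>n. \<tau> n p) \<longlonglongrightarrow> 0" if "p \<in> P" for p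
  proof -
    define a where "a = 2 * p / (1 + p)"
    have "1 < p" using that P by auto
    then have a1: "1 < a" unfolding a_def by (simp add: field_simps)
    have hL: "in_Lpw M a w h" unfolding h_def by (rule ltrans_K_in_Lpw[OF weight_imp_moderate[OF w] a1])
    have hl: "in_Lpw M a w (\<lambda>y. indicator (- B n) y *\<^sub>R h y)" for n
      by (rule in_Lpw_mono[OF hL]) (use a1 w_nonneg in \<open>auto simp: indicator_def\<close>)
    have "(\<lambda>n. \<integral>\<^sup>+y. ennreal ((w y * norm (indicator (- B n) y *\<^sub>R h y)) powr a) \<partial>M) \<longlonglongrightarrow> (\<integral>\<^sup>+y. 0 \<partial>M)"
    proof (rule nn_integral_dominated_convergence[where w="\<lambda>y. ennreal ((w y * norm (h y)) powr a)"])
      show "AE y in M. ennreal ((w y * norm (indicator (- B n) y *\<^sub>R h y)) powr a) \<le> ennreal ((w y * norm (h y)) powr a)" for n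
        using a1 by (intro AE_I2 ennreal_leI powr_mono2) (auto simp: indicator_def w_nonneg)
      show "(\<integral>\<^sup>+y. ennreal ((w y * norm (h y)) powr a) \<partial>M) < \<infinity>"
        using a1 by (subst nn_integral_Lpw_norm[OF hL]) (auto simp: w_nonneg)
      show "AE y in M. (\<lambda>n. ennreal ((w y * norm (indicator (- B n) y *\<^sub>R h y)) powr a)) \<longlonglongrightarrow> 0"
      proof (rule AE_I2)
        fix y
        show "(\<lambda>n. ennreal ((w y * norm (indicator (- B n) y *\<^sub>R h y)) powr a)) \<longlonglongrightarrow> 0"
          by (rule tendsto_eventually) (use ev[of y] in \<open>eventually_elim, use a1 in simp\<close>)
      qed
    qed measurable
    then have "(\<lambda>n. ennreal (Lpw_norm M a w (\<lambda>y. indicator (- B n) y *\<^sub>R h y) powr a)) \<longlonglongrightarrow> ennreal 0"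
      using a1 by (subst (asm) nn_integral_Lpw_norm[OF hl]) (auto simp: w_nonneg)
    then have lim: "(\<lambda>n. Lpw_norm M a w (\<lambda>y. indicator (- B n) y *\<^sub>R h y) powr a) \<longlonglongrightarrow> 0"
      by (subst (asm) tendsto_ennreal_iff) auto
    have "(\<lambda>n. (Lpw_norm M a w (\<lambda>y. indicator (- B n) y *\<^sub>R h y) powr a) powr (1 / a)) \<longlonglongrightarrow> 0 powr (1 / a)"
      using a1 by (intro tendsto_powr'[OF lim tendsto_const]) auto
    then have "(\<lambda>n. Lpw_norm M a w (\<lambda>y. indicator (- B n) y *\<^sub>R h y)) \<longlonglongrightarrow> 0"
      using a1 by (simp add: powr_powr Lpw_norm_nonneg)
    then show ?thesis by (simp add: \<tau>_def a_def h_def)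
  qed
  define E where "E n = (\<integral>y. indicator (B n) y *\<^sub>R (f y * K (- y + x)) \<partial>M)" for n
  have "E \<longlonglongrightarrow> (\<integral>y. f y * K (- y + x) \<partial>M)"
    unfolding E_def
  proof (rule integral_dominated_convergence[where w="\<lambda>y. norm (f y * K (- y + x))"])
    show "AE y in M. (\<lambda>n. indicator (B n) y *\<^sub>R (f y * K (- y + x))) \<longlonglongrightarrow> f y * K (- y + x)"
    proof (rule AE_I2)
      fix y
      show "(\<lambda>n. indicator (B n) y *\<^sub>R (f y * K (- y + x))) \<longlonglongrightarrow> f y * K (- y + x)"
        by (rule tendsto_eventually) (use ev[of y] in \<open>eventually_elim, simp\<close>)
    qed
    show "integrable M (\<lambda>y. norm (f y * K (- y + x)))" using int by (rule integrable_norm)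
    show "AE y in M. norm (indicator (B n) y *\<^sub>R (f y * K (- y + x))) \<le> norm (f y * K (- y + x))" for n
      by (auto simp: indicator_def)
  qed measurable
  then have 1: "(\<lambda>n. norm (f x - E n)) \<longlonglongrightarrow> norm (f x - conv M f K x)"
    unfolding conv_def by (intro tendsto_intros)
  have 2: "(\<lambda>n. C * (\<Sum>p\<in>P. \<tau> n p * Lpw_norm M (2 * p / (1 + p)) w K)) \<longlonglongrightarrow> C * (\<Sum>p\<in>P. 0 * Lpw_norm M (2 * p / (1 + p)) w K)"
    by (intro tendsto_intros \<tau>)
  have 3: "norm (f x - E n) \<le> C * (\<Sum>p\<in>P. \<tau> n p * Lpw_norm M (2 * p / (1 + p)) w K)" for n
    using Riemann_sum_approx[OF TS P C(1)[OF rep_in_Sw] C(2) B(1)[of n] mf[unfolded f_def] int[unfolded f_def]]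
    unfolding f_def E_def \<tau>_def by simp
  have "norm (f x - conv M f K x) \<le> C * (\<Sum>p\<in>P. 0 * Lpw_norm M (2 * p / (1 + p)) w K)"
    by (rule LIMSEQ_le[OF 1 2]) (use 3 in auto)
  then show ?thesis by (simp add: f_def)
qed

lemma Co_imp_Mspace:
  assumes "T \<in> Co M w sc ip \<pi> u r m" "moderate w m" "1 < r"
  shows "ext_voice \<pi> u T \<in> Mspace M r m K"
  using assms Co_reproducing[OF assms] by (auto simp: Mspace_def Co_def)

end

section \<open>Dual systems\<close>

text \<open>Independent functionals have biorthogonal vectors. When \<open>x0\<close> is added, some
  \<open>f\<close> keeps a non-zero value under \<open>L x0\<close> after its components along the
  old vectors are subtracted, since otherwise \<open>L x0\<close> would be a combination of the
  others. That remainder is scaled to \<open>e0\<close>, and the old vectors are corrected by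
  multiples of it.\<close>

lemma dual_system:
  fixes W :: "('b \<Rightarrow> complex) set" and L :: "'x \<Rightarrow> ('b \<Rightarrow> complex) \<Rightarrow> complex"
  assumes "finite X" and zero: "(\<lambda>_. 0) \<in> W"
    and add: "\<And>f g. f \<in> W \<Longrightarrow> g \<in> W \<Longrightarrow> (\<lambda>t. f t + g t) \<in> W"
    and cmult: "\<And>f a. f \<in> W \<Longrightarrow> (\<lambda>t. a * f t) \<in> W"
    and Ladd: "\<And>x f g. x \<in> X \<Longrightarrow> f \<in> W \<Longrightarrow> g \<in> W \<Longrightarrow> L x (\<lambda>t. f t + g t) = L x f + L x g"
    and Lcmult: "\<And>x f a. x \<in> X \<Longrightarrow> f \<in> W \<Longrightarrow> L x (\<lambda>t. a * f t) = a * L x f"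
    and indep: "\<And>a. (\<And>f. f \<in> W \<Longrightarrow> (\<Sum>x\<in>X. a x * L x f) = 0) \<Longrightarrow> \<forall>x\<in>X. a x = 0"
  shows "\<exists>e. \<forall>x\<in>X. e x \<in> W \<and> (\<forall>y\<in>X. L y (e x) = (if x = y then 1 else 0))"
  using assms(1) Ladd Lcmult indep
proof (induction X)
  case (insert x0 X)
  have ind: "\<forall>x\<in>X. a x = 0" if a: "\<And>f. f \<in> W \<Longrightarrow> (\<Sum>x\<in>X. a x * L x f) = 0" for a
  proof -
    have "(\<Sum>x\<in>insert x0 X. (a(x0 := 0)) x * L x f) = (\<Sum>x\<in>X. a x * L x f)" for f
      using insert(1,2) by (auto intro!: sum.cong)
    then have "\<forall>x\<in>insert x0 X. (a(x0 := 0)) x = 0" using a insert(6)[of "a(x0 := 0)"] by presburger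
    then show ?thesis using insert(2) by (metis fun_upd_apply insertI2)
  qed
  obtain e where e: "\<And>x. x \<in> X \<Longrightarrow> e x \<in> W" "\<And>x y. x \<in> X \<Longrightarrow> y \<in> X \<Longrightarrow> L y (e x) = (if x = y then 1 else 0)"
    using insert(3)[OF insert(4,5) ind] by auto
  have comb: "(\<lambda>t. \<Sum>x\<in>Z. c x * e x t) \<in> W \<and> (\<forall>y\<in>insert x0 X. L y (\<lambda>t. \<Sum>x\<in>Z. c x * e x t) = (\<Sum>x\<in>Z. c x * L y (e x)))"
    if "Z \<subseteq> X" for Z c
    using finite_subset[OF that insert(1)] that
  proof (induction Z)
    case empty
    have "L y (\<lambda>_. 0) = 0" if "y \<in> insert x0 X" for y
      using insert(5)[OF that zero, of 0] by simp
    then show ?case using zero by simp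
  next
    case (insert z Z)
    have z: "(\<lambda>t. c z * e z t) \<in> W" using insert by (intro cmult e) auto
    have "L y (\<lambda>t. c z * e z t) = c z * L y (e z)" if "y \<in> insert x0 X" for y
      using that insert e \<open>\<And>x f a. x \<in> insert x0 X \<Longrightarrow> f \<in> W \<Longrightarrow> L x (\<lambda>t. a * f t) = a * L x f\<close> by auto
    then show ?case using insert z add
      \<open>\<And>x f g. x \<in> insert x0 X \<Longrightarrow> f \<in> W \<Longrightarrow> g \<in> W \<Longrightarrow> L x (\<lambda>t. f t + g t) = L x f + L x g\<close>
      by auto
  qed
  have sub: "(\<lambda>t. f t + (-1) * (\<Sum>x\<in>X. c x * e x t)) \<in> W \<and>
      (\<forall>y\<in>insert x0 X. L y (\<lambda>t. f t + (-1) * (\<Sum>x\<in>X. c x * e x t)) = L y f - (\<Sum>x\<in>X. c x * L y (e x)))"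
    if "f \<in> W" for f c
  proof -
    have 1: "(\<lambda>t. \<Sum>x\<in>X. c x * e x t) \<in> W" using comb[of X c] by auto
    have 2: "(\<lambda>t. (-1) * (\<Sum>x\<in>X. c x * e x t)) \<in> W" by (rule cmult[OF 1])
    show ?thesis using add[OF that 2] insert(4)[OF _ that 2] insert(5)[OF _ 1, of _ "-1"] comb[of X c] by auto
  qed
  have "\<exists>f\<in>W. L x0 f - (\<Sum>x\<in>X. L x f * L x0 (e x)) \<noteq> 0"
  proof (rule ccontr)
    assume neg: "\<not> ?thesis"
    define a where "a x = (if x = x0 then 1 else - L x0 (e x))" for x
    have "(\<Sum>x\<in>insert x0 X. a x * L x f) = 0" if "f \<in> W" for f
    proof -
      have "(\<Sum>x\<in>insert x0 X. a x * L x f) = L x0 f + (\<Sum>x\<in>X. - L x0 (e x) * L x f)"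
        using insert(1,2) by (auto simp: a_def intro!: sum.cong)
      then show ?thesis using neg that by (auto simp: sum_negf mult.commute)
    qed
    then have "a x0 = 0" using insert(6) by blast
    then show False by (simp add: a_def)
  qed
  then obtain f where f: "f \<in> W" "L x0 f - (\<Sum>x\<in>X. L x f * L x0 (e x)) \<noteq> 0" by blast
  define g where "g = (\<lambda>t. f t + (-1) * (\<Sum>x\<in>X. L x f * e x t))"
  have g: "g \<in> W" "L x0 g \<noteq> 0" using sub[OF f(1), of "\<lambda>x. L x f"] f(2) by (auto simp: g_def)
  have gy: "L y g = 0" if "y \<in> X" for y
  proof -
    have "L y g = L y f - (\<Sum>x\<in>X. L x f * L y (e x))"
      using sub[OF f(1), of "\<lambda>x. L x f"] that by (simp add: g_def)
    also have "(\<Sum>x\<in>X. L x f * L y (e x)) = (\<Sum>x\<in>X. if x = y then L x f else 0)"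
      using that e by (intro sum.cong) auto
    also have "\<dots> = L y f" using that insert(1) by simp
    finally show ?thesis by simp
  qed
  define e0 where "e0 = (\<lambda>t. (1 / L x0 g) * g t)"
  have e0W: "e0 \<in> W" unfolding e0_def by (rule cmult[OF g(1)])
  have Le0: "L y e0 = (1 / L x0 g) * L y g" if "y \<in> insert x0 X" for y
    unfolding e0_def by (rule insert(5)[OF that g(1)])
  have e0: "e0 \<in> W" "L x0 e0 = 1" "\<And>y. y \<in> X \<Longrightarrow> L y e0 = 0"
    using Le0 g(2) gy e0W by auto
  define e' where "e' x = (if x = x0 then e0 else (\<lambda>t. e x t + (- L x0 (e x)) * e0 t))" for x
  have e': "e' x \<in> W" "\<And>y. y \<in> insert x0 X \<Longrightarrow> L y (e' x) = L y (e x) - L x0 (e x) * L y e0" if "x \<in> X" for x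
  proof -
    have x: "x \<noteq> x0" using that insert(2) by auto
    have 1: "(\<lambda>t. - L x0 (e x) * e0 t) \<in> W" by (rule cmult[OF e0(1)])
    show "e' x \<in> W" using add[OF e(1)[OF that] 1] x by (simp add: e'_def)
    fix y assume y: "y \<in> insert x0 X"
    show "L y (e' x) = L y (e x) - L x0 (e x) * L y e0"
      using insert(4)[OF y e(1)[OF that] 1] insert(5)[OF y e0(1), of "- L x0 (e x)"] x by (simp add: e'_def)
  qed
  have e'_x0: "e' x0 = e0" by (simp add: e'_def)
  show ?case
  proof (intro exI[of _ e'] ballI conjI)
    fix x assume x: "x \<in> insert x0 X"
    show "e' x \<in> W" using x e'(1)[of x] e0(1) by (cases "x = x0") (simp_all add: e'_x0)
    fix y assume y: "y \<in> insert x0 X"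
    show "L y (e' x) = (if x = y then 1 else 0)"
    proof (cases "x = x0")
      case True
      then show ?thesis using y e0 insert(2) by (auto simp: e'_x0)
    next
      case False
      then have "x \<in> X" using x by simp
      then show ?thesis using e'(2)[OF _ y] y e0 e(2) insert(2) False by (cases "y = x0") auto
    qed
  qed
qed simp

text \<open>Greedy choice: a new element is kept only if it is no combination of those kept before.
  Finitely many translates of \<open>K\<close> may be dependent, and biorthogonal functions exist
  only for an independent subfamily.\<close>

lemma independent_spanning_subset:
  fixes g :: "'x \<Rightarrow> 'b \<Rightarrow> complex"
  assumes "finite X"
  shows "\<exists>B\<subseteq>X. (\<forall>a. (\<forall>t. (\<Sum>x\<in>B. a x * g x t) = 0) \<longrightarrow> (\<forall>x\<in>B. a x = 0)) \<and>
    (\<forall>c. \<exists>c'. \<forall>t. (\<Sum>x\<in>X. c x * g x t) = (\<Sum>x\<in>B. c' x * g x t))"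
  using assms
proof (induction X)
  case (insert x0 X)
  then obtain B where B: "B \<subseteq> X" "\<And>a. (\<forall>t. (\<Sum>x\<in>B. a x * g x t) = 0) \<Longrightarrow> (\<forall>x\<in>B. a x = 0)"
    and sp: "\<And>c. \<exists>c'. \<forall>t. (\<Sum>x\<in>X. c x * g x t) = (\<Sum>x\<in>B. c' x * g x t)" by blast
  have fB: "finite B" "x0 \<notin> B" using B(1) insert(1,2) finite_subset by auto
  show ?case
  proof (cases "\<exists>b. \<forall>t. g x0 t = (\<Sum>x\<in>B. b x * g x t)")
    case True
    then obtain b where b: "\<And>t. g x0 t = (\<Sum>x\<in>B. b x * g x t)" by blast
    have "\<exists>c'. \<forall>t. (\<Sum>x\<in>insert x0 X. c x * g x t) = (\<Sum>x\<in>B. c' x * g x t)" for c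
    proof -
      obtain c' where "\<And>t. (\<Sum>x\<in>X. c x * g x t) = (\<Sum>x\<in>B. c' x * g x t)" using sp by blast
      then show ?thesis using insert(1,2)
        by (intro exI[of _ "\<lambda>x. c x0 * b x + c' x"]) (simp add: b distrib_right sum.distrib sum_distrib_left mult.assoc)
    qed
    then show ?thesis using B by blast
  next
    case False
    have "\<forall>x\<in>insert x0 B. a x = 0" if a: "\<forall>t. (\<Sum>x\<in>insert x0 B. a x * g x t) = 0" for a
    proof -
      have eq: "a x0 * g x0 t + (\<Sum>x\<in>B. a x * g x t) = 0" for t using a fB by simp
      have "a x0 = 0"
      proof (rule ccontr)
        assume nz: "a x0 \<noteq> 0"
        have "g x0 t = (\<Sum>x\<in>B. (- a x / a x0) * g x t)" for t
        proof -
          have "g x0 t = - (\<Sum>x\<in>B. a x * g x t) / a x0"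
            using eq[of t] nz by (simp add: field_simps eq_neg_iff_add_eq_0)
          then show ?thesis by (simp add: sum_divide_distrib sum_negf)
        qed
        then show False using spec[OF False[unfolded not_ex], of "\<lambda>x. - a x / a x0"] by blast
      qed
      then show ?thesis using eq B(2)[of a] by simp
    qed
    moreover have "\<exists>c'. \<forall>t. (\<Sum>x\<in>insert x0 X. c x * g x t) = (\<Sum>x\<in>insert x0 B. c' x * g x t)" for c
    proof -
      obtain c' where c': "\<And>t. (\<Sum>x\<in>X. c x * g x t) = (\<Sum>x\<in>B. c' x * g x t)" using sp by blast
      have "(\<Sum>x\<in>B. c' x * g x t) = (\<Sum>x\<in>B. (c'(x0 := c x0)) x * g x t)" for t
        using fB by (intro sum.cong) auto
      then show ?thesis using insert(1,2) fB c' by (intro exI[of _ "c'(x0 := c x0)"]) simp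
    qed
    ultimately show ?thesis using B(1) by (intro exI[of _ "insert x0 B"]) blast
  qed
qed auto

lemma Lpw_pairing_integrable:
  assumes f: "in_Lpw M s v f" and g: "in_Lpw M t (\<lambda>x. 1 / v x) g" and v: "\<And>x. 0 < v x"
    and s: "1 < s" "1 / s + 1 / t = 1"
  shows "integrable M (\<lambda>x. f x * g x)"
    and "norm (\<integral>x. f x * g x \<partial>M) \<le> Lpw_norm M s v f * Lpw_norm M t (\<lambda>x. 1 / v x) g"
proof -
  note p = nn_integral_Lpw_pairing[OF assms]
  note [measurable] = in_Lpw_measurable(1)[OF f] in_Lpw_measurable(1)[OF g]
  show i: "integrable M (\<lambda>x. f x * g x)"
    by (rule integrableI_bounded) (use le_less_trans[OF p] in \<open>auto simp: norm_mult\<close>)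
  have "ennreal (norm (\<integral>x. f x * g x \<partial>M)) \<le> ennreal (Lpw_norm M s v f * Lpw_norm M t (\<lambda>x. 1 / v x) g)"
    using integral_norm_bound_ennreal[OF i] p by (simp add: norm_mult)
  then show "norm (\<integral>x. f x * g x \<partial>M) \<le> Lpw_norm M s v f * Lpw_norm M t (\<lambda>x. 1 / v x) g"
    by (subst (asm) ennreal_le_iff) (auto simp: Lpw_norm_nonneg)
qed

lemma in_Lpw_cnj:
  assumes "in_Lpw M s v f" "\<And>x. 0 \<le> v x" "0 < s"
  shows "in_Lpw M s v (\<lambda>x. cnj (f x))"
proof (rule in_Lpw_mono[OF assms])
  note [measurable] = in_Lpw_measurable[OF assms(1)]
  show "(\<lambda>x. cnj (f x)) \<in> borel_measurable M" by measurable
  have "(\<lambda>x. cnj (complex_of_real (v x) * f x)) \<in> borel_measurable M" by measurable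
  then show "(\<lambda>x. complex_of_real (v x) * cnj (f x)) \<in> borel_measurable M" by simp
qed simp

text \<open>Testing against the conjugate of a linear combination turns the pairing into the squared
  \<open>L\<^sub>2\<close>-norm.\<close>
lemma Lpw_dual_system:
  fixes g :: "'x \<Rightarrow> 'a \<Rightarrow> complex"
  assumes X: "finite X" and g1: "\<And>x. x \<in> X \<Longrightarrow> in_Lpw M t (\<lambda>y. 1 / v y) (g x)"
    and g2: "\<And>x. x \<in> X \<Longrightarrow> in_Lpw M s v (g x)" and v: "\<And>x. 0 < v x"
    and s: "1 < s" "1 / s + 1 / t = 1"
    and indep: "\<And>a. (AE y in M. (\<Sum>x\<in>X. a x * g x y) = 0) \<Longrightarrow> \<forall>x\<in>X. a x = 0"
  shows "\<exists>e. \<forall>x\<in>X. in_Lpw M s v (e x) \<and> (\<forall>y\<in>X. (\<integral>z. e x z * g y z \<partial>M) = (if x = y then 1 else 0))"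
proof -
  have v': "0 \<le> v x" for x using v[of x] by simp
  have t: "1 < t" "1 / t + 1 / s = 1"
  proof -
    have "0 < 1 / s" "1 / s < 1" using s(1) by auto
    with s(2) have "0 < 1 / t" "1 / t < 1" using s by linarith+
    then show "1 < t" by (simp add: divide_less_eq_1)
  qed (use s in simp)
  have i: "integrable M (\<lambda>z. f z * g x z)" if "x \<in> X" "in_Lpw M s v f" for x f
    by (rule Lpw_pairing_integrable[OF that(2) g1[OF that(1)] v s])
  have "\<exists>e. \<forall>x\<in>X. e x \<in> {f. in_Lpw M s v f} \<and> (\<forall>y\<in>X. (\<integral>z. e x z * g y z \<partial>M) = (if x = y then 1 else 0))"
  proof (rule dual_system[OF X, where L="\<lambda>x f. \<integral>z. f z * g x z \<partial>M"])
    fix a assume a: "\<And>f. f \<in> {f. in_Lpw M s v f} \<Longrightarrow> (\<Sum>x\<in>X. a x * (\<integral>z. f z * g x z \<partial>M)) = 0"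
    define G where "G y = (\<Sum>x\<in>X. a x * g x y)" for y
    have G: "in_Lpw M s v G" unfolding G_def
      using s v' by (intro in_Lpw_sum in_Lpw_cmult g2) auto
    have G': "in_Lpw M t (\<lambda>y. 1 / v y) G" unfolding G_def
      using t v' by (intro in_Lpw_sum in_Lpw_cmult g1) auto
    have cG: "in_Lpw M s v (\<lambda>y. cnj (G y))" using s by (intro in_Lpw_cnj G v') auto
    have "0 = (\<Sum>x\<in>X. a x * (\<integral>z. cnj (G z) * g x z \<partial>M))" using a[of "\<lambda>y. cnj (G y)"] cG by simp
    also have "\<dots> = (\<Sum>x\<in>X. \<integral>z. a x * (cnj (G z) * g x z) \<partial>M)"
      by (intro sum.cong refl) (simp only: integral_mult_right_zero)
    also have "\<dots> = (\<integral>z. (\<Sum>x\<in>X. a x * (cnj (G z) * g x z)) \<partial>M)"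
      by (rule Bochner_Integration.integral_sum[symmetric]) (intro integrable_mult_right i cG)
    also have "\<dots> = (\<integral>z. complex_of_real ((norm (G z))\<^sup>2) \<partial>M)"
    proof (rule Bochner_Integration.integral_cong)
      fix z
      have "(\<Sum>x\<in>X. a x * (c * g x z)) = c * G z" for c
        by (simp add: G_def sum_distrib_left mult_ac)
      then show "(\<Sum>x\<in>X. a x * (cnj (G z) * g x z)) = complex_of_real ((norm (G z))\<^sup>2)"
        by (simp add: complex_norm_square mult.commute del: of_real_power)
    qed simp
    also have "\<dots> = complex_of_real (\<integral>z. (norm (G z))\<^sup>2 \<partial>M)" by (rule integral_complex_of_real)
    finally have z: "(\<integral>z. (norm (G z))\<^sup>2 \<partial>M) = 0" by simp
    \<comment> \<open>The square of \<open>|G|\<close> is integrable because \<open>G\<close> lies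
      in both of the spaces paired with each other.\<close>
    have "integrable M (\<lambda>z. norm (cnj (G z) * G z))"
      by (intro integrable_norm Lpw_pairing_integrable[OF cG G' v s])
    then have "integrable M (\<lambda>z. (norm (G z))\<^sup>2)" by (simp add: norm_mult power2_eq_square)
    then have "AE y in M. (norm (G y))\<^sup>2 = 0" using z by (subst (asm) integral_nonneg_eq_0_iff_AE) auto
    then have "AE y in M. G y = 0" by (auto elim: eventually_mono)
    then show "\<forall>x\<in>X. a x = 0" unfolding G_def by (rule indep)
  next
    fix x f h assume "x \<in> X" "f \<in> {f. in_Lpw M s v f}" "h \<in> {f. in_Lpw M s v f}"
    then show "(\<integral>z. (f z + h z) * g x z \<partial>M) = (\<integral>z. f z * g x z \<partial>M) + (\<integral>z. h z * g x z \<partial>M)"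
      using i[of x f] i[of x h] by (simp add: distrib_right)
  next
    fix x f a assume "x \<in> X" "f \<in> {f. in_Lpw M s v f}"
    show "(\<integral>z. a * f z * g x z \<partial>M) = a * (\<integral>z. f z * g x z \<partial>M)"
      by (simp only: mult.assoc integral_mult_right_zero)
  qed (use s in \<open>auto simp: in_Lpw_zero intro!: in_Lpw_add in_Lpw_cmult v'\<close>)
  then show ?thesis by simp
qed

section \<open>Compactly supported and continuous functions\<close>

context haar_group
begin

lemma in_Lpw_bounded_compact_support:
  assumes C: "compact C" and v: "continuous_on UNIV v" "\<And>x. 0 \<le> v x" and s: "0 < s"
    and g: "g \<in> borel_measurable M" "\<And>x. norm (g x) \<le> 1" "\<And>x. x \<notin> C \<Longrightarrow> g x = 0"
  shows "in_Lpw M s v g"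
proof -
  have [measurable]: "v \<in> borel_measurable M" "g \<in> borel_measurable M" using continuous_measurable[OF v(1)] g by auto
  have [measurable]: "C \<in> sets M" by (rule compact_sets[OF C])
  have "compact (v ` C)" using C v(1) by (intro compact_continuous_image) (auto intro: continuous_on_subset)
  then have "bounded (v ` C)" by (rule compact_imp_bounded)
  then obtain B0 where B0: "\<And>x. x \<in> C \<Longrightarrow> norm (v x) \<le> B0" by (auto simp: bounded_iff)
  define B where "B = max B0 0"
  have B: "v x \<le> B" "0 \<le> B" if "x \<in> C" for x using B0[OF that] v(2)[of x] by (auto simp: B_def)
  have "(\<integral>\<^sup>+x. ennreal ((v x * norm (g x)) powr s) \<partial>M) \<le> (\<integral>\<^sup>+x. ennreal (B powr s) * indicator C x \<partial>M)"
  proof (intro nn_integral_mono)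
    fix x
    show "ennreal ((v x * norm (g x)) powr s) \<le> ennreal (B powr s) * indicator C x"
    proof (cases "x \<in> C")
      case True
      have "v x * norm (g x) \<le> B * 1" using B[OF True] g(2)[of x] v(2)[of x] by (intro mult_mono) auto
      then show ?thesis using True v(2)[of x] s by (auto intro!: ennreal_leI powr_mono2)
    qed (use g(3) s in auto)
  qed
  also have "\<dots> = ennreal (B powr s * measure M C)"
    using emeasure_compact[OF C] by (simp add: nn_integral_cmult_indicator ennreal_mult emeasure_eq_ennreal_measure)
  also have "B powr s * measure M C = ((B powr s * measure M C) powr (1 / s)) powr s"
    using s by (simp add: powr_powr)
  finally show ?thesis
    using s v(2) by (intro in_Lpw_bound[where c="(B powr s * measure M C) powr (1 / s)"]) auto
qed

lemma continuous_AE_0: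
  fixes f :: "'g \<Rightarrow> complex"
  assumes "continuous_on UNIV f" "AE x in M. f x = 0"
  shows "f x = 0"
proof (rule ccontr)
  assume nz: "f x \<noteq> 0"
  have [measurable]: "f \<in> borel_measurable M" by (rule continuous_measurable[OF assms(1)])
  have "open (f -` (- {0}))" using assms(1) by (intro open_vimage) auto
  then have "0 < emeasure M (f -` (- {0}))" using nz by (intro emeasure_open_pos) auto
  moreover have "emeasure M {x \<in> space M. f x \<noteq> 0} = 0" using assms(2) by (subst (asm) AE_iff_measurable) auto
  moreover have "{x \<in> space M. f x \<noteq> 0} = f -` (- {0})" by auto
  ultimately show False by simp
qed

end

section \<open>Boundedness on finite-dimensional spaces\<close>

context voice_transform
begin

lemma ltrans_K_continuous: "continuous_on UNIV (ltrans x K)"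
  unfolding ltrans_def by (intro continuous_on_compose2[OF K_continuous] continuous_intros) auto

text \<open>This is the range of \<open>Tn\<close> (see \<open>Tn_range\<close>), described without
  the functions \<psi>; only the values of the coefficients on \<open>X\<close> count.\<close>

definition K_span :: "'g set \<Rightarrow> ('g \<Rightarrow> complex) set" where
  "K_span X = range (\<lambda>c y. \<Sum>x\<in>X. c x * ltrans x K y)"

text \<open>Indices with the same point \<open>g i\<close> have their coefficients added. This
  happens when several centres are approximated by one point of \<open>X\<close>.\<close>

lemma K_span_lincomb:
  assumes "finite X" "\<And>i. i \<in> F \<Longrightarrow> g i \<in> X"
  shows "(\<lambda>y. \<Sum>i\<in>F. c i * ltrans (g i) K y) \<in> K_span X"
proof -
  have "(\<Sum>x\<in>X. (\<Sum>i\<in>F. if x = g i then c i else 0) * ltrans x K y) = (\<Sum>i\<in>F. c i * ltrans (g i) K y)" for y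
  proof -
    have "(\<Sum>x\<in>X. (\<Sum>i\<in>F. if x = g i then c i else 0) * ltrans x K y) = (\<Sum>x\<in>X. \<Sum>i\<in>F. if x = g i then c i * ltrans x K y else 0)"
      unfolding sum_distrib_right by (intro sum.cong) auto
    also have "\<dots> = (\<Sum>i\<in>F. \<Sum>x\<in>X. if x = g i then c i * ltrans x K y else 0)" by (rule sum.swap)
    also have "\<dots> = (\<Sum>i\<in>F. c i * ltrans (g i) K y)"
      using assms by (intro sum.cong refl) auto
    finally show ?thesis .
  qed
  then show ?thesis unfolding K_span_def by (intro image_eqI[of _ _ "\<lambda>x. \<Sum>i\<in>F. if x = g i then c i else 0"]) auto
qed

lemma K_span_in_Lpw:
  assumes "moderate w m" "1 < r" "f \<in> K_span X"
  shows "in_Lpw M r m f"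
  using assms lincomb_in_Lpw by (auto simp: K_span_def)

text \<open>Boundedness of linear maps on a finite-dimensional space, in coordinates: biorthogonal
  functions for an independent subfamily bound each coefficient of \<open>f\<close> by the norm of
  \<open>f\<close>.\<close>

lemma linear_bounded_on_K_span:
  assumes m: "moderate w m" and r: "1 < r" and X: "finite X"
    and S: "\<And>f. f \<in> K_span X \<Longrightarrow> in_Lpw M r m (S f)"
    and lin: "\<And>f g a b. f \<in> K_span X \<Longrightarrow> g \<in> K_span X \<Longrightarrow>
        S (\<lambda>x. a * f x + b * g x) = (\<lambda>x. a * S f x + b * S g x)"
  shows "\<exists>C. \<forall>f\<in>K_span X. Lpw_norm M r m (S f) \<le> C * Lpw_norm M r m f"
proof -
  have mpos: "0 < m x" and mnn: "0 \<le> m x" for x using m by (auto simp: moderate_def less_imp_le)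
  define r' where "r' = r / (r - 1)"
  have r': "1 < r'" "1 / r' + 1 / r = 1" using r by (auto simp: r'_def field_simps)
  obtain B where B: "B \<subseteq> X"
    and ind: "\<forall>a. (\<forall>t. (\<Sum>x\<in>B. a x * ltrans x K t) = 0) \<longrightarrow> (\<forall>x\<in>B. a x = 0)"
    and sp: "\<forall>c. \<exists>c'. \<forall>t. (\<Sum>x\<in>X. c x * ltrans x K t) = (\<Sum>x\<in>B. c' x * ltrans x K t)"
    using independent_spanning_subset[OF X, of "\<lambda>x. ltrans x K"] by (elim exE conjE) (rule that)
  have fB: "finite B" using B X finite_subset by blast
  have "\<exists>e. \<forall>x\<in>B. in_Lpw M r' (\<lambda>y. 1 / m y) (e x) \<and> (\<forall>y\<in>B. (\<integral>z. e x z * ltrans y K z \<partial>M) = (if x = y then 1 else 0))"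
  proof (rule Lpw_dual_system[OF fB _ _ _ r'])
    \<comment> \<open>The biorthogonal functions are sought in the dual space, so the weight is 1/m
      and its reciprocal is \<open>m\<close> again.\<close>
    show "in_Lpw M r (\<lambda>y. 1 / (1 / m y)) (ltrans x K)" for x using ltrans_K_in_Lpw[OF m r] by simp
    show "in_Lpw M r' (\<lambda>y. 1 / m y) (ltrans x K)" for x by (rule ltrans_K_in_Lpw[OF moderate_inverse[OF w m] r'(1)])
    \<comment> \<open>Pointwise independence becomes independence almost everywhere: the
      combinations are continuous and open sets have positive measure.\<close>
    fix a assume "AE y in M. (\<Sum>x\<in>B. a x * ltrans x K y) = 0"
    moreover have "continuous_on UNIV (\<lambda>y. \<Sum>x\<in>B. a x * ltrans x K y)"
      by (intro continuous_intros ltrans_K_continuous)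
    ultimately have "(\<Sum>x\<in>B. a x * ltrans x K y) = 0" for y
      by (intro continuous_AE_0[where f="\<lambda>y. \<Sum>x\<in>B. a x * ltrans x K y"])
    then show "\<forall>x\<in>B. a x = 0" using ind by blast
  qed (use mpos in auto)
  then obtain e where e: "\<And>x. x \<in> B \<Longrightarrow> in_Lpw M r' (\<lambda>y. 1 / m y) (e x)"
    "\<And>x y. x \<in> B \<Longrightarrow> y \<in> B \<Longrightarrow> (\<integral>z. e x z * ltrans y K z \<partial>M) = (if x = y then 1 else 0)" by metis
  have gX: "ltrans x K \<in> K_span X" if "x \<in> B" for x
    using K_span_lincomb[OF X, of "{x}" "\<lambda>x. x" "\<lambda>_. 1"] that B by auto
  have Ssum: "S (\<lambda>y. \<Sum>x\<in>Z. c x * ltrans x K y) = (\<lambda>y. \<Sum>x\<in>Z. c x * S (ltrans x K) y)" if "Z \<subseteq> B" for Z c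
    using finite_subset[OF that fB] that
  proof (induction Z)
    case empty
    have 0: "(\<lambda>y. 0) \<in> K_span X" using K_span_lincomb[OF X, of "{}"] by simp
    show ?case using lin[OF 0 0, of 0 0] by simp
  next
    case (insert z Z)
    have "(\<lambda>y. \<Sum>x\<in>Z. c x * ltrans x K y) \<in> K_span X"
      using insert(4) B by (intro K_span_lincomb[OF X]) auto
    then show ?case using lin[OF gX, of z "\<lambda>y. \<Sum>x\<in>Z. c x * ltrans x K y" "c z" 1] insert by simp
  qed
  define C where "C = (\<Sum>x\<in>B. Lpw_norm M r' (\<lambda>y. 1 / m y) (e x) * Lpw_norm M r m (S (ltrans x K)))"
  have "Lpw_norm M r m (S f) \<le> C * Lpw_norm M r m f" if f: "f \<in> K_span X" for f
  proof -
    obtain c where c: "f = (\<lambda>y. \<Sum>x\<in>B. c x * ltrans x K y)"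
      using f sp unfolding K_span_def by (auto simp: fun_eq_iff)
    have cx: "norm (c x) \<le> Lpw_norm M r' (\<lambda>y. 1 / m y) (e x) * Lpw_norm M r m f" if x: "x \<in> B" for x
    proof -
      have fL: "in_Lpw M r (\<lambda>y. 1 / (1 / m y)) f" using K_span_in_Lpw[OF m r f] by simp
      have "(\<integral>z. e x z * f z \<partial>M) = (\<integral>z. (\<Sum>y\<in>B. c y * (e x z * ltrans y K z)) \<partial>M)"
        unfolding c by (simp add: sum_distrib_left mult_ac)
      also have "\<dots> = (\<Sum>y\<in>B. \<integral>z. c y * (e x z * ltrans y K z) \<partial>M)"
      proof (intro Bochner_Integration.integral_sum integrable_mult_right Lpw_pairing_integrable[OF e(1)[OF x] _ _ r'])
        show "in_Lpw M r (\<lambda>y. 1 / (1 / m y)) (ltrans y K)" for y using ltrans_K_in_Lpw[OF m r] by simp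
      qed (use mpos in auto)
      also have "\<dots> = (\<Sum>y\<in>B. if x = y then c y else 0)"
        by (intro sum.cong refl) (simp add: integral_mult_right_zero e(2)[OF x])
      also have "\<dots> = c x" using x fB by simp
      finally have "c x = (\<integral>z. e x z * f z \<partial>M)" by simp
      then show ?thesis
        using Lpw_pairing_integrable(2)[OF e(1)[OF x] fL _ r'] mpos by simp
    qed
    have "Lpw_norm M r m (S f) = Lpw_norm M r m (\<lambda>y. \<Sum>x\<in>B. c x * S (ltrans x K) y)"
      unfolding c Ssum[OF order_refl] ..
    also have "\<dots> \<le> (\<Sum>x\<in>B. Lpw_norm M r m (\<lambda>y. c x * S (ltrans x K) y))"
      using r by (intro Lpw_norm_sum in_Lpw_cmult S gX mnn) auto
    also have "\<dots> = (\<Sum>x\<in>B. norm (c x) * Lpw_norm M r m (S (ltrans x K)))"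
      using r by (intro sum.cong refl Lpw_norm_cmult) auto
    also have "\<dots> \<le> (\<Sum>x\<in>B. (Lpw_norm M r' (\<lambda>y. 1 / m y) (e x) * Lpw_norm M r m f) * Lpw_norm M r m (S (ltrans x K)))"
      by (intro sum_mono mult_right_mono cx Lpw_norm_nonneg)
    also have "\<dots> = C * Lpw_norm M r m f" by (simp add: C_def sum_distrib_left sum_distrib_right mult_ac)
    finally show ?thesis .
  qed
  then show ?thesis by blast
qed

text \<open>The operator norm is a \<open>Sup\<close> of reals and says something only about a set
  that is bounded above; boundedness is supplied by \<open>linear_bounded_on_K_span\<close>.\<close>

lemma op_norm_bound:
  assumes m: "moderate w m" and r: "1 < r" and X: "finite X"
    and S: "\<And>f. f \<in> K_span X \<Longrightarrow> in_Lpw M r m (S f)"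
    and lin: "\<And>f g a b. f \<in> K_span X \<Longrightarrow> g \<in> K_span X \<Longrightarrow>
        S (\<lambda>x. a * f x + b * g x) = (\<lambda>x. a * S f x + b * S g x)"
    and f: "f \<in> K_span X"
  shows "Lpw_norm M r m (S f) \<le> op_norm_on M r m (K_span X) S * Lpw_norm M r m f"
    and "0 \<le> op_norm_on M r m (K_span X) S"
proof -
  obtain C0 where C0: "\<And>f. f \<in> K_span X \<Longrightarrow> Lpw_norm M r m (S f) \<le> C0 * Lpw_norm M r m f"
    using linear_bounded_on_K_span[OF m r X, of S, OF S lin] by blast
  have bdd: "bdd_above {Lpw_norm M r m (S f) | f. f \<in> K_span X \<and> Lpw_norm M r m f \<le> 1}"
  proof (rule bdd_aboveI)
    fix z assume "z \<in> {Lpw_norm M r m (S f) | f. f \<in> K_span X \<and> Lpw_norm M r m f \<le> 1}"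
    then obtain f where f: "f \<in> K_span X" "Lpw_norm M r m f \<le> 1" "z = Lpw_norm M r m (S f)" by auto
    have "C0 * Lpw_norm M r m f \<le> \<bar>C0\<bar> * 1" using f by (intro mult_mono) (auto simp: Lpw_norm_nonneg)
    then show "z \<le> \<bar>C0\<bar>" using C0[OF f(1)] f(3) by simp
  qed
  have up: "Lpw_norm M r m (S g) \<le> op_norm_on M r m (K_span X) S" if "g \<in> K_span X" "Lpw_norm M r m g \<le> 1" for g
    unfolding op_norm_on_def using that by (intro cSup_upper bdd) auto
  have "(\<lambda>y. 0) \<in> K_span X" using K_span_lincomb[OF X, of "{}"] by simp
  then have "Lpw_norm M r m (S (\<lambda>y. 0)) \<le> op_norm_on M r m (K_span X) S"
    using r by (intro up) (auto simp: Lpw_norm_zero)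
  then show "0 \<le> op_norm_on M r m (K_span X) S"
    using Lpw_norm_nonneg[of M r m "S (\<lambda>y. 0)"] by linarith
  show "Lpw_norm M r m (S f) \<le> op_norm_on M r m (K_span X) S * Lpw_norm M r m f"
  proof (cases "Lpw_norm M r m f = 0")
    \<comment> \<open>A function of norm 0 cannot be normalised, but boundedness forces its image to
      have norm 0.\<close>
    case True
    then show ?thesis using C0[OF f] by simp
  next
    case False
    define l where "l = Lpw_norm M r m f"
    have l: "l > 0" using False Lpw_norm_nonneg[of M r m f] by (simp add: l_def)
    \<comment> \<open>The term \<open>0 * f x\<close> brings the multiple into the two-term form of
      the linearity hypothesis.\<close>
    define g where "g = (\<lambda>x. complex_of_real (1 / l) * f x + 0 * f x)"
    have Sg: "S g = (\<lambda>x. complex_of_real (1 / l) * S f x)" unfolding g_def lin[OF f f] by simp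
    have nz: "Lpw_norm M r m (\<lambda>x. complex_of_real (1 / l) * h x) = (1 / l) * Lpw_norm M r m h" for h
      using Lpw_norm_cmult[of r M m "complex_of_real (1 / l)" h] r l by (simp add: norm_divide)
    have "g \<in> K_span X"
    proof -
      obtain c where c: "f = (\<lambda>y. \<Sum>x\<in>X. c x * ltrans x K y)" using f by (auto simp: K_span_def)
      show ?thesis unfolding K_span_def
        by (rule image_eqI[of _ _ "\<lambda>x. complex_of_real (1 / l) * c x"]) (auto simp: g_def c sum_distrib_left mult_ac)
    qed
    moreover have "Lpw_norm M r m g = 1" using nz[of f] l by (simp add: g_def l_def)
    ultimately have "Lpw_norm M r m (S g) \<le> op_norm_on M r m (K_span X) S" by (intro up) auto
    then have "(1 / l) * Lpw_norm M r m (S f) \<le> op_norm_on M r m (K_span X) S" by (simp only: Sg nz)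
    then show ?thesis using l by (simp add: l_def[symmetric] field_simps)
  qed
qed

end

section \<open>Sparse approximation\<close>

locale discretized = voice_transform M sc ip \<pi> u w
  for M :: "'g::{topological_group_add,t2_space,second_countable_topology} measure"
    and sc :: "complex \<Rightarrow> 'h::ab_group_add \<Rightarrow> 'h" and ip and \<pi> and u and w +
  fixes Q Y X :: "nat \<Rightarrow> 'g set" and I :: nat and \<psi> :: "nat \<Rightarrow> 'g \<Rightarrow> 'g \<Rightarrow> real"
    and m :: "'g \<Rightarrow> real" and r :: real
  assumes disc: "discretization M Q Y I \<psi> X" and m: "moderate w m" and r: "1 < r"
begin

lemma
  shows Q_compact: "compact (Q n)" and Q_zero: "0 \<in> interior (Q n)"
    and Y_countable: "countable (Y n)"
    and packing: "\<exists>Z. \<forall>n. Y n = (\<Union>i\<in>{1..I}. Z n i) \<and>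
        (\<forall>i\<in>{1..I}. \<forall>x\<in>Z n i. \<forall>y\<in>Z n i.
           ((+) x ` Q n) \<inter> ((+) y ` Q n) \<noteq> {} \<longrightarrow> x = y)"
    and psi_measurable: "x \<in> Y n \<Longrightarrow> \<psi> n x \<in> borel_measurable M"
    and psi_nonneg: "x \<in> Y n \<Longrightarrow> 0 \<le> \<psi> n x g" and psi_le_1: "x \<in> Y n \<Longrightarrow> \<psi> n x g \<le> 1"
    and psi_support: "x \<in> Y n \<Longrightarrow> \<psi> n x g \<noteq> 0 \<Longrightarrow> g \<in> (+) x ` Q n"
    and psi_sum: "((\<lambda>x. \<psi> n x g) has_sum 1) (Y n)"
    and psi_indep: "finite F \<Longrightarrow> F \<subseteq> Y n \<Longrightarrow> (AE g in M. (\<Sum>x\<in>F. a x * complex_of_real (\<psi> n x g)) = 0) \<Longrightarrow> \<forall>x\<in>F. a x = 0"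
    and X_finite: "finite (X n)" and X_Y: "X n \<subseteq> Y n" and X_Suc: "X n \<subseteq> X (Suc n)"
    and X_dense: "closure (\<Union>n. X n) = UNIV"
proof -
  note d = disc[unfolded discretization_def]
  note d2 = d[THEN conjunct2] note d3 = d2[THEN conjunct2] note d4 = d3[THEN conjunct2]
  note d5 = d4[THEN conjunct2] note d6 = d5[THEN conjunct2] note d7 = d6[THEN conjunct2]
  note d8 = d7[THEN conjunct2] note d9 = d8[THEN conjunct2]
  show "compact (Q n)" "0 \<in> interior (Q n)" using d[THEN conjunct1] by blast+
  show "countable (Y n)" using d2[THEN conjunct1] by blast
  show "\<exists>Z. \<forall>n. Y n = (\<Union>i\<in>{1..I}. Z n i) \<and>
        (\<forall>i\<in>{1..I}. \<forall>x\<in>Z n i. \<forall>y\<in>Z n i.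
           ((+) x ` Q n) \<inter> ((+) y ` Q n) \<noteq> {} \<longrightarrow> x = y)"
    by (rule d5[THEN conjunct1])
  have 6: "\<psi> n x \<in> borel_measurable M \<and> (\<forall>g. 0 \<le> \<psi> n x g \<and> \<psi> n x g \<le> 1) \<and> {g. \<psi> n x g \<noteq> 0} \<subseteq> (+) x ` Q n"
    if "x \<in> Y n" for x using d6[THEN conjunct1] that by blast
  show "\<psi> n x \<in> borel_measurable M" if "x \<in> Y n" using 6[OF that] by blast
  show "0 \<le> \<psi> n x g" if "x \<in> Y n" using 6[OF that] by blast
  show "\<psi> n x g \<le> 1" if "x \<in> Y n" using 6[OF that] by blast
  show "g \<in> (+) x ` Q n" if "x \<in> Y n" "\<psi> n x g \<noteq> 0" using 6[OF that(1)] that(2) by blast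
  show "((\<lambda>x. \<psi> n x g) has_sum 1) (Y n)" by (rule d7[THEN conjunct1, rule_format])
  show "finite F \<Longrightarrow> F \<subseteq> Y n \<Longrightarrow> (AE g in M. (\<Sum>x\<in>F. a x * complex_of_real (\<psi> n x g)) = 0) \<Longrightarrow> \<forall>x\<in>F. a x = 0"
    by (intro ballI) (rule d8[THEN conjunct1, rule_format])
  show "finite (X n)" "X n \<subseteq> Y n" "X n \<subseteq> X (Suc n)" using d9[THEN conjunct1] by blast+
  show "closure (\<Union>n. X n) = UNIV" by (rule d9[THEN conjunct2])
qed

lemma m_pos: "0 < m x" and m_nonneg: "0 \<le> m x" and m_right: "m (x + y) \<le> m x * w y"
  using m by (auto simp: moderate_def less_imp_le)

lemma m_measurable [measurable]: "m \<in> borel_measurable M"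
  using m by (auto simp: moderate_def intro: continuous_measurable)

lemma w_le_Sup: "q \<in> Q n \<Longrightarrow> w q \<le> Sup (w ` Q n)"
proof -
  assume q: "q \<in> Q n"
  have "compact (w ` Q n)"
    using w Q_compact by (intro compact_continuous_image) (auto simp: weight_def intro: continuous_on_subset)
  then have "bdd_above (w ` Q n)" by (intro bounded_imp_bdd_above compact_imp_bounded)
  then show ?thesis using q by (intro cSUP_upper)
qed

lemma Sup_w_pos: "0 < Sup (w ` Q n)"
proof -
  have "0 \<in> Q n" using Q_zero interior_subset by blast
  then show ?thesis using w_le_Sup[of 0 n] w_pos[of 0] by linarith
qed

lemma translate_compact: "compact ((+) x ` Q n)"
  by (intro compact_continuous_image Q_compact continuous_intros)

lemma emeasure_translate: "emeasure M ((+) x ` Q n) = ennreal (measure M (Q n))"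
  using emeasure_left[OF compact_sets[OF Q_compact], of x n] emeasure_compact[OF Q_compact[of n]]
  by (simp add: emeasure_eq_ennreal_measure)

lemma measure_Q_pos: "0 < measure M (Q n)"
proof -
  have "0 < emeasure M (interior (Q n))" using Q_zero by (intro emeasure_open_pos) auto
  also have "\<dots> \<le> emeasure M (Q n)" by (intro emeasure_mono interior_subset compact_sets Q_compact)
  finally show ?thesis using emeasure_compact[OF Q_compact[of n]] by (simp add: emeasure_eq_ennreal_measure)
qed

lemma m_le_Sup:
  assumes "z \<in> (+) x ` Q n"
  shows "m x \<le> m z * Sup (w ` Q n)" "m z \<le> m x * Sup (w ` Q n)"
proof -
  obtain q where q: "z = x + q" "q \<in> Q n" using assms by auto
  have "m x = m (z + - q)" by (simp add: q(1) add.assoc)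
  also have "\<dots> \<le> m z * w q" using m_right[of z "- q"] by (simp add: w_minus)
  also have "\<dots> \<le> m z * Sup (w ` Q n)" by (intro mult_left_mono w_le_Sup q m_nonneg)
  finally show "m x \<le> m z * Sup (w ` Q n)" .
  have "m z \<le> m x * w q" unfolding q(1) by (rule m_right)
  also have "\<dots> \<le> m x * Sup (w ` Q n)" by (intro mult_left_mono w_le_Sup q m_nonneg)
  finally show "m z \<le> m x * Sup (w ` Q n)" .
qed

lemma psi_sum_le_1: "finite F \<Longrightarrow> F \<subseteq> Y n \<Longrightarrow> (\<Sum>x\<in>F. \<psi> n x g) \<le> 1"
proof -
  assume F: "finite F" "F \<subseteq> Y n"
  have "infsum (\<lambda>x. \<psi> n x g) F \<le> infsum (\<lambda>x. \<psi> n x g) (Y n)"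
    using F psi_sum[of n g] by (intro infsum_mono_neutral) (auto simp: psi_nonneg intro: has_sum_imp_summable)
  then show ?thesis using F infsumI[OF psi_sum[of n g]] by simp
qed

text \<open>On the support of \<open>\<psi> n x\<close> the weight \<open>m x\<close> is at most
  \<open>m z * s\<close>. Hoelder is applied to \<psi>^(1/r) times \<psi>^(1/t): the second factor
  contributes the measure of a patch to the power 1/t, and the r-th powers of the first add up to at
  most the r-th power of the norm of \<open>F\<close>, because the \<psi> sum to at most 1.\<close>

lemma coefficient_bound:
  assumes F: "in_Lpw M r m F" and Z: "finite Z" "Z \<subseteq> Y n"
  shows "(\<Sum>x\<in>Z. (norm (L2_inner M F (\<lambda>g. complex_of_real (\<psi> n x g))) * m x) powr r) powr (1 / r)
    \<le> measure M (Q n) powr (1 - 1 / r) * Sup (w ` Q n) * Lpw_norm M r m F"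
proof -
  define G where "G z = m z * norm (F z)" for z
  define s where "s = Sup (w ` Q n)"
  define b where "b = measure M (Q n)"
  define N where "N = Lpw_norm M r m F"
  define c where "c x = L2_inner M F (\<lambda>g. complex_of_real (\<psi> n x g))" for x
  define t where "t = r / (r - 1)"
  have t: "1 < t" "1 / r + 1 / t = 1" "1 / t = 1 - 1 / r" using r by (auto simp: t_def field_simps)
  have s: "0 < s" unfolding s_def by (rule Sup_w_pos)
  have b: "0 < b" unfolding b_def by (rule measure_Q_pos)
  have N: "0 \<le> N" by (simp add: N_def Lpw_norm_nonneg)
  have [measurable]: "F \<in> borel_measurable M" by (rule in_Lpw_measurable(1)[OF F])
  have G[measurable]: "G \<in> borel_measurable M" unfolding G_def by measurable
  have G0: "0 \<le> G z" for z by (simp add: G_def m_nonneg)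
  have intG: "(\<integral>\<^sup>+z. ennreal (G z powr r) \<partial>M) = ennreal (N powr r)"
    unfolding G_def N_def using r by (intro nn_integral_Lpw_norm F m_nonneg) auto
  define J where "J x = (\<integral>\<^sup>+z. ennreal (G z powr r * \<psi> n x z) \<partial>M)" for x
  have sumJ: "(\<Sum>x\<in>Z. J x) \<le> ennreal (N powr r)"
  proof -
    have "(\<Sum>x\<in>Z. J x) = (\<integral>\<^sup>+z. (\<Sum>x\<in>Z. ennreal (G z powr r * \<psi> n x z)) \<partial>M)"
      unfolding J_def
    proof (rule nn_integral_sum[symmetric])
      fix x assume "x \<in> Z"
      then have [measurable]: "\<psi> n x \<in> borel_measurable M" using Z by (intro psi_measurable) auto
      show "(\<lambda>z. ennreal (G z powr r * \<psi> n x z)) \<in> borel_measurable M" by measurable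
    qed
    also have "\<dots> \<le> (\<integral>\<^sup>+z. ennreal (G z powr r) \<partial>M)"
    proof (intro nn_integral_mono)
      fix z
      have "(\<Sum>x\<in>Z. ennreal (G z powr r * \<psi> n x z)) = ennreal (G z powr r * (\<Sum>x\<in>Z. \<psi> n x z))"
        using Z psi_nonneg by (subst sum_ennreal) (auto simp: sum_distrib_left intro!: mult_nonneg_nonneg)
      also have "\<dots> \<le> ennreal (G z powr r * 1)"
        by (intro ennreal_leI mult_left_mono psi_sum_le_1 Z) auto
      finally show "(\<Sum>x\<in>Z. ennreal (G z powr r * \<psi> n x z)) \<le> ennreal (G z powr r)" by simp
    qed
    finally show ?thesis by (simp add: intG)
  qed
  have Jfin: "J x < \<infinity>" if "x \<in> Z" for x
  proof -
    have "J x \<le> (\<Sum>x\<in>Z. J x)" using that Z by (intro member_le_sum) auto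
    then show ?thesis using le_less_trans[OF order_trans[OF _ sumJ]] by simp
  qed
  define j where "j x = enn2real (J x)" for x
  have Jj: "J x = ennreal (j x)" if "x \<in> Z" for x using Jfin[OF that] by (simp add: j_def)
  have j0: "0 \<le> j x" for x by (simp add: j_def)
  have each: "(norm (c x) * m x) powr r \<le> s powr r * b powr (r - 1) * j x" if x: "x \<in> Z" for x
  proof -
    have xY: "x \<in> Y n" using x Z by auto
    note [measurable] = psi_measurable[OF xY]
    have "ennreal (norm (c x)) \<le> (\<integral>\<^sup>+z. ennreal (norm (F z) * \<psi> n x z) \<partial>M)"
    \<comment> \<open>Without integrability the Bochner integral has the default value 0 and the
      bound is trivial.\<close>
    proof (cases "integrable M (\<lambda>z. F z * cnj (complex_of_real (\<psi> n x z)))")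
      case True
      then show ?thesis using integral_norm_bound_ennreal[OF True] psi_nonneg[OF xY]
        by (simp add: c_def L2_inner_def norm_mult)
    next
      case False
      then show ?thesis unfolding c_def L2_inner_def by (subst not_integrable_integral_eq) auto
    qed
    then have "ennreal (norm (c x) * m x) \<le> (\<integral>\<^sup>+z. ennreal (norm (F z) * \<psi> n x z) \<partial>M) * ennreal (m x)"
      by (simp add: ennreal_mult m_nonneg mult_right_mono)
    also have "\<dots> = (\<integral>\<^sup>+z. ennreal (norm (F z) * \<psi> n x z) * ennreal (m x) \<partial>M)"
      by (rule nn_integral_multc[symmetric]) measurable
    also have "\<dots> \<le> (\<integral>\<^sup>+z. ennreal s * ennreal (G z * \<psi> n x z) \<partial>M)"
    proof (rule nn_integral_mono)
      fix z
      have "norm (F z) * \<psi> n x z * m x \<le> s * (G z * \<psi> n x z)"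
      proof (cases "\<psi> n x z = 0")
        case False
        then have "m x \<le> m z * s" unfolding s_def by (intro m_le_Sup psi_support[OF xY])
        then have "(norm (F z) * \<psi> n x z) * m x \<le> (norm (F z) * \<psi> n x z) * (m z * s)"
          using psi_nonneg[OF xY] by (intro mult_left_mono) auto
        then show ?thesis by (simp add: G_def mult_ac)
      qed simp
      then show "ennreal (norm (F z) * \<psi> n x z) * ennreal (m x) \<le> ennreal s * ennreal (G z * \<psi> n x z)"
        using s psi_nonneg[OF xY] G0 m_nonneg by (simp add: ennreal_mult[symmetric] ennreal_leI)
    qed
    also have "\<dots> = ennreal s * (\<integral>\<^sup>+z. ennreal (G z * \<psi> n x z) \<partial>M)"
      by (rule nn_integral_cmult) measurable
    also have "(\<integral>\<^sup>+z. ennreal (G z * \<psi> n x z) \<partial>M)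
        = (\<integral>\<^sup>+z. ennreal ((G z * \<psi> n x z powr (1 / r)) * \<psi> n x z powr (1 / t)) \<partial>M)"
    proof (rule nn_integral_cong)
      fix z
      have "\<psi> n x z powr (1 / r) * \<psi> n x z powr (1 / t) = \<psi> n x z"
        unfolding powr_add[symmetric] t(2) using psi_nonneg[OF xY] by simp
      then show "ennreal (G z * \<psi> n x z) = ennreal ((G z * \<psi> n x z powr (1 / r)) * \<psi> n x z powr (1 / t))"
        by (simp add: mult.assoc)
    qed
    also have "\<dots> \<le> ennreal (j x powr (1 / r) * b powr (1 / t))"
    proof (rule nn_integral_Holder[OF _ _ _ _ r t(2)])
      have "(\<integral>\<^sup>+z. ennreal ((G z * \<psi> n x z powr (1 / r)) powr r) \<partial>M) = J x"
        unfolding J_def using r psi_nonneg[OF xY] by (intro nn_integral_cong) (simp add: powr_mult powr_powr)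
      then show "(\<integral>\<^sup>+z. ennreal ((G z * \<psi> n x z powr (1 / r)) powr r) \<partial>M) \<le> ennreal ((j x powr (1 / r)) powr r)"
        using r Jj[OF x] j0 by (simp add: powr_powr)
      have "(\<integral>\<^sup>+z. ennreal ((\<psi> n x z powr (1 / t)) powr t) \<partial>M) \<le> (\<integral>\<^sup>+z. indicator ((+) x ` Q n) z \<partial>M)"
      proof (rule nn_integral_mono)
        fix z
        show "ennreal ((\<psi> n x z powr (1 / t)) powr t) \<le> indicator ((+) x ` Q n) z"
          using t(1) psi_support[OF xY, of z] psi_le_1[OF xY, of z] psi_nonneg[OF xY, of z]
          by (cases "\<psi> n x z = 0") (auto simp: powr_powr)
      qed
      also have "\<dots> = ennreal b" using compact_sets[OF translate_compact] by (simp add: emeasure_translate b_def)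
      finally show "(\<integral>\<^sup>+z. ennreal ((\<psi> n x z powr (1 / t)) powr t) \<partial>M) \<le> ennreal ((b powr (1 / t)) powr t)"
        using t(1) b by (simp add: powr_powr)
    qed (use G0 j0 b in auto)
    finally have "ennreal (norm (c x) * m x) \<le> ennreal (s * (j x powr (1 / r) * b powr (1 / t)))"
      using s by (simp add: ennreal_mult mult_left_mono)
    then have "norm (c x) * m x \<le> s * (j x powr (1 / r) * b powr (1 / t))"
      using s by (subst (asm) ennreal_le_iff) auto
    then have "(norm (c x) * m x) powr r \<le> (s * (j x powr (1 / r) * b powr (1 / t))) powr r"
      using r m_nonneg by (intro powr_mono2) auto
    also have "\<dots> = s powr r * b powr (r - 1) * j x"
      using r j0 b s unfolding t(3) by (simp add: powr_mult powr_powr algebra_simps)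
    finally show ?thesis .
  qed
  have "(\<Sum>x\<in>Z. j x) \<le> N powr r"
  proof -
    have "(\<Sum>x\<in>Z. J x) = (\<Sum>x\<in>Z. ennreal (j x))" by (rule sum.cong[OF refl Jj])
    also have "\<dots> = ennreal (\<Sum>x\<in>Z. j x)" by (rule sum_ennreal) (rule j0)
    finally show ?thesis using sumJ by simp
  qed
  then have "(\<Sum>x\<in>Z. (norm (c x) * m x) powr r) \<le> s powr r * b powr (r - 1) * N powr r"
    by (intro order_trans[OF sum_mono[OF each]]) (simp_all add: sum_distrib_left[symmetric] mult_left_mono)
  then have "(\<Sum>x\<in>Z. (norm (c x) * m x) powr r) powr (1 / r) \<le> (s powr r * b powr (r - 1) * N powr r) powr (1 / r)"
    using r by (intro powr_mono2) (auto intro: sum_nonneg)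
  also have "\<dots> = b powr (1 - 1 / r) * s * N"
    using r s b N by (simp add: powr_mult powr_powr diff_divide_distrib)
  finally show ?thesis by (simp add: c_def b_def s_def N_def)
qed

lemma psi_in_Lpw:
  assumes x: "x \<in> Y n" and v: "moderate w v" and s: "0 < s"
  shows "in_Lpw M s v (\<lambda>g. complex_of_real (\<psi> n x g))"
proof (rule in_Lpw_bounded_compact_support[OF translate_compact[of x n]])
  show "(\<lambda>g. complex_of_real (\<psi> n x g)) \<in> borel_measurable M" using psi_measurable[OF x] by measurable
  show "norm (complex_of_real (\<psi> n x g)) \<le> 1" for g using psi_nonneg[OF x] psi_le_1[OF x] by simp
  show "complex_of_real (\<psi> n x g) = 0" if "g \<notin> (+) x ` Q n" for g using psi_support[OF x] that by auto
qed (use v s in \<open>auto simp: moderate_def less_imp_le\<close>)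

text \<open>Functions biorthogonal to the \<psi> allow the coefficients of \<open>Tn\<close> to be
  prescribed freely. Hence the range is the full span, whether or not the translates of
  \<open>K\<close> are independent.\<close>

lemma Tn_range: "Tn M \<psi> X K n ` {F. in_Lpw M r m F} = K_span (X n)"
proof (rule set_eqI, rule iffI)
  fix f assume "f \<in> Tn M \<psi> X K n ` {F. in_Lpw M r m F}"
  then show "f \<in> K_span (X n)" unfolding Tn_def K_span_def by auto
next
  fix f assume "f \<in> K_span (X n)"
  then obtain c where c: "f = (\<lambda>y. \<Sum>x\<in>X n. c x * ltrans x K y)" by (auto simp: K_span_def)
  define t where "t = r / (r - 1)"
  have t: "1 < t" "1 / r + 1 / t = 1" using r by (auto simp: t_def field_simps)
  note mi = moderate_inverse[OF w m]
  let ?g = "\<lambda>x g. complex_of_real (\<psi> n x g)"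
  have g1: "in_Lpw M t (\<lambda>y. 1 / m y) (?g x)" if "x \<in> X n" for x
    using that X_Y t by (intro psi_in_Lpw mi) auto
  have g2: "in_Lpw M r m (?g x)" if "x \<in> X n" for x
    using that X_Y r by (intro psi_in_Lpw m) auto
  have "\<exists>e. \<forall>x\<in>X n. in_Lpw M r m (e x) \<and> (\<forall>y\<in>X n. (\<integral>z. e x z * ?g y z \<partial>M) = (if x = y then 1 else 0))"
    by (rule Lpw_dual_system[OF X_finite g1 g2 m_pos r t(2) psi_indep[OF X_finite X_Y]])
  then obtain e where e: "\<And>x. x \<in> X n \<Longrightarrow> in_Lpw M r m (e x)"
    "\<And>x y. x \<in> X n \<Longrightarrow> y \<in> X n \<Longrightarrow> (\<integral>z. e x z * ?g y z \<partial>M) = (if x = y then 1 else 0)" by metis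
  define F where "F = (\<lambda>z. \<Sum>x\<in>X n. c x * e x z)"
  have F: "in_Lpw M r m F" unfolding F_def using r by (intro in_Lpw_sum in_Lpw_cmult e m_nonneg) auto
  have "L2_inner M F (?g y) = c y" if y: "y \<in> X n" for y
  proof -
    have "L2_inner M F (?g y) = (\<integral>z. (\<Sum>x\<in>X n. c x * (e x z * ?g y z)) \<partial>M)"
      by (simp add: L2_inner_def F_def sum_distrib_left mult_ac)
    also have "\<dots> = (\<Sum>x\<in>X n. \<integral>z. c x * (e x z * ?g y z) \<partial>M)"
      by (intro Bochner_Integration.integral_sum integrable_mult_right
        Lpw_pairing_integrable[OF e(1) g1[OF y] m_pos r t(2)])
    also have "\<dots> = (\<Sum>x\<in>X n. if x = y then c x else 0)"
      by (intro sum.cong refl) (simp add: integral_mult_right_zero e(2)[OF _ y])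
    also have "\<dots> = c y" using y X_finite by simp
    finally show ?thesis .
  qed
  then have "Tn M \<psi> X K n F = f" unfolding Tn_def c by auto
  then show "f \<in> Tn M \<psi> X K n ` {F. in_Lpw M r m F}" using F by auto
qed

lemma X_mono: "i \<le> j \<Longrightarrow> X i \<subseteq> X j"
  by (rule lift_Suc_mono_le[of X, OF X_Suc])

lemma K_span_mono: "i \<le> j \<Longrightarrow> f \<in> K_span (X i) \<Longrightarrow> f \<in> K_span (X j)"
  using X_mono[of i j] by (auto simp: K_span_def[of "X i"] intro!: K_span_lincomb[OF X_finite, where g="\<lambda>x. x"])

text \<open>Half of \<delta> pays for arbitrary centres, the other half for moving them into the
  dense union of the sets \<open>X n\<close>. These sets are nested, so one \<open>n\<close> serves
  all the finitely many centres.\<close>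

lemma approx_by_X:
  assumes dense: "\<exists>F (c :: 'g \<Rightarrow> complex). finite F \<and> Lpw_norm M r m (\<lambda>y. f y - (\<Sum>x\<in>F. c x * ltrans x K y)) < \<delta> / 2"
    and f: "in_Lpw M r m f" and \<delta>: "0 < \<delta>"
  shows "\<exists>n. \<exists>h\<in>K_span (X n). Lpw_norm M r m (\<lambda>y. f y - h y) \<le> \<delta>"
proof -
  obtain F and c :: "'g \<Rightarrow> complex" where F: "finite F"
    and Fc: "Lpw_norm M r m (\<lambda>y. f y - (\<Sum>x\<in>F. c x * ltrans x K y)) < \<delta> / 2" using dense by blast
  \<comment> \<open>Each of the \<open>card F\<close> terms may cost \<delta> divided by 2 (card F +
    1); the added ones avoid zero denominators.\<close>
  define \<eta> where "\<eta> x = \<delta> / (2 * (card F + 1) * (norm (c x) + 1))" for x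
  have \<eta>: "\<eta> x > 0" for x unfolding \<eta>_def using \<delta> by (intro divide_pos_pos mult_pos_pos) (auto simp: add_nonneg_pos)
  have "\<exists>n x'. x' \<in> X n \<and> Lpw_norm M r m (\<lambda>z. ltrans x' K z - ltrans x K z) < \<eta> x" for x
  proof -
    obtain U where U: "open U" "x \<in> U" "\<And>y. y \<in> U \<Longrightarrow> Lpw_norm M r m (\<lambda>z. ltrans y K z - ltrans x K z) < \<eta> x"
      using Lpw_ltrans_nhds[OF w m K_in_Lpw[OF r] _ K_continuous \<eta>[of x], of x] r by auto
    have "x \<in> closure (\<Union>n. X n)" using X_dense by simp
    then have "U \<inter> (\<Union>n. X n) \<noteq> {}" using U(1,2) open_Int_closure_eq_empty by blast
    then show ?thesis using U(3) by blast
  qed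
  then obtain k and x' where x': "\<And>x. x' x \<in> X (k x)"
    "\<And>x. Lpw_norm M r m (\<lambda>z. ltrans (x' x) K z - ltrans x K z) < \<eta> x" by metis
  define n where "n = Max (insert 0 (k ` F))"
  have x'n: "x' x \<in> X n" if "x \<in> F" for x
    using x'(1)[of x] X_mono[of "k x" n] that F by (auto simp: n_def)
  define h where "h = (\<lambda>y. \<Sum>x\<in>F. c x * ltrans (x' x) K y)"
  have h: "h \<in> K_span (X n)" unfolding h_def by (intro K_span_lincomb X_finite x'n)
  have i: "in_Lpw M r m (\<lambda>z. ltrans x K z - ltrans (x' x) K z)" for x
    using r by (intro in_Lpw_diff ltrans_K_in_Lpw m m_nonneg) auto
  have l: "in_Lpw M r m (\<lambda>y. \<Sum>x\<in>F. c x * ltrans x K y)" by (rule lincomb_in_Lpw[OF m r])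
  have "Lpw_norm M r m (\<lambda>y. f y - h y)
    = Lpw_norm M r m (\<lambda>y. (f y - (\<Sum>x\<in>F. c x * ltrans x K y)) + (\<Sum>x\<in>F. c x * (ltrans x K y - ltrans (x' x) K y)))"
    by (simp add: h_def right_diff_distrib sum_subtractf)
  also have "\<dots> \<le> Lpw_norm M r m (\<lambda>y. f y - (\<Sum>x\<in>F. c x * ltrans x K y)) + Lpw_norm M r m (\<lambda>y. \<Sum>x\<in>F. c x * (ltrans x K y - ltrans (x' x) K y))"
    using r by (intro Lpw_norm_triangle in_Lpw_diff[OF f l] in_Lpw_sum in_Lpw_cmult i m_nonneg) auto
  also have "Lpw_norm M r m (\<lambda>y. \<Sum>x\<in>F. c x * (ltrans x K y - ltrans (x' x) K y))
      \<le> (\<Sum>x\<in>F. Lpw_norm M r m (\<lambda>y. c x * (ltrans x K y - ltrans (x' x) K y)))"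
    using r by (intro Lpw_norm_sum in_Lpw_cmult i m_nonneg) auto
  also have "\<dots> \<le> (\<Sum>x\<in>F. \<delta> / (2 * (card F + 1)))"
  proof (intro sum_mono)
    fix x
    have "Lpw_norm M r m (\<lambda>y. c x * (ltrans x K y - ltrans (x' x) K y)) = norm (c x) * Lpw_norm M r m (\<lambda>z. ltrans (x' x) K z - ltrans x K z)"
      using r Lpw_norm_cmult[of r M m "c x" "\<lambda>y. ltrans x K y - ltrans (x' x) K y"]
      by (simp add: Lpw_norm_minus_commute[of M r m "ltrans x K"])
    also have "\<dots> \<le> (norm (c x) + 1) * \<eta> x"
      using x'(2)[of x] by (intro mult_mono) (auto simp: Lpw_norm_nonneg)
    also have "\<dots> = \<delta> / (2 * (card F + 1))"
    proof -
      have "norm (c x) + 1 \<noteq> 0" by (smt (verit) norm_ge_zero)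
      then show ?thesis by (simp add: \<eta>_def)
    qed
    finally show "Lpw_norm M r m (\<lambda>y. c x * (ltrans x K y - ltrans (x' x) K y)) \<le> \<delta> / (2 * (card F + 1))" .
  qed
  also have "\<dots> \<le> \<delta> / 2" using \<delta> by (simp add: field_simps)
  finally have "Lpw_norm M r m (\<lambda>y. f y - h y) \<le> \<delta>" using Fc by simp
  then show ?thesis using h by blast
qed

theorem sparse_approximation:
  assumes dense: "\<forall>f \<in> Mspace M r m K. \<forall>\<epsilon>>0. \<exists>F (c :: 'g \<Rightarrow> complex). finite F \<and>
                  Lpw_norm M r m (\<lambda>y. f y - (\<Sum>x\<in>F. c x * ltrans x K y)) < \<epsilon>"
    and S: "\<forall>n. right_inverse_on M r m (Tn M \<psi> X K n) (S n)"
    and T: "T \<in> Co M w sc ip \<pi> u r m" and \<epsilon>: "0 < \<epsilon>"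
  shows "\<exists>n0. \<forall>n\<ge>n0. \<exists>c :: 'g \<Rightarrow> complex.
        Co_norm M \<pi> u r m (\<lambda>s. T s - emb ip (\<Sum>x\<in>X n. sc (c x) (\<pi> x u)) s) \<le> \<epsilon> \<and>
        (\<Sum>x\<in>X n. (norm (c x) * m x) powr r) powr (1 / r)
          \<le> (measure M (Q n) powr (1 - 1 / r) * Sup (w ` Q n) *
              op_norm_on M r m (Tn M \<psi> X K n ` {F. in_Lpw M r m F}) (S n))
             * (1 + \<epsilon>) * Co_norm M \<pi> u r m T"
proof -
  define f where "f = ext_voice \<pi> u T"
  have fM: "f \<in> Mspace M r m K" unfolding f_def by (rule Co_imp_Mspace[OF T m r])
  then have f: "in_Lpw M r m f" by (simp add: Mspace_def)
  have CT: "Co_norm M \<pi> u r m T = Lpw_norm M r m f" by (simp add: Co_norm_def f_def)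
  have Cdiff: "Co_norm M \<pi> u r m (\<lambda>s. T s - emb ip (\<Sum>x\<in>X n. sc (c x) (\<pi> x u)) s)
      = Lpw_norm M r m (\<lambda>y. f y - (\<Sum>x\<in>X n. c x * ltrans x K y))" for n c
    unfolding Co_norm_def
    by (simp add: ext_voice_def[abs_def] f_def emb_def ip_sum_left ip_sc_left ip_rep_rep ltrans_def)
  show ?thesis
  \<comment> \<open>For norm 0 the tolerance chosen below would be 0; zero coefficients do
    instead.\<close>
  proof (cases "Lpw_norm M r m f = 0")
    case True
    show ?thesis
      by (rule exI[of _ 0], intro allI impI, rule exI[of _ "\<lambda>_. 0"]) (use True \<epsilon> in \<open>simp add: Cdiff CT\<close>)
  next
    case False
    then have pos: "0 < Lpw_norm M r m f" using Lpw_norm_nonneg[of M r m f] by linarith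
    \<comment> \<open>The first entry is the required error, the second bounds the norm of
      \<open>h\<close> by (1 + \<epsilon>) times that of \<open>f\<close>.\<close>
    define \<delta> where "\<delta> = min \<epsilon> (\<epsilon> * Lpw_norm M r m f)"
    have \<delta>: "0 < \<delta>" using \<epsilon> pos by (simp add: \<delta>_def)
    obtain n0 h where h: "h \<in> K_span (X n0)" "Lpw_norm M r m (\<lambda>y. f y - h y) \<le> \<delta>"
      using approx_by_X[OF _ f \<delta>] dense fM \<delta> by (meson half_gt_zero)
    have hL: "in_Lpw M r m h" by (rule K_span_in_Lpw[OF m r h(1)])
    have hn: "Lpw_norm M r m h \<le> (1 + \<epsilon>) * Lpw_norm M r m f"
    proof -
      have "Lpw_norm M r m h = Lpw_norm M r m (\<lambda>y. f y - (f y - h y))" by simp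
      also have "\<dots> \<le> Lpw_norm M r m f + Lpw_norm M r m (\<lambda>y. f y - h y)"
        using r by (intro Lpw_norm_diff_triangle f in_Lpw_diff[OF f hL] m_nonneg) auto
      also have "\<dots> \<le> Lpw_norm M r m f + \<epsilon> * Lpw_norm M r m f" using h(2) by (simp add: \<delta>_def)
      finally show ?thesis by (simp add: algebra_simps)
    qed
    show ?thesis
    proof (intro exI[of _ n0] allI impI)
      fix n assume n: "n0 \<le> n"
      \<comment> \<open>The same \<open>h\<close> serves every later \<open>n\<close>, since the
        spans increase; its coefficients change with \<open>n\<close> through
        \<open>S n\<close>.\<close>
      have hX: "h \<in> K_span (X n)" by (rule K_span_mono[OF n h(1)])
      have Sn: "\<And>f. f \<in> K_span (X n) \<Longrightarrow> in_Lpw M r m (S n f)"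
        "\<And>f. f \<in> K_span (X n) \<Longrightarrow> Tn M \<psi> X K n (S n f) = f"
        "\<And>f g a b. f \<in> K_span (X n) \<Longrightarrow> g \<in> K_span (X n) \<Longrightarrow> S n (\<lambda>x. a * f x + b * g x) = (\<lambda>x. a * S n f x + b * S n g x)"
        using S[rule_format, of n] unfolding right_inverse_on_def Let_def Tn_range by blast+
      define c where "c x = L2_inner M (S n h) (\<lambda>g. complex_of_real (\<psi> n x g))" for x
      have hc: "h = (\<lambda>y. \<Sum>x\<in>X n. c x * ltrans x K y)"
        using Sn(2)[OF hX] unfolding Tn_def c_def by simp
      let ?op = "op_norm_on M r m (K_span (X n)) (S n)"
      have op: "Lpw_norm M r m (S n h) \<le> ?op * Lpw_norm M r m h" "0 \<le> ?op"
        by (rule op_norm_bound[OF m r X_finite Sn(1,3) hX]; assumption)+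
      show "\<exists>c. Co_norm M \<pi> u r m (\<lambda>s. T s - emb ip (\<Sum>x\<in>X n. sc (c x) (\<pi> x u)) s) \<le> \<epsilon> \<and>
        (\<Sum>x\<in>X n. (norm (c x) * m x) powr r) powr (1 / r)
          \<le> (measure M (Q n) powr (1 - 1 / r) * Sup (w ` Q n) * op_norm_on M r m (Tn M \<psi> X K n ` {F. in_Lpw M r m F}) (S n))
             * (1 + \<epsilon>) * Co_norm M \<pi> u r m T"
      proof (intro exI[of _ c] conjI)
        show "Co_norm M \<pi> u r m (\<lambda>s. T s - emb ip (\<Sum>x\<in>X n. sc (c x) (\<pi> x u)) s) \<le> \<epsilon>"
          using h(2) unfolding Cdiff hc[symmetric] by (simp add: \<delta>_def fun_cong[OF hc, symmetric])
        let ?D = "measure M (Q n) powr (1 - 1 / r) * Sup (w ` Q n)"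
        have D: "0 \<le> ?D" using Sup_w_pos[of n] by simp
        have "(\<Sum>x\<in>X n. (norm (c x) * m x) powr r) powr (1 / r) \<le> ?D * Lpw_norm M r m (S n h)"
          unfolding c_def by (rule coefficient_bound[OF Sn(1)[OF hX] X_finite X_Y])
        also have "\<dots> \<le> ?D * (?op * Lpw_norm M r m h)" by (intro mult_left_mono op D)
        also have "\<dots> \<le> ?D * (?op * ((1 + \<epsilon>) * Lpw_norm M r m f))" by (intro mult_left_mono hn op D)
        finally show "(\<Sum>x\<in>X n. (norm (c x) * m x) powr r) powr (1 / r)
          \<le> (?D * op_norm_on M r m (Tn M \<psi> X K n ` {F. in_Lpw M r m F}) (S n)) * (1 + \<epsilon>) * Co_norm M \<pi> u r m T"
          unfolding Tn_range CT by (simp add: mult.assoc)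
      qed
    qed
  qed
qed

end

section \<open>Synthesis\<close>

text \<open>Hoelder for the counting measure on \<open>A\<close> against the constant 1. With
  \<open>k\<close> the overlap number this is the source of I^(1-1/q).\<close>

lemma power_mean_le:
  fixes e :: "'a \<Rightarrow> real"
  assumes "finite A" "card A \<le> k" "1 < q" "\<And>x. 0 \<le> e x"
  shows "(\<Sum>x\<in>A. e x) powr q \<le> real k powr (q - 1) * (\<Sum>x\<in>A. e x powr q)"
proof -
  define t where "t = q / (q - 1)"
  have t: "1 < t" "1 / q + 1 / t = 1" "1 / t = 1 - 1 / q" using assms(3) by (auto simp: t_def field_simps)
  define S where "S = (\<Sum>x\<in>A. e x powr q)"
  have S: "0 \<le> S" unfolding S_def by (rule sum_nonneg) simp
  have "(\<integral>\<^sup>+x. ennreal (e x * 1) \<partial>count_space A) \<le> ennreal (S powr (1 / q) * real k powr (1 / t))"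
  proof (rule nn_integral_Holder[OF _ _ _ _ assms(3) t(2)])
    show "(\<integral>\<^sup>+x. ennreal (e x powr q) \<partial>count_space A) \<le> ennreal ((S powr (1 / q)) powr q)"
      using assms S by (simp add: nn_integral_count_space_finite sum_ennreal powr_powr S_def)
    show "(\<integral>\<^sup>+x. ennreal (1 powr t) \<partial>count_space A) \<le> ennreal ((real k powr (1 / t)) powr t)"
      using assms t(1) by (simp add: nn_integral_count_space_finite powr_powr ennreal_of_nat_eq_real_of_nat)
  qed (use assms in auto)
  then have "ennreal (\<Sum>x\<in>A. e x) \<le> ennreal (S powr (1 / q) * real k powr (1 / t))"
    using assms by (simp add: nn_integral_count_space_finite sum_ennreal)
  then have "(\<Sum>x\<in>A. e x) \<le> S powr (1 / q) * real k powr (1 / t)"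
    by (subst (asm) ennreal_le_iff) auto
  then have "(\<Sum>x\<in>A. e x) powr q \<le> (S powr (1 / q) * real k powr (1 / t)) powr q"
    using assms by (intro powr_mono2 sum_nonneg) auto
  also have "\<dots> = real k powr (q - 1) * S"
    using assms(3) S unfolding t(3) by (simp add: powr_mult powr_powr algebra_simps)
  finally show ?thesis by (simp add: S_def)
qed

lemma measurable_swap_count_space:
  assumes "countable A" "\<And>x. x \<in> A \<Longrightarrow> f x \<in> measurable N L"
  shows "(\<lambda>(y, x). f x y) \<in> measurable (N \<Otimes>\<^sub>M count_space A) L"
  using assms by (subst measurable_pair_swap_iff) (auto intro!: measurable_pair_measure_countable1)

lemma nn_integral_count_space_measurable:
  assumes "countable A" "\<And>x. x \<in> A \<Longrightarrow> f x \<in> borel_measurable N"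
  shows "(\<lambda>y. \<integral>\<^sup>+x. f x y \<partial>count_space A) \<in> borel_measurable N"
proof -
  interpret sigma_finite_measure "count_space A"
    by (rule sigma_finite_measure_count_space_countable[OF assms(1)])
  show ?thesis
    by (rule borel_measurable_nn_integral) (rule measurable_swap_count_space[OF assms])
qed

lemma integral_count_space_measurable:
  fixes f :: "'a \<Rightarrow> 'b \<Rightarrow> complex"
  assumes "countable A" "\<And>x. x \<in> A \<Longrightarrow> f x \<in> borel_measurable N"
  shows "(\<lambda>y. \<integral>x. f x y \<partial>count_space A) \<in> borel_measurable N"
proof -
  interpret sigma_finite_measure "count_space A"
    by (rule sigma_finite_measure_count_space_countable[OF assms(1)])
  show ?thesis
    by (rule borel_measurable_lebesgue_integral) (rule measurable_swap_count_space[OF assms])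
qed

text \<open>The hypothesis on the coefficients speaks of unordered sums, the estimates of counting
  measure, where Fubini applies.\<close>

lemma nn_integral_count_space_eq_infsum:
  fixes \<phi> :: "'a \<Rightarrow> real"
  assumes "\<phi> summable_on A" "\<And>x. 0 \<le> \<phi> x"
  shows "(\<integral>\<^sup>+x. ennreal (\<phi> x) \<partial>count_space A) = ennreal (infsum \<phi> A)"
proof -
  have "Infinite_Sum.abs_summable_on \<phi> A" using assms(1) summable_on_iff_abs_summable_on_real by blast
  then have a: "Infinite_Set_Sum.abs_summable_on \<phi> A" by (simp only: abs_summable_equivalent)
  then have "(\<integral>\<^sup>+x. ennreal (\<phi> x) \<partial>count_space A) = ennreal (\<integral>x. \<phi> x \<partial>count_space A)"
    using assms(2) by (intro nn_integral_eq_integral) (auto simp: Infinite_Set_Sum.abs_summable_on_def)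
  then show ?thesis using infsetsum_infsum[OF a] by (simp add: infsetsum_def)
qed

lemma in_Lpw_norm:
  assumes f: "in_Lpw M p v f" and v: "\<And>x. 0 \<le> v x" and p: "0 < p"
  shows "in_Lpw M p v (\<lambda>x. complex_of_real (norm (f x)))"
proof (rule in_Lpw_mono[OF f v p])
  show "(\<lambda>x. complex_of_real (norm (f x))) \<in> borel_measurable M"
    using in_Lpw_measurable(1)[OF f] by measurable
  have "(\<lambda>x. complex_of_real (v x * norm (f x))) \<in> borel_measurable M"
    using in_Lpw_measurable_norm[OF f v] by measurable
  then show "(\<lambda>x. complex_of_real (v x) * complex_of_real (norm (f x))) \<in> borel_measurable M" by simp
qed simp

section \<open>Estimates for a fixed index n\<close>

locale synthesis = discretized M sc ip \<pi> u w Q Y X I \<psi> m r + modular_group M \<Delta>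
  for M :: "'g::{topological_group_add,t2_space,second_countable_topology} measure"
    and sc :: "complex \<Rightarrow> 'h::ab_group_add \<Rightarrow> 'h" and ip \<pi> u w Q Y X I \<psi> m r \<Delta> +
  fixes p q :: real and n :: nat
  assumes p: "1 \<le> p" "p < r" and q: "1 / q + 1 / p = 1 + 1 / r"
    and Kp: "in_Lpw M p w K" "in_Lpw M p (\<lambda>x. w x * \<Delta> x powr (- 1 / p)) K"
      "in_Lpw M p w (\<lambda>x. complex_of_real (osc (Q n) K x))"
      "in_Lpw M p (\<lambda>x. w x * \<Delta> x powr (- 1 / p)) (\<lambda>x. complex_of_real (osc (Q n) K x))"
begin

definition "g y = osc (Q n) K y + norm (K y)"
definition "\<theta> = max (Lpw_norm M p w (\<lambda>x. complex_of_real (g x)))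
    (Lpw_norm M p (\<lambda>x. w x * \<Delta> x powr (- 1 / p)) (\<lambda>x. complex_of_real (g x)))"

lemma q_gt_1: "1 < q"
proof -
  have "1 / r < 1 / p" "1 / p \<le> 1" "0 < 1 / r" using p r by (auto simp: frac_less2)
  then have "0 < 1 / q" "1 / q < 1" using q by linarith+
  then show ?thesis by (simp add: divide_less_eq_1)
qed

text \<open>\<open>K\<close> is bounded, so the supremum is taken over a bounded set of
  reals.\<close>

lemma osc_ge: "v \<in> Q n \<Longrightarrow> norm (K (v + x) - K x) \<le> osc (Q n) K x"
  unfolding osc_def
proof (rule cSUP_upper)
  have "norm (K (v + x) - K x) \<le> (hnorm ip u)\<^sup>2 + (hnorm ip u)\<^sup>2" for v
    by (intro order_trans[OF norm_triangle_ineq4] add_mono norm_K_le)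
  then show "bdd_above ((\<lambda>v. norm (K (v + x) - K x)) ` Q n)" by (intro bdd_aboveI2)
qed

lemma osc_nonneg: "0 \<le> osc (Q n) K x"
  using osc_ge[of 0 x] Q_zero interior_subset by fastforce

lemma g_nonneg: "0 \<le> g y"
  by (simp add: g_def osc_nonneg)

lemma K_le_g: "x \<in> Q n \<Longrightarrow> norm (K (x + a)) \<le> g a"
  using osc_ge[of x a] norm_triangle_sub[of "K (x + a)" "K a"] by (simp add: g_def)

lemma g_measurable [measurable]: "g \<in> borel_measurable M"
proof -
  have "(\<lambda>x. Re (complex_of_real (osc (Q n) K x))) \<in> borel_measurable M"
    by (rule measurable_compose[OF in_Lpw_measurable(1)[OF Kp(3)]]) measurable
  then show ?thesis unfolding g_def[abs_def] by simp
qed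

lemma \<Delta>_weight_nonneg: "0 \<le> w x * \<Delta> x powr (- 1 / p)"
  by (simp add: w_nonneg)

lemma g_in_Lpw: "in_Lpw M p w (\<lambda>x. complex_of_real (g x))"
  "in_Lpw M p (\<lambda>x. w x * \<Delta> x powr (- 1 / p)) (\<lambda>x. complex_of_real (g x))"
proof -
  have p0: "0 < p" using p by simp
  show "in_Lpw M p w (\<lambda>x. complex_of_real (g x))"
    unfolding g_def of_real_add
    by (rule in_Lpw_add[OF Kp(3) in_Lpw_norm[OF Kp(1) w_nonneg p0] w_nonneg p(1)])
  show "in_Lpw M p (\<lambda>x. w x * \<Delta> x powr (- 1 / p)) (\<lambda>x. complex_of_real (g x))"
    unfolding g_def of_real_add
    by (rule in_Lpw_add[OF Kp(4) in_Lpw_norm[OF Kp(2) \<Delta>_weight_nonneg p0] \<Delta>_weight_nonneg p(1)])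
qed

lemma \<theta>_nonneg: "0 \<le> \<theta>"
  by (simp add: \<theta>_def Lpw_norm_nonneg max_def)

text \<open>The two bounds that Young's inequality asks of its second factor. Inversion produces the
  density 1/\<Delta>, the p-th power of the extra factor in the second weight.\<close>

lemma g_norm:
  "(\<integral>\<^sup>+y. ennreal ((w y * g y) powr p) \<partial>M) \<le> ennreal (\<theta> powr p)"
  "(\<integral>\<^sup>+y. ennreal ((w (- y) * g (- y)) powr p) \<partial>M) \<le> ennreal (\<theta> powr p)"
proof -
  have p0: "0 < p" using p by simp
  have "(\<integral>\<^sup>+y. ennreal ((w y * g y) powr p) \<partial>M) = ennreal (Lpw_norm M p w (\<lambda>x. complex_of_real (g x)) powr p)"
    using nn_integral_Lpw_norm[OF g_in_Lpw(1) p0 w_nonneg] by (simp add: g_nonneg)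
  also have "\<dots> \<le> ennreal (\<theta> powr p)"
    using p0 by (intro ennreal_leI powr_mono2) (auto simp: \<theta>_def Lpw_norm_nonneg)
  finally show "(\<integral>\<^sup>+y. ennreal ((w y * g y) powr p) \<partial>M) \<le> ennreal (\<theta> powr p)" .
  have "(\<integral>\<^sup>+y. ennreal ((w (- y) * g (- y)) powr p) \<partial>M) = (\<integral>\<^sup>+y. ennreal ((w y * g y) powr p) * ennreal (1 / \<Delta> y) \<partial>M)"
    by (rule nn_integral_inverse[where f="\<lambda>y. ennreal ((w y * g y) powr p)"]) measurable
  also have "\<dots> = (\<integral>\<^sup>+y. ennreal ((w y * \<Delta> y powr (- 1 / p) * norm (complex_of_real (g y))) powr p) \<partial>M)"
  proof (rule nn_integral_cong)
    fix y
    have "(\<Delta> y powr (- 1 / p)) powr p = 1 / \<Delta> y"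
    proof -
      have "- 1 / p * p = - 1" using p0 by simp
      then have "(\<Delta> y powr (- 1 / p)) powr p = \<Delta> y powr (- 1)" unfolding powr_powr by simp
      then show ?thesis using modular_pos[of y] by (simp add: powr_minus_divide)
    qed
    then have "(w y * \<Delta> y powr (- 1 / p) * norm (complex_of_real (g y))) powr p = (w y * g y) powr p * (1 / \<Delta> y)"
      using g_nonneg[of y] by (simp add: powr_mult)
    then show "ennreal ((w y * g y) powr p) * ennreal (1 / \<Delta> y) = ennreal ((w y * \<Delta> y powr (- 1 / p) * norm (complex_of_real (g y))) powr p)"
      using modular_pos[of y] by (simp only: ennreal_mult[symmetric] powr_ge_zero less_imp_le divide_nonneg_pos zero_le_one)
  qed
  also have "\<dots> = ennreal (Lpw_norm M p (\<lambda>x. w x * \<Delta> x powr (- 1 / p)) (\<lambda>x. complex_of_real (g x)) powr p)"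
    by (rule nn_integral_Lpw_norm[OF g_in_Lpw(2) p0 \<Delta>_weight_nonneg])
  also have "\<dots> \<le> ennreal (\<theta> powr p)"
    using p0 by (intro ennreal_leI powr_mono2) (auto simp: \<theta>_def Lpw_norm_nonneg)
  finally show "(\<integral>\<^sup>+y. ennreal ((w (- y) * g (- y)) powr p) \<partial>M) \<le> ennreal (\<theta> powr p)" .
qed

definition "near y = {x \<in> Y n. y \<in> (+) x ` Q n}"

text \<open>Two members of \<open>near y\<close> in the same class of the packing have patches that
  meet at \<open>y\<close> and therefore coincide, so the choice of a class is injective.\<close>

lemma near_finite: "finite (near y)" and card_near: "card (near y) \<le> I"
proof -
  obtain Z where Z: "Y n = (\<Union>i\<in>{1..I}. Z n i)"
    "\<And>i x x'. i \<in> {1..I} \<Longrightarrow> x \<in> Z n i \<Longrightarrow> x' \<in> Z n i \<Longrightarrow>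
           ((+) x ` Q n) \<inter> ((+) x' ` Q n) \<noteq> {} \<Longrightarrow> x = x'"
    using packing by metis
  have "\<forall>x\<in>near y. \<exists>i\<in>{1..I}. x \<in> Z n i" using Z(1) by (auto simp: near_def)
  then obtain i where i: "\<And>x. x \<in> near y \<Longrightarrow> i x \<in> {1..I} \<and> x \<in> Z n (i x)" by metis
  have inj: "inj_on i (near y)"
  proof (rule inj_onI)
    fix x x' assume x: "x \<in> near y" "x' \<in> near y" "i x = i x'"
    then have "y \<in> ((+) x ` Q n) \<inter> ((+) x' ` Q n)" by (simp add: near_def)
    then show "x = x'" using Z(2)[of "i x" x x'] i[OF x(1)] i[OF x(2)] x(3) by auto
  qed
  have im: "i ` near y \<subseteq> {1..I}" using i by blast
  show "finite (near y)" using finite_imageD[OF finite_subset[OF im] inj] by simp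
  show "card (near y) \<le> I" using card_inj_on_le[OF inj im] by simp
qed

text \<open>Turns the finite sum, whose index set depends on \<open>y\<close>, into an integral with
  a fixed domain, open to measurability and Fubini.\<close>

lemma nn_integral_near:
  fixes e :: "'g \<Rightarrow> real"
  assumes e: "\<And>x. 0 \<le> e x"
  shows "(\<integral>\<^sup>+x. ennreal (e x) * indicator ((+) x ` Q n) y \<partial>count_space (Y n)) = ennreal (\<Sum>x\<in>near y. e x)"
proof -
  have "(\<integral>\<^sup>+x. ennreal (e x) * indicator ((+) x ` Q n) y \<partial>count_space (Y n))
      = (\<integral>\<^sup>+x. ennreal (e x) * indicator (near y) x \<partial>count_space (Y n))"
    by (intro nn_integral_cong) (auto simp: indicator_def near_def)
  also have "\<dots> = (\<integral>\<^sup>+x. ennreal (e x) * indicator (near y) x \<partial>count_space (near y))"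
    by (rule nn_integral_count_space_eq) (auto simp: near_def)
  also have "\<dots> = (\<integral>\<^sup>+x. ennreal (e x) \<partial>count_space (near y))"
    by (intro nn_integral_cong) simp
  also have "\<dots> = ennreal (\<Sum>x\<in>near y. e x)"
    using e near_finite by (simp add: nn_integral_count_space_finite sum_ennreal)
  finally show ?thesis .
qed

lemma translate_sets [measurable]: "(+) x ` Q n \<in> sets M" "(+) x ` Q n \<in> sets borel"
  using compact_sets[OF translate_compact[of x n]] by (auto simp: sets_M)

lemma near_sum_measurable:
  fixes e :: "'g \<Rightarrow> real"
  assumes e: "\<And>x. 0 \<le> e x"
  shows "(\<lambda>y. \<Sum>x\<in>near y. e x) \<in> borel_measurable M"
proof -
  have [measurable]: "(\<lambda>y. \<integral>\<^sup>+x. ennreal (e x) * indicator ((+) x ` Q n) y \<partial>count_space (Y n)) \<in> borel_measurable M"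
    by (rule nn_integral_count_space_measurable[OF Y_countable]) measurable
  have "(\<lambda>y. enn2real (\<integral>\<^sup>+x. ennreal (e x) * indicator ((+) x ` Q n) y \<partial>count_space (Y n))) \<in> borel_measurable M"
    by measurable
  then show ?thesis unfolding nn_integral_near[OF e] by (simp add: sum_nonneg e)
qed

text \<open>The constant D_n of the theorem without its factor \<theta>_n.\<close>

definition "Dn = measure M (Q n) powr (1 / q - 1) * real I powr (1 - 1 / q) * Sup (w ` Q n)"

lemma Dn_nonneg: "0 \<le> Dn"
  using Sup_w_pos[of n] by (simp add: Dn_def)

context
  fixes d :: "'g \<Rightarrow> complex" and N :: real
  assumes dN: "(\<integral>\<^sup>+x. ennreal ((m x * norm (d x)) powr q) \<partial>count_space (Y n)) \<le> ennreal (N powr q)" and N: "0 \<le> N"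
begin

text \<open>Extended-valued at first: finiteness is known almost everywhere from
  \<open>h_AE_finite\<close> and everywhere only from \<open>h_finite\<close>. The bound
  \<open>N\<close> need not be the norm itself, so that the same results also apply to tails of
  \<open>d\<close>.\<close>

definition "h z = (\<integral>\<^sup>+x. ennreal (norm (d x) * norm (K (- x + z))) \<partial>count_space (Y n))"
definition "D y = (\<Sum>x\<in>near y. norm (d x)) / measure M (Q n)"

lemma D_nonneg: "0 \<le> D y"
  by (simp add: D_def sum_nonneg)

lemma D_measurable [measurable]: "D \<in> borel_measurable M"
  using near_sum_measurable[of "\<lambda>x. norm (d x)"] unfolding D_def[abs_def] by simp

lemma h_measurable [measurable]: "h \<in> borel_measurable M"
  unfolding h_def[abs_def] by (rule nn_integral_count_space_measurable[OF Y_countable]) measurable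

text \<open>The average contributes b^(-q), the power mean I^(q-1), the comparison of weights on a
  patch s^q, and the integral over each patch one factor b. The q-th root of the product is
  \<open>Dn\<close>.\<close>

lemma D_norm: "(\<integral>\<^sup>+y. ennreal ((m y * D y) powr q) \<partial>M) \<le> ennreal ((Dn * N) powr q)"
proof -
  define b where "b = measure M (Q n)"
  define s where "s = Sup (w ` Q n)"
  have b: "0 < b" unfolding b_def by (rule measure_Q_pos)
  have s: "0 < s" unfolding s_def by (rule Sup_w_pos)
  have q1: "1 < q" by (rule q_gt_1)
  define C where "C = b powr (- q) * real I powr (q - 1) * s powr q"
  have C: "0 \<le> C" by (simp add: C_def)
  define e where "e x = (m x * norm (d x)) powr q" for x
  have e0: "0 \<le> e x" for x by (simp add: e_def)
  have pw: "(m y * D y) powr q \<le> C * (\<Sum>x\<in>near y. e x)" for y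
  proof -
    have "m y * D y = (\<Sum>x\<in>near y. m y * norm (d x)) / b" by (simp add: D_def b_def sum_distrib_left)
    also have "\<dots> \<le> (\<Sum>x\<in>near y. s * (m x * norm (d x))) / b"
    proof (intro divide_right_mono sum_mono)
      fix x assume "x \<in> near y"
      then have "m y \<le> m x * s" unfolding s_def by (intro m_le_Sup) (simp add: near_def)
      then have "m y * norm (d x) \<le> (m x * s) * norm (d x)" by (intro mult_right_mono) auto
      then show "m y * norm (d x) \<le> s * (m x * norm (d x))" by (simp add: mult_ac)
    qed (use b in simp)
    finally have "(m y * D y) powr q \<le> ((\<Sum>x\<in>near y. s * (m x * norm (d x))) / b) powr q"
      using q1 m_nonneg D_nonneg by (intro powr_mono2) auto
    also have "\<dots> = b powr (- q) * (\<Sum>x\<in>near y. s * (m x * norm (d x))) powr q"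
      using b s m_nonneg by (subst powr_divide) (auto intro!: sum_nonneg mult_nonneg_nonneg simp: powr_minus field_simps)
    also have "\<dots> \<le> b powr (- q) * (real I powr (q - 1) * (\<Sum>x\<in>near y. (s * (m x * norm (d x))) powr q))"
      using s m_nonneg q1 by (intro mult_left_mono power_mean_le near_finite card_near) auto
    also have "(\<Sum>x\<in>near y. (s * (m x * norm (d x))) powr q) = s powr q * (\<Sum>x\<in>near y. e x)"
      unfolding sum_distrib_left e_def by (intro sum.cong refl powr_mult)
    finally show ?thesis by (simp add: C_def mult_ac)
  qed
  have "(\<integral>\<^sup>+y. ennreal ((m y * D y) powr q) \<partial>M) \<le> (\<integral>\<^sup>+y. ennreal C * (\<integral>\<^sup>+x. ennreal (e x) * indicator ((+) x ` Q n) y \<partial>count_space (Y n)) \<partial>M)"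
    unfolding nn_integral_near[OF e0]
    using pw C e0 by (intro nn_integral_mono) (simp add: ennreal_mult[symmetric] sum_nonneg ennreal_leI)
  also have "\<dots> = ennreal C * (\<integral>\<^sup>+y. (\<integral>\<^sup>+x. ennreal (e x) * indicator ((+) x ` Q n) y \<partial>count_space (Y n)) \<partial>M)"
    by (rule nn_integral_cmult, rule nn_integral_count_space_measurable[OF Y_countable]) measurable
  also have "(\<integral>\<^sup>+y. (\<integral>\<^sup>+x. ennreal (e x) * indicator ((+) x ` Q n) y \<partial>count_space (Y n)) \<partial>M)
     = (\<integral>\<^sup>+x. (\<integral>\<^sup>+y. ennreal (e x) * indicator ((+) x ` Q n) y \<partial>M) \<partial>count_space (Y n))"
    by (rule nn_integral_count_space_nn_integral[OF Y_countable]) measurable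
  also have "\<dots> = (\<integral>\<^sup>+x. ennreal (e x) * ennreal b \<partial>count_space (Y n))"
    by (intro nn_integral_cong) (simp add: nn_integral_cmult_indicator emeasure_translate b_def)
  also have "\<dots> = (\<integral>\<^sup>+x. ennreal (e x) \<partial>count_space (Y n)) * ennreal b"
    by (rule nn_integral_multc) simp
  also have "ennreal C * ((\<integral>\<^sup>+x. ennreal (e x) \<partial>count_space (Y n)) * ennreal b) \<le> ennreal C * (ennreal (N powr q) * ennreal b)"
    using dN unfolding e_def by (intro mult_left_mono mult_right_mono) auto
  also have "\<dots> = ennreal (C * (N powr q * b))" using C b by (simp add: ennreal_mult)
  also have "C * (N powr q * b) = (Dn * N) powr q"
  proof -
    have "Dn * N = b powr (1 / q - 1) * real I powr (1 - 1 / q) * s * N" by (simp add: Dn_def b_def s_def)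
    also have "\<dots> powr q = b powr ((1 / q - 1) * q) * real I powr ((1 - 1 / q) * q) * s powr q * N powr q"
      by (simp only: powr_mult powr_powr)
    also have "(1 / q - 1) * q = - q + 1" using q1 by (simp add: field_simps)
    also have "(1 - 1 / q) * q = q - 1" using q1 by (simp add: field_simps)
    also have "b powr (- q + 1) = b powr (- q) * b" using b powr_add[of b "- q" 1] by simp
    finally show ?thesis by (simp add: C_def mult_ac)
  qed
  finally show ?thesis .
qed

text \<open>For every \<open>y \<in> xQ\<^sub>n\<close> the value \<open>|K(x\<^sup>-\<^sup>1z)|\<close> is at most \<open>g(y\<^sup>-\<^sup>1z)\<close>; the bound is its average over \<open>xQ\<^sub>n\<close>.\<close>
lemma h_le_conv: "h z \<le> (\<integral>\<^sup>+y. ennreal (D y * g (- y + z)) \<partial>M)"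
proof -
  define b where "b = measure M (Q n)"
  have b: "0 < b" unfolding b_def by (rule measure_Q_pos)
  have "h z \<le> (\<integral>\<^sup>+x. (\<integral>\<^sup>+y. ennreal (norm (d x)) * indicator ((+) x ` Q n) y * ennreal (g (- y + z) / b) \<partial>M) \<partial>count_space (Y n))"
    unfolding h_def
  proof (rule nn_integral_mono)
    fix x
    have "ennreal (norm (d x) * norm (K (- x + z))) = ennreal (norm (d x) * norm (K (- x + z)) / b) * ennreal b"
      using b by (simp add: ennreal_mult[symmetric])
    also have "\<dots> = (\<integral>\<^sup>+y. ennreal (norm (d x) * norm (K (- x + z)) / b) * indicator ((+) x ` Q n) y \<partial>M)"
      by (simp add: nn_integral_cmult_indicator emeasure_translate b_def)
    also have "\<dots> \<le> (\<integral>\<^sup>+y. ennreal (norm (d x)) * indicator ((+) x ` Q n) y * ennreal (g (- y + z) / b) \<partial>M)"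
    proof (rule nn_integral_mono)
      fix y
      show "ennreal (norm (d x) * norm (K (- x + z)) / b) * indicator ((+) x ` Q n) y
        \<le> ennreal (norm (d x)) * indicator ((+) x ` Q n) y * ennreal (g (- y + z) / b)"
      proof (cases "y \<in> (+) x ` Q n")
        case True
        then obtain t where t: "t \<in> Q n" "y = x + t" by blast
        have "t + (- y + z) = - x + z" unfolding t(2) minus_add add.assoc[symmetric] by simp
        then have "norm (K (- x + z)) \<le> g (- y + z)" using K_le_g[OF t(1), of "- y + z"] by simp
        then have "norm (d x) * norm (K (- x + z)) / b \<le> norm (d x) * (g (- y + z) / b)"
          using b by (simp add: divide_right_mono mult_left_mono)
        then show ?thesis using True b g_nonneg by (simp add: ennreal_mult[symmetric] ennreal_leI)
      qed simp
    qed
    finally show "ennreal (norm (d x) * norm (K (- x + z)))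
      \<le> (\<integral>\<^sup>+y. ennreal (norm (d x)) * indicator ((+) x ` Q n) y * ennreal (g (- y + z) / b) \<partial>M)" .
  qed
  also have "\<dots> = (\<integral>\<^sup>+y. (\<integral>\<^sup>+x. ennreal (norm (d x)) * indicator ((+) x ` Q n) y * ennreal (g (- y + z) / b) \<partial>count_space (Y n)) \<partial>M)"
    by (rule nn_integral_count_space_nn_integral[OF Y_countable, symmetric]) measurable
  also have "\<dots> = (\<integral>\<^sup>+y. ennreal (D y * g (- y + z)) \<partial>M)"
  proof (rule nn_integral_cong)
    fix y
    have "(\<integral>\<^sup>+x. ennreal (norm (d x)) * indicator ((+) x ` Q n) y * ennreal (g (- y + z) / b) \<partial>count_space (Y n))
      = ennreal (\<Sum>x\<in>near y. norm (d x)) * ennreal (g (- y + z) / b)"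
      by (subst nn_integral_multc) (auto simp: nn_integral_near)
    also have "\<dots> = ennreal (D y * g (- y + z))"
      using b g_nonneg by (simp add: ennreal_mult[symmetric] sum_nonneg D_def b_def)
    finally show "(\<integral>\<^sup>+x. ennreal (norm (d x)) * indicator ((+) x ` Q n) y * ennreal (g (- y + z) / b) \<partial>count_space (Y n))
      = ennreal (D y * g (- y + z))" .
  qed
  finally show ?thesis .
qed

lemma mh_le_conv: "ennreal (m z) * h z \<le> (\<integral>\<^sup>+y. ennreal ((m y * D y) * (w (- y + z) * g (- y + z))) \<partial>M)"
proof -
  have "ennreal (m z) * h z \<le> ennreal (m z) * (\<integral>\<^sup>+y. ennreal (D y * g (- y + z)) \<partial>M)"
    by (intro mult_left_mono h_le_conv) simp
  also have "\<dots> = (\<integral>\<^sup>+y. ennreal (m z) * ennreal (D y * g (- y + z)) \<partial>M)"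
    by (rule nn_integral_cmult[symmetric]) measurable
  also have "\<dots> \<le> (\<integral>\<^sup>+y. ennreal ((m y * D y) * (w (- y + z) * g (- y + z))) \<partial>M)"
  proof (rule nn_integral_mono)
    fix y
    have "m z * (D y * g (- y + z)) \<le> (m y * w (- y + z)) * (D y * g (- y + z))"
      by (intro mult_right_mono moderate_shift[OF w m] mult_nonneg_nonneg D_nonneg g_nonneg)
    then show "ennreal (m z) * ennreal (D y * g (- y + z)) \<le> ennreal ((m y * D y) * (w (- y + z) * g (- y + z)))"
      using m_nonneg by (simp add: ennreal_mult[symmetric] D_nonneg g_nonneg ennreal_leI mult_ac)
  qed
  finally show ?thesis .
qed

text \<open>\<open>enn2real\<close> sends infinity to 0; the second claim shows that this affects
  only a null set.\<close>

lemma
  shows h_norm: "(\<integral>\<^sup>+z. ennreal (enn2real (ennreal (m z) * h z) powr r) \<partial>M) \<le> ennreal ((Dn * N * \<theta>) powr r)"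
    and h_AE_finite: "AE z in M. ennreal (m z) * h z < \<infinity>"
proof -
  have G0: "0 \<le> w x * g x" for x by (simp add: w_nonneg g_nonneg)
  have F0: "0 \<le> m x * D x" for x by (simp add: m_nonneg D_nonneg)
  have [measurable]: "(\<lambda>y. m y * D y) \<in> borel_measurable M" "(\<lambda>y. w y * g y) \<in> borel_measurable M" by measurable
  have q1: "1 \<le> q" and r0: "0 < r" and DN: "0 \<le> Dn * N" using q_gt_1 r Dn_nonneg N by auto
  note Y1 = Young_convolution[of "\<lambda>y. m y * D y" "\<lambda>y. w y * g y", OF _ _ F0 G0 p(1) q1 r0 q DN \<theta>_nonneg D_norm g_norm]
  note Y2 = Young_convolution_AE_finite[of "\<lambda>y. m y * D y" "\<lambda>y. w y * g y", OF _ _ F0 G0 p(1) q1 r0 q DN \<theta>_nonneg D_norm g_norm]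
  show "(\<integral>\<^sup>+z. ennreal (enn2real (ennreal (m z) * h z) powr r) \<partial>M) \<le> ennreal ((Dn * N * \<theta>) powr r)"
  proof (rule Y1)
    show "ennreal (enn2real (ennreal (m z) * h z)) \<le> (\<integral>\<^sup>+y. ennreal ((m y * D y) * (w (- y + z) * g (- y + z))) \<partial>M)" for z
      using mh_le_conv[of z] by (simp add: ennreal_enn2real_if del: enn2real_mult)
  qed auto
  have "AE z in M. (\<integral>\<^sup>+y. ennreal ((m y * D y) * (w (- y + z) * g (- y + z))) \<partial>M) < \<infinity>"
    by (rule Y2) auto
  then show "AE z in M. ennreal (m z) * h z < \<infinity>"
    by eventually_elim (rule le_less_trans[OF mh_le_conv])
qed

text \<open>Makes the sum over \<open>Y n\<close> a continuous functional. Each value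
  \<open>V v x\<close> is replaced by its reproducing integral; after exchanging sum and integral,
  \<open>h\<close> in the space with weight m is paired with \<open>V v\<close> in the dual one, and
  1/m is at most w divided by m at the identity.\<close>

lemma voice_synthesis_bound:
  assumes v: "in_Lpw M (r / (r - 1)) w (V v)"
  shows "(\<integral>\<^sup>+x. ennreal (norm (d x) * norm (V v x)) \<partial>count_space (Y n))
     \<le> ennreal ((Dn * N * \<theta>) * (1 / m 0 * Lpw_norm M (r / (r - 1)) w (V v)))"
proof -
  define t where "t = r / (r - 1)"
  have t: "1 < t" "1 / r + 1 / t = 1" using r by (auto simp: t_def field_simps)
  note mi = moderate_inverse[OF w m]
  have mi0: "0 \<le> 1 / m y" for y using m_nonneg by simp
  have t0: "0 < t" using t by simp
  \<comment> \<open>The trivial translation converts the norm with weight \<open>w\<close> into the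
    one with weight 1/m, at the price \<open>1 / m 0\<close>.\<close>
  have lt: "ltrans 0 (V v) = V v" by (simp add: ltrans_def fun_eq_iff)
  have vt: "in_Lpw M t w (V v)" using v by (simp add: t_def)
  have v1: "in_Lpw M t (\<lambda>y. 1 / m y) (V v)"
    and v2: "Lpw_norm M t (\<lambda>y. 1 / m y) (V v) \<le> 1 / m 0 * Lpw_norm M t w (V v)"
    using in_Lpw_ltrans[OF w mi vt t0, of 0] Lpw_norm_ltrans[OF w mi vt t0, of 0] by (simp_all only: lt)
  define H where "H z = enn2real (ennreal (m z) * h z)" for z
  have [measurable]: "H \<in> borel_measurable M" unfolding H_def by measurable
  have rep: "ennreal (norm (V v x)) \<le> (\<integral>\<^sup>+y. ennreal (norm (V v y)) * ennreal (norm (K (- x + y))) \<partial>M)" for x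
    using integral_norm_bound_ennreal[OF voice_reproducing(1)[of v x]]
    by (simp add: voice_reproducing(2) norm_mult ennreal_mult norm_K_flip[of _ x])
  have "(\<integral>\<^sup>+x. ennreal (norm (d x) * norm (V v x)) \<partial>count_space (Y n))
    \<le> (\<integral>\<^sup>+x. (\<integral>\<^sup>+y. ennreal (norm (V v y)) * ennreal (norm (d x) * norm (K (- x + y))) \<partial>M) \<partial>count_space (Y n))"
  proof (rule nn_integral_mono)
    fix x
    have "ennreal (norm (d x) * norm (V v x)) \<le> ennreal (norm (d x)) * (\<integral>\<^sup>+y. ennreal (norm (V v y)) * ennreal (norm (K (- x + y))) \<partial>M)"
      using rep[of x] by (simp add: ennreal_mult mult_left_mono)
    also have "\<dots> = (\<integral>\<^sup>+y. ennreal (norm (V v y)) * ennreal (norm (d x) * norm (K (- x + y))) \<partial>M)"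
      by (subst nn_integral_cmult[symmetric]) (auto simp: ennreal_mult mult_ac)
    finally show "ennreal (norm (d x) * norm (V v x)) \<le> (\<integral>\<^sup>+y. ennreal (norm (V v y)) * ennreal (norm (d x) * norm (K (- x + y))) \<partial>M)" .
  qed
  also have "\<dots> = (\<integral>\<^sup>+y. (\<integral>\<^sup>+x. ennreal (norm (V v y)) * ennreal (norm (d x) * norm (K (- x + y))) \<partial>count_space (Y n)) \<partial>M)"
    by (rule nn_integral_count_space_nn_integral[OF Y_countable, symmetric]) measurable
  also have "\<dots> = (\<integral>\<^sup>+y. ennreal (norm (V v y)) * h y \<partial>M)"
    unfolding h_def by (intro nn_integral_cong nn_integral_cmult) simp
  also have "\<dots> \<le> (\<integral>\<^sup>+y. ennreal (H y * (1 / m y * norm (V v y))) \<partial>M)"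
  proof (rule nn_integral_mono_AE)
    show "AE y in M. ennreal (norm (V v y)) * h y \<le> ennreal (H y * (1 / m y * norm (V v y)))"
      using h_AE_finite
    proof eventually_elim
      case (elim y)
      have hf: "h y < \<infinity>"
      proof (rule ccontr)
        assume "\<not> h y < \<infinity>"
        then have "ennreal (m y) * h y = \<infinity>" using m_pos[of y] by (simp add: ennreal_mult_top less_top[symmetric])
        then show False using elim by simp
      qed
      then have "h y = ennreal (enn2real (h y))" by simp
      moreover have Hy: "H y = m y * enn2real (h y)" using m_nonneg[of y] by (simp add: H_def enn2real_mult)
      ultimately have "ennreal (norm (V v y)) * h y = ennreal (norm (V v y) * enn2real (h y))"
        by (metis ennreal_mult enn2real_nonneg norm_ge_zero)
      moreover have "H y * (1 / m y * norm (V v y)) = norm (V v y) * enn2real (h y)"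
        using Hy m_pos[of y] by simp
      ultimately show ?case by simp
    qed
  qed
  also have "\<dots> \<le> ennreal ((Dn * N * \<theta>) * Lpw_norm M t (\<lambda>y. 1 / m y) (V v))"
  proof (rule nn_integral_Holder[OF _ _ _ _ r t(2)])
    show "(\<lambda>y. 1 / m y * norm (V v y)) \<in> borel_measurable M" by measurable
    show "0 \<le> H y" for y by (simp add: H_def del: enn2real_mult)
    show "0 \<le> 1 / m y * norm (V v y)" for y using m_nonneg by simp
    show "0 \<le> Dn * N * \<theta>" using Dn_nonneg N \<theta>_nonneg by simp
    show "(\<integral>\<^sup>+y. ennreal (H y powr r) \<partial>M) \<le> ennreal ((Dn * N * \<theta>) powr r)" unfolding H_def by (rule h_norm)
    show "(\<integral>\<^sup>+y. ennreal ((1 / m y * norm (V v y)) powr t) \<partial>M) \<le> ennreal (Lpw_norm M t (\<lambda>y. 1 / m y) (V v) powr t)"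
      using nn_integral_Lpw_norm[OF v1 t0 mi0] by simp
  qed (auto simp: Lpw_norm_nonneg)
  also have "\<dots> \<le> ennreal ((Dn * N * \<theta>) * (1 / m 0 * Lpw_norm M t w (V v)))"
    using v2 Dn_nonneg N \<theta>_nonneg by (intro ennreal_leI mult_left_mono) auto
  finally show ?thesis by (simp add: t_def)
qed

text \<open>The preceding bound for \<open>\<pi> z u\<close>, whose voice transform is a translate
  of \<open>K\<close>, improves finiteness almost everywhere to finiteness at every point.\<close>

lemma h_finite: "h z < \<infinity>"
proof -
  have t: "1 < r / (r - 1)" using r by (simp add: field_simps)
  have "in_Lpw M (r / (r - 1)) w (V (\<pi> z u))"
    unfolding voice_rep by (rule ltrans_K_in_Lpw[OF weight_imp_moderate[OF w] t])
  from le_less_trans[OF voice_synthesis_bound[OF this]]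
  show ?thesis by (simp add: h_def voice_rep ltrans_def norm_K_flip[of z])
qed

text \<open>The functional given by the sum of \<open>d x\<close> times \<open>\<pi> x u\<close>:
  the pairing of \<open>\<pi> x u\<close> with \<open>v\<close> is the conjugate of
  \<open>V v x\<close>.\<close>

definition "Td v = (\<integral>x. d x * cnj (V v x) \<partial>count_space (Y n))"

lemma Td_integrable:
  assumes "in_Lpw M (r / (r - 1)) w (V v)"
  shows "integrable (count_space (Y n)) (\<lambda>x. d x * cnj (V v x))"
  using le_less_trans[OF voice_synthesis_bound[OF assms]]
  by (intro integrableI_bounded) (auto simp: norm_mult)

lemma Td_in_Sw_dual: "Td \<in> Sw_dual M w sc ip \<pi> u"
proof -
  define t where "t = r / (r - 1)"
  have t: "1 < t" using r by (simp add: t_def field_simps)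
  have vL: "in_Lpw M (r / (r - 1)) w (V v)" if "v \<in> Sw M w ip \<pi> u" for v
    using that t by (auto simp: Sw_def t_def)
  have lin: "Td (sc a v + sc b v') = cnj a * Td v + cnj b * Td v'"
    if "v \<in> Sw M w ip \<pi> u" "v' \<in> Sw M w ip \<pi> u" for a b v v'
  proof -
    have "Td (sc a v + sc b v') = (\<integral>x. cnj a * (d x * cnj (V v x)) + cnj b * (d x * cnj (V v' x)) \<partial>count_space (Y n))"
      unfolding Td_def voice_add voice_sc by (simp add: algebra_simps)
    also have "\<dots> = (\<integral>x. cnj a * (d x * cnj (V v x)) \<partial>count_space (Y n)) + (\<integral>x. cnj b * (d x * cnj (V v' x)) \<partial>count_space (Y n))"
      by (intro Bochner_Integration.integral_add integrable_mult_right Td_integrable vL that)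
    finally show ?thesis by (simp only: Td_def integral_mult_right_zero)
  qed
  have bnd: "norm (Td v) \<le> (Dn * N * \<theta> / m 0) * (\<Sum>s\<in>{t}. Lpw_norm M s w (V v))" if v: "v \<in> Sw M w ip \<pi> u" for v
  proof -
    have "ennreal (norm (Td v)) \<le> ennreal ((Dn * N * \<theta>) * (1 / m 0 * Lpw_norm M t w (V v)))"
      using integral_norm_bound_ennreal[OF Td_integrable[OF vL[OF v]]] voice_synthesis_bound[OF vL[OF v]]
      by (simp add: Td_def norm_mult t_def)
    moreover have "0 \<le> (Dn * N * \<theta>) * (1 / m 0 * Lpw_norm M t w (V v))"
      using Dn_nonneg N \<theta>_nonneg m_nonneg[of 0] by (simp add: Lpw_norm_nonneg)
    ultimately have "norm (Td v) \<le> (Dn * N * \<theta>) * (1 / m 0 * Lpw_norm M t w (V v))"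
      by (subst (asm) ennreal_le_iff) auto
    then show ?thesis by simp
  qed
  have "\<exists>P C. finite P \<and> P \<subseteq> {1<..} \<and>
         (\<forall>v \<in> Sw M w ip \<pi> u. norm (Td v) \<le> C * (\<Sum>p\<in>P. Lpw_norm M p w (V v)))"
    by (intro exI[of _ "{t}"] exI[of _ "Dn * N * \<theta> / m 0"] conjI ballI bnd) (use t in auto)
  then show ?thesis unfolding Sw_dual_def using lin by blast
qed

lemma ext_voice_Td: "ext_voice \<pi> u Td z = (\<integral>x. d x * K (- x + z) \<partial>count_space (Y n))"
proof -
  have "cnj (V (\<pi> z u) x) = K (- x + z)" for x
    using K_minus[of "- z + x"] by (simp add: voice_rep ltrans_def minus_add)
  then show ?thesis by (simp add: ext_voice_def Td_def)
qed

lemma Td_summable: "integrable (count_space (Y n)) (\<lambda>x. d x * K (- x + z))"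
  using h_finite[of z] by (intro integrableI_bounded) (auto simp: norm_mult h_def)

lemma
  shows Td_in_Co: "Td \<in> Co M w sc ip \<pi> u r m"
    and Td_Co_norm: "Co_norm M \<pi> u r m Td \<le> Dn * N * \<theta>"
proof -
  have r0: "0 < r" using r by simp
  have [measurable]: "ext_voice \<pi> u Td \<in> borel_measurable M"
    unfolding ext_voice_Td[abs_def] by (rule integral_count_space_measurable[OF Y_countable]) measurable
  have DN: "0 \<le> Dn * N * \<theta>" using Dn_nonneg N \<theta>_nonneg by simp
  have le: "m z * norm (ext_voice \<pi> u Td z) \<le> enn2real (ennreal (m z) * h z)" for z
  proof -
    have "ennreal (norm (ext_voice \<pi> u Td z)) \<le> h z"
      using integral_norm_bound_ennreal[OF Td_summable[of z]] by (simp add: ext_voice_Td h_def norm_mult)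
    then have "ennreal (m z * norm (ext_voice \<pi> u Td z)) \<le> ennreal (m z) * h z"
      using m_nonneg[of z] by (simp add: ennreal_mult mult_left_mono)
    moreover have fin: "ennreal (m z) * h z < \<infinity>" using h_finite[of z] by (simp add: ennreal_mult_less_top)
    ultimately have "enn2real (ennreal (m z * norm (ext_voice \<pi> u Td z))) \<le> enn2real (ennreal (m z) * h z)"
      by (intro enn2real_mono) auto
    then show ?thesis using m_nonneg[of z] by (simp del: enn2real_mult)
  qed
  have "(\<integral>\<^sup>+z. ennreal ((m z * norm (ext_voice \<pi> u Td z)) powr r) \<partial>M)
      \<le> (\<integral>\<^sup>+z. ennreal (enn2real (ennreal (m z) * h z) powr r) \<partial>M)"
    using r0 m_nonneg by (intro nn_integral_mono ennreal_leI powr_mono2 le) auto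
  also have "\<dots> \<le> ennreal ((Dn * N * \<theta>) powr r)" by (rule h_norm)
  finally have *: "(\<integral>\<^sup>+z. ennreal ((m z * norm (ext_voice \<pi> u Td z)) powr r) \<partial>M) \<le> ennreal ((Dn * N * \<theta>) powr r)" .
  have "in_Lpw M r m (ext_voice \<pi> u Td)"
    by (rule in_Lpw_bound[OF _ _ m_nonneg r0 DN *]) measurable
  then show "Td \<in> Co M w sc ip \<pi> u r m" using Td_in_Sw_dual by (simp add: Co_def)
  show "Co_norm M \<pi> u r m Td \<le> Dn * N * \<theta>"
    unfolding Co_norm_def by (rule Lpw_norm_bound[OF _ _ m_nonneg r0 DN *]) measurable
qed

end

theorem synthesis:
  fixes d :: "'g \<Rightarrow> complex"
  assumes sm: "(\<lambda>x. (m x * norm (d x)) powr q) summable_on Y n"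
  shows "\<exists>T \<in> Co M w sc ip \<pi> u r m.
           (\<forall>\<epsilon>>0. \<exists>F0. finite F0 \<and> F0 \<subseteq> Y n \<and>
              (\<forall>F. finite F \<and> F0 \<subseteq> F \<and> F \<subseteq> Y n \<longrightarrow>
                 Co_norm M \<pi> u r m (\<lambda>s. T s - emb ip (\<Sum>x\<in>F. sc (d x) (\<pi> x u)) s) < \<epsilon>)) \<and>
           Co_norm M \<pi> u r m T \<le> Dn * \<theta> * (infsum (\<lambda>x. (m x * norm (d x)) powr q) (Y n)) powr (1 / q)"
proof -
  define \<phi> where "\<phi> x = (m x * norm (d x)) powr q" for x
  define S where "S = infsum \<phi> (Y n)"
  have q1: "1 < q" by (rule q_gt_1)
  have \<phi>0: "0 \<le> \<phi> x" for x by (simp add: \<phi>_def)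
  have sm': "\<phi> summable_on Y n" using sm by (simp add: \<phi>_def[abs_def])
  have S0: "0 \<le> S" unfolding S_def by (intro infsum_nonneg \<phi>0)
  have dN: "(\<integral>\<^sup>+x. ennreal ((m x * norm (d x)) powr q) \<partial>count_space (Y n)) \<le> ennreal ((S powr (1 / q)) powr q)"
    using nn_integral_count_space_eq_infsum[OF sm' \<phi>0] q1 S0 by (simp add: \<phi>_def[abs_def] S_def powr_powr)
  have N0: "0 \<le> S powr (1 / q)" by simp
  \<comment> \<open>Here the bound \<open>N\<close> is the exact norm of the weighted
    coefficients.\<close>
  note T = Td_in_Co[OF dN N0] Td_Co_norm[OF dN N0]
  show ?thesis
  proof (rule bexI[OF _ T(1)], intro conjI allI impI)
    show "Co_norm M \<pi> u r m (Td d) \<le> Dn * \<theta> * (infsum (\<lambda>x. (m x * norm (d x)) powr q) (Y n)) powr (1 / q)"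
      using T(2) by (simp add: S_def \<phi>_def[abs_def] mult_ac)
    fix \<epsilon> :: real assume \<epsilon>: "0 < \<epsilon>"
    \<comment> \<open>Chosen so that a tail of norm at most \<epsilon> / (2 (Dn \<theta> + 1)) costs
      less than \<epsilon>; the added 1 admits \<open>Dn * \<theta> = 0\<close>.\<close>
    define \<eta> where "\<eta> = (\<epsilon> / (2 * (Dn * \<theta> + 1))) powr q"
    have DT: "0 \<le> Dn * \<theta>" using Dn_nonneg \<theta>_nonneg by simp
    have \<eta>: "0 < \<eta>" unfolding \<eta>_def using \<epsilon> DT by (simp add: add_nonneg_pos)
    have "(sum \<phi> \<longlongrightarrow> S) (finite_subsets_at_top (Y n))"
      using has_sum_infsum[OF sm'] by (simp add: has_sum_def S_def)
    then have "eventually (\<lambda>F. dist (sum \<phi> F) S < \<eta>) (finite_subsets_at_top (Y n))"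
      using \<eta> by (rule tendstoD)
    then obtain F0 where F0: "finite F0" "F0 \<subseteq> Y n"
      "\<forall>F. finite F \<and> F0 \<subseteq> F \<and> F \<subseteq> Y n \<longrightarrow> dist (sum \<phi> F) S < \<eta>"
      unfolding eventually_finite_subsets_at_top by (elim exE conjE) (rule that)
    show "\<exists>F0. finite F0 \<and> F0 \<subseteq> Y n \<and>
              (\<forall>F. finite F \<and> F0 \<subseteq> F \<and> F \<subseteq> Y n \<longrightarrow>
                 Co_norm M \<pi> u r m (\<lambda>s. Td d s - emb ip (\<Sum>x\<in>F. sc (d x) (\<pi> x u)) s) < \<epsilon>)"
    proof (intro exI[of _ F0] conjI allI impI F0(1,2))
      fix F assume "finite F \<and> F0 \<subseteq> F \<and> F \<subseteq> Y n"
      then have F: "finite F" "F0 \<subseteq> F" "F \<subseteq> Y n" by auto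
      define d' where "d' x = (if x \<in> F then 0 else d x)" for x
      have "infsum (\<lambda>x. (m x * norm (d' x)) powr q) (Y n) = infsum \<phi> (Y n - F)"
        using q1 by (intro infsum_cong_neutral) (auto simp: d'_def \<phi>_def)
      also have "\<dots> = S - sum \<phi> F"
        using infsum_Diff[OF sm' summable_on_finite[OF F(1)] F(3)] F(1) by (simp add: S_def)
      also have "\<dots> \<le> \<eta>" using F0(3)[rule_format, of F] F by (simp add: dist_real_def)
      finally have le: "infsum (\<lambda>x. (m x * norm (d' x)) powr q) (Y n) \<le> \<eta>" .
      have sd: "(\<lambda>x. (m x * norm (d' x)) powr q) summable_on Y n"
        by (rule summable_on_comparison_test[OF sm']) (auto simp: d'_def \<phi>_def)
      define N where "N = \<epsilon> / (2 * (Dn * \<theta> + 1))"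
      have N: "0 < N" unfolding N_def using \<epsilon> DT by (simp add: add_nonneg_pos)
      have dN': "(\<integral>\<^sup>+x. ennreal ((m x * norm (d' x)) powr q) \<partial>count_space (Y n)) \<le> ennreal (N powr q)"
        using nn_integral_count_space_eq_infsum[OF sd] le by (simp add: \<eta>_def N_def ennreal_leI)
      \<comment> \<open>The norm of \<open>Co\<close> sees a functional only at the vectors
        \<open>\<pi> z u\<close>. There the remainder agrees with the functional of the tail
        \<open>d'\<close>, to which the same norm bound applies.\<close>
      have ev: "ext_voice \<pi> u (\<lambda>s. Td d s - emb ip (\<Sum>x\<in>F. sc (d x) (\<pi> x u)) s) = ext_voice \<pi> u (Td d')"
      proof
        fix z
        have fs: "(\<integral>x. (if x \<in> F then d x * K (- x + z) else 0) \<partial>count_space (Y n)) = (\<Sum>x\<in>F. d x * K (- x + z))"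
        proof -
          have "(\<integral>x. (if x \<in> F then d x * K (- x + z) else 0) \<partial>count_space (Y n))
            = (\<Sum>x | x \<in> Y n \<and> (if x \<in> F then d x * K (- x + z) else 0) \<noteq> 0. (if x \<in> F then d x * K (- x + z) else 0))"
            by (rule lebesgue_integral_count_space_finite_support) (use F(1) in \<open>auto intro: finite_subset\<close>)
          also have "\<dots> = (\<Sum>x\<in>F. d x * K (- x + z))"
            using F by (intro sum.mono_neutral_cong_left) auto
          finally show ?thesis .
        qed
        have i1: "integrable (count_space (Y n)) (\<lambda>x. d' x * K (- x + z))" by (rule Td_summable[OF dN' less_imp_le[OF N]])
        have i2: "integrable (count_space (Y n)) (\<lambda>x. if x \<in> F then d x * K (- x + z) else 0)"
          using Bochner_Integration.integrable_diff[OF Td_summable[OF dN N0, of z] i1]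
          by (rule Bochner_Integration.integrable_cong[THEN iffD1, rotated 2]) (auto simp: d'_def)
        have "ext_voice \<pi> u (Td d) z = (\<integral>x. d' x * K (- x + z) + (if x \<in> F then d x * K (- x + z) else 0) \<partial>count_space (Y n))"
          unfolding ext_voice_Td[OF dN N0] by (intro Bochner_Integration.integral_cong) (auto simp: d'_def)
        also have "\<dots> = ext_voice \<pi> u (Td d') z + (\<Sum>x\<in>F. d x * K (- x + z))"
          unfolding Bochner_Integration.integral_add[OF i1 i2] fs ext_voice_Td[OF dN' less_imp_le[OF N]] ..
        finally show "ext_voice \<pi> u (\<lambda>s. Td d s - emb ip (\<Sum>x\<in>F. sc (d x) (\<pi> x u)) s) z = ext_voice \<pi> u (Td d') z"
          by (simp add: ext_voice_def emb_def ip_sum_left ip_sc_left ip_rep_rep)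
      qed
      have "Co_norm M \<pi> u r m (\<lambda>s. Td d s - emb ip (\<Sum>x\<in>F. sc (d x) (\<pi> x u)) s) \<le> Dn * N * \<theta>"
        using Td_Co_norm[OF dN' less_imp_le[OF N]] by (simp add: Co_norm_def ev)
      also have "\<dots> = (Dn * \<theta>) * (\<epsilon> / 2) / (Dn * \<theta> + 1)" by (simp add: N_def field_simps)
      also have "\<dots> < \<epsilon>"
      proof -
        have "(Dn * \<theta>) * (\<epsilon> / 2) \<le> (Dn * \<theta> + 1) * (\<epsilon> / 2)" using \<epsilon> by (intro mult_right_mono) auto
        also have "\<dots> < (Dn * \<theta> + 1) * \<epsilon>" using \<epsilon> DT by (intro mult_strict_left_mono) auto
        finally have "(Dn * \<theta>) * (\<epsilon> / 2) < (Dn * \<theta> + 1) * \<epsilon>" .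
        moreover have "0 < Dn * \<theta> + 1" using DT by linarith
        ultimately show ?thesis by (simp only: pos_divide_less_eq mult.commute[of \<epsilon>])
      qed
      finally show "Co_norm M \<pi> u r m (\<lambda>s. Td d s - emb ip (\<Sum>x\<in>F. sc (d x) (\<pi> x u)) s) < \<epsilon>" .
    qed
  qed
qed

end

theorem mainTheorem2:
  fixes M :: "('g::{topological_group_add,t2_space,second_countable_topology}) measure"
    and \<Delta> w m :: "'g \<Rightarrow> real"
    and sc :: "complex \<Rightarrow> 'h::ab_group_add \<Rightarrow> 'h" and ip :: "'h \<Rightarrow> 'h \<Rightarrow> complex"
    and \<pi> :: "'g \<Rightarrow> 'h \<Rightarrow> 'h" and u :: 'h
    and r p q :: real
    and Q Y X :: "nat \<Rightarrow> 'g set" and I :: nat and \<psi> :: "nat \<Rightarrow> 'g \<Rightarrow> 'g \<Rightarrow> real"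
    and S :: "nat \<Rightarrow> ('g \<Rightarrow> complex) \<Rightarrow> 'g \<Rightarrow> complex"
  assumes G: "lcsc_group TYPE('g)"
    and haar: "left_haar M"
    and modular: "modular_function M \<Delta>"
    and w: "weight w"
    and H: "complex_hilbert sc ip"
    and rep: "unitary_rep sc ip \<pi>"
    and isometry: "\<forall>v. in_Lp M 2 (voice ip \<pi> u v) \<and> Lp_norm M 2 (voice ip \<pi> u v) = hnorm ip v"
    and standing: "\<forall>s>1. in_Lpw M s w (kernel ip \<pi> u)"
    and r: "1 < r"
    and m: "moderate w m"
    and dense: "\<forall>f \<in> Mspace M r m (kernel ip \<pi> u). \<forall>\<epsilon>>0. \<exists>F (c :: 'g \<Rightarrow> complex). finite F \<and>
                  Lpw_norm M r m (\<lambda>y. f y - (\<Sum>x\<in>F. c x * ltrans x (kernel ip \<pi> u) y)) < \<epsilon>"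
    and disc: "discretization M Q Y I \<psi> X"
    and p: "1 \<le> p" "p < r"
    and Kp: "\<forall>n. in_Lpw M p w (kernel ip \<pi> u) \<and>
                 in_Lpw M p (\<lambda>x. w x * \<Delta> x powr (- 1 / p)) (kernel ip \<pi> u) \<and>
                 in_Lpw M p w (\<lambda>x. complex_of_real (osc (Q n) (kernel ip \<pi> u) x)) \<and>
                 in_Lpw M p (\<lambda>x. w x * \<Delta> x powr (- 1 / p))
                    (\<lambda>x. complex_of_real (osc (Q n) (kernel ip \<pi> u) x))"
    and S: "\<forall>n. right_inverse_on M r m (Tn M \<psi> X (kernel ip \<pi> u) n) (S n)"
    and q: "1 / q + 1 / p = 1 + 1 / r"
  shows
    "(\<forall>\<epsilon>>0. \<forall>T \<in> Co M w sc ip \<pi> u r m. \<exists>n0. \<forall>n\<ge>n0. \<exists>c :: 'g \<Rightarrow> complex.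
        Co_norm M \<pi> u r m (\<lambda>s. T s - emb ip (\<Sum>x\<in>X n. sc (c x) (\<pi> x u)) s) \<le> \<epsilon> \<and>
        (\<Sum>x\<in>X n. (norm (c x) * m x) powr r) powr (1 / r)
          \<le> (measure M (Q n) powr (1 - 1 / r) * Sup (w ` Q n) *
              op_norm_on M r m ((Tn M \<psi> X (kernel ip \<pi> u) n) ` {F. in_Lpw M r m F}) (S n))
             * (1 + \<epsilon>) * Co_norm M \<pi> u r m T)
     \<and>
     (\<forall>n (d :: 'g \<Rightarrow> complex). (\<lambda>x. (m x * norm (d x)) powr q) summable_on Y n \<longrightarrow>
        (\<exists>T \<in> Co M w sc ip \<pi> u r m.
           (\<forall>\<epsilon>>0. \<exists>F0. finite F0 \<and> F0 \<subseteq> Y n \<and>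
              (\<forall>F. finite F \<and> F0 \<subseteq> F \<and> F \<subseteq> Y n \<longrightarrow>
                 Co_norm M \<pi> u r m (\<lambda>s. T s - emb ip (\<Sum>x\<in>F. sc (d x) (\<pi> x u)) s) < \<epsilon>)) \<and>
           Co_norm M \<pi> u r m T
             \<le> (measure M (Q n) powr (1 / q - 1) * real I powr (1 - 1 / q) * Sup (w ` Q n) *
                 max (Lpw_norm M p w
                        (\<lambda>x. complex_of_real (osc (Q n) (kernel ip \<pi> u) x + norm (kernel ip \<pi> u x))))
                     (Lpw_norm M p (\<lambda>x. w x * \<Delta> x powr (- 1 / p))
                        (\<lambda>x. complex_of_real (osc (Q n) (kernel ip \<pi> u) x + norm (kernel ip \<pi> u x)))))
               * (infsum (\<lambda>x. (m x * norm (d x)) powr q) (Y n)) powr (1 / q)))"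
proof -
  interpret discretized M sc ip \<pi> u w Q Y X I \<psi> m r
    by unfold_locales (fact G haar H rep isometry w standing disc m r)+
  have syn: "synthesis M sc ip \<pi> u w Q Y X I \<psi> m r \<Delta> p q n" for n
    by unfold_locales (use assms in blast)+
  show ?thesis
    using sparse_approximation[OF dense S]
      synthesis.synthesis[OF syn, unfolded synthesis.Dn_def[OF syn] synthesis.\<theta>_def[OF syn] synthesis.g_def[OF syn]]
    by (intro conjI allI impI ballI) assumption+
qed

end
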